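(* Let $\xi=\{x_i:i\in\mathcal{I}\}\subset\mathbb{R}^d\setminus\{0\}$ be a locally finite collection of points with finite or countable index set $\mathcal{I}$, let $g:\mathbb{R}^d\to[0,\infty)$ be Borel measurable and such that $\{g(x):x\in\xi\}$ is locally finite, and let $\{S,S_i:i\in\mathcal{I}\}$ be i.i.d. positive random variables. Let $Y_i=g(x_i)/S_i$, $N=\sum_{i\in\mathcal{I}}\delta_{Y_i}$ (as a point process on $(0,\infty)$), $p_i(t)=\mathbb{P}(0<g(x_i)/S\le t)$, $M(t)=\sum_{i\in\mathcal{I}}p_i(t)$, and let $Z$ be a Poisson process on $(0,\infty)$ with mean measure $M$. Then for every $\tau>0$, $$\frac{1\wedge M(\tau)^{-1}}{32}\sum_{i\in\mathcal{I}}p_i(\tau)^2\ \le\ d_{\mathrm{TV}}\big(\mathcal{L}(Z|_\tau),\mathcal{L}(N|_\tau)\big)\ \le\ \sum_{i\in\mathcal{I}}p_i(\tau)^2\ \le\ M(\tau)\sup_{i\in\mathcal{I}}p_i(\tau).$$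
   Context: A measure $\eta$ on $(0,\infty)$ is identified with $\eta(t):=\eta((0,t])$, so the mean measure $M$ is the sum over $i$ of the restrictions to $(0,\infty)$ of the laws of $Y_i$; $\eta|_\tau$ denotes the restriction of $\eta$ to $(0,\tau]$. Points with $Y_i=0$ are disregarded in $N$. Point processes on $(0,\infty)$ are regarded as random elements of the space $\mathcal{H}$ of locally finite point measures on $(0,\infty)$, equipped with the Borel $\sigma$-algebra $\mathcal{B}(\mathcal{H})$ of the vague topology; in particular $N$ and $Z$ are regarded as random elements of $\mathcal{H}$. $\mathcal{L}(X)$ is the distribution of $X$, and $d_{\mathrm{TV}}(\nu_1,\nu_2)=\sup_A|\nu_1(A)-\nu_2(A)|$, the supremum being over measurable sets $A$. Conventions: $a\wedge b=\min\{a,b\}$, $1/0=\infty$, $1/\infty=0$, $0\cdot\infty=0$. *)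

theory Defs
  imports "HOL-Probability.Probability"
begin

text \<open>Local finiteness is relative to the space \<open>X\<close>: points may accumulate only at the boundary of
  \<open>X\<close> or at infinity.\<close>

definition locally_finite_subset :: "'a::topological_space set \<Rightarrow> 'a set \<Rightarrow> bool" where
  "locally_finite_subset X A \<longleftrightarrow> A \<subseteq> X \<and> (\<forall>K. compact K \<and> K \<subseteq> X \<longrightarrow> finite (A \<inter> K))"

abbreviation pos_borel :: "real measure" where
  "pos_borel \<equiv> restrict_space borel {0<..}"

text \<open>The measure \<open>\<Sum>i\<in>I. \<delta>(y i)\<close> on \<open>(0,\<infinity>)\<close>, as the image of counting measure; indices with
  \<open>y i \<le> 0\<close> do not contribute.\<close>

definition dirac_sum :: "'i set \<Rightarrow> ('i \<Rightarrow> real) \<Rightarrow> real measure" where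
  "dirac_sum I y = distr (count_space {i \<in> I. 0 < y i}) pos_borel y"

text \<open>The space \<open>\<H>\<close>. A locally finite point measure on \<open>(0,\<infinity>)\<close> has at most countably many atoms, so
  indexing by sets of naturals is no restriction. Measures in \<open>\<H>\<close> may be infinite on \<open>(0,t]\<close>.\<close>

definition lf_point_measures :: "real measure set" where
  "lf_point_measures =
     {\<eta>. (\<exists>(J :: nat set) y. \<eta> = dirac_sum J y) \<and>
         (\<forall>K. compact K \<and> K \<subseteq> {0<..} \<longrightarrow> emeasure \<eta> K < \<infinity>)}"

text \<open>Continuous functions on \<open>(0,\<infinity>)\<close> with compact support; the values outside \<open>(0,\<infinity>)\<close> are
  irrelevant.\<close>

definition vague_test_functions :: "(real \<Rightarrow> real) set" where
  "vague_test_functions =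
     {f. continuous_on {0<..} f \<and>
         (\<exists>K. compact K \<and> K \<subseteq> {0<..} \<and> (\<forall>x \<in> {0<..} - K. f x = 0))}"

definition vague_topology :: "real measure topology" where
  "vague_topology = topology_generated_by
     {{\<eta> \<in> lf_point_measures. (LINT x|\<eta>. f x) \<in> U} | f U. f \<in> vague_test_functions \<and> open U}"

definition vague_borel :: "real measure measure" where
  "vague_borel = sigma lf_point_measures {U. openin vague_topology U}"

text \<open>\<open>\<eta>|\<^sub>\<tau>\<close>, that is \<open>B \<mapsto> \<eta>(B \<inter> (0,\<tau>])\<close>, still as a measure on \<open>(0,\<infinity>)\<close>.\<close>

definition restrict_upto :: "real \<Rightarrow> real measure \<Rightarrow> real measure" where
  "restrict_upto \<tau> \<eta> = density \<eta> (indicator {0<..\<tau>})"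

text \<open>The point process \<open>\<Sum>i\<in>I. \<delta>(Y i)\<close> on \<open>(0,\<infinity>)\<close> as an \<open>\<H>\<close>-valued map. When its mean measure is
  locally finite, the sum belongs to \<open>\<H>\<close> almost surely; the exceptional outcomes are sent to the zero
  measure.\<close>

definition point_process :: "'i set \<Rightarrow> ('i \<Rightarrow> '\<omega> \<Rightarrow> real) \<Rightarrow> '\<omega> \<Rightarrow> real measure" where
  "point_process I Y \<omega> =
     (if dirac_sum I (\<lambda>i. Y i \<omega>) \<in> lf_point_measures then dirac_sum I (\<lambda>i. Y i \<omega>)
      else null_measure pos_borel)"

text \<open>The sum over \<open>i\<close> of the restrictions to \<open>(0,\<infinity>)\<close> of the laws of \<open>Y i\<close>.\<close>

definition mean_measure :: "'\<omega> measure \<Rightarrow> 'i set \<Rightarrow> ('i \<Rightarrow> '\<omega> \<Rightarrow> real) \<Rightarrow> real measure" where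
  "mean_measure P I Y =
     measure_of {0<..} (sets pos_borel) (\<lambda>B. \<Sum>\<^sub>\<infinity>i\<in>I. emeasure (distr P borel (Y i)) B)"

text \<open>A Poisson process is in particular a random element of \<open>\<H>\<close>. The Poisson law with infinite mean
  is the point mass at \<open>\<infinity>\<close>, so the definition forces \<open>\<mu>\<close> to be finite on compact subsets of
  \<open>(0,\<infinity>)\<close>.\<close>

definition poisson_process :: "'\<omega> measure \<Rightarrow> real measure \<Rightarrow> ('\<omega> \<Rightarrow> real measure) \<Rightarrow> bool" where
  "poisson_process Q \<mu> Z \<longleftrightarrow>
     Z \<in> Q \<rightarrow>\<^sub>M vague_borel \<and>
     (\<forall>B \<in> sets pos_borel.
        if emeasure \<mu> B = \<infinity> then (AE \<omega> in Q. emeasure (Z \<omega>) B = \<infinity>)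
        else (\<forall>k::nat. measure Q {\<omega> \<in> space Q. emeasure (Z \<omega>) B = of_nat k} =
                exp (- measure \<mu> B) * measure \<mu> B ^ k / fact k)) \<and>
     (\<forall>F. finite F \<and> F \<subseteq> sets pos_borel \<and> disjoint F \<longrightarrow>
        prob_space.indep_vars Q (\<lambda>_. borel) (\<lambda>B \<omega>. emeasure (Z \<omega>) B) F)"

definition tv_dist :: "'a measure \<Rightarrow> 'a measure \<Rightarrow> real" where
  "tv_dist \<nu>\<^sub>1 \<nu>\<^sub>2 = (SUP A \<in> sets \<nu>\<^sub>1. \<bar>measure \<nu>\<^sub>1 A - measure \<nu>\<^sub>2 A\<bar>)"

end

theory Submission
  imports Defs "HOL-Library.Function_Algebras"
begin

text \<open>Both processes restricted to \<open>(0,\<tau>]\<close> are compared through their numbers of points in finitely many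
disjoint cells. For such counts the statement is about sums of independent random vectors, the
\<open>i\<close>-th of which is \<open>0\<close> or the unit vector of the cell that contains \<open>Y\<^sub>i\<close>; the counts of the Poisson
process are independent Poisson variables with the same means.

\<^bold>\<open>Upper bound.\<close> Le Cam's argument: a Poisson vector whose mean is a sum is the convolution of the Poisson
vectors of the summands (\<open>mpois_add\<close>), distances add up under convolution (\<open>pmf_close_conv\<close>), and a single
summand with hitting probability \<open>p\<close> is within \<open>p (1 - exp (-p)) \<le> p\<^sup>2\<close> of its Poisson vector
(\<open>le_cam_single\<close>). Infinite index sets are reached by truncation: dropping all indices outside a finite set
changes either law by at most the sum of the dropped probabilities. The resulting bound does not depend
on the cells, so it passes to all Borel sets of the vague topology: the events that depend on the counts in the
dyadic cells \<open>(\<tau> k / 2\<^sup>m, \<tau> (k+1) / 2\<^sup>m]\<close> with \<open>1 \<le> k < 2\<^sup>m\<close> form an algebra, every vaguely open set is a countable union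
of them (\<open>open_determined_by_grid\<close>), and a bound for the difference of two measures on an algebra
extends to the generated sigma-algebra (\<open>measure_diff_bound_on_generating_algebra\<close>). Cells
that stay away from \<open>0\<close> suffice, which is why \<open>M(\<tau>)\<close> may be infinite here: the mean measure is finite on
compact subsets of \<open>(0,\<infinity>)\<close> because a Poisson process with this mean exists as an element of \<open>\<H>\<close>.

\<^bold>\<open>Lower bound.\<close> If \<open>M(\<tau>)\<close> is infinite, the left-hand side is \<open>0\<close>. Otherwise the total numbers of points in \<open>(0,\<tau>]\<close>
already differ enough. This is the Stein argument of Barbour and Hall (\<open>barbour_hall_finite\<close>): with
\<open>f(n) = l h(n+1) - n h(n)\<close> the mean of \<open>f\<close> vanishes under the Poisson law with mean \<open>l\<close> (\<open>pois_stein\<close>), and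
under a sum \<open>W\<close> of independent Bernoulli variables it is
\<open>\<Sum>i. p\<^sub>i\<^sup>2 E (h(W\<^sub>i + 2) - h(W\<^sub>i + 1))\<close>, where \<open>W\<^sub>i\<close> omits the \<open>i\<close>-th variable (\<open>pbin_stein\<close>). For
\<open>h(n) = x exp (- x\<^sup>2 / c)\<close> with \<open>x = n - l\<close> and \<open>c\<close> a large multiple of \<open>max 1 l\<close>, all these increments have mean at
least \<open>1/2\<close>, while the range of \<open>f\<close> is of order \<open>max 1 l\<close>.\<close>

section \<open>Closeness of discrete laws\<close>

text \<open>Total variation distance at most \<open>d\<close>, in the functional form, which is the one that is stable under
convolution.\<close>

definition pmf_close :: "real \<Rightarrow> 'a pmf \<Rightarrow> 'a pmf \<Rightarrow> bool" where
  "pmf_close d p q \<longleftrightarrow>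
     (\<forall>h. (\<forall>x. 0 \<le> h x \<and> h x \<le> 1) \<longrightarrow>
        \<bar>measure_pmf.expectation p h - measure_pmf.expectation q h\<bar> \<le> d)"

lemma integrable_pmf_unit:
  fixes h :: "'a \<Rightarrow> real"
  assumes "\<And>x. 0 \<le> h x \<and> h x \<le> 1"
  shows "integrable (measure_pmf p) h"
  by (rule measure_pmf.integrable_const_bound[where B=1]) (use assms in auto)

lemma expectation_unit:
  fixes h :: "'a \<Rightarrow> real"
  assumes "\<And>x. 0 \<le> h x \<and> h x \<le> 1"
  shows "0 \<le> measure_pmf.expectation p h \<and> measure_pmf.expectation p h \<le> 1"
proof -
  have "measure_pmf.expectation p h \<le> measure_pmf.expectation p (\<lambda>_. 1)"
    by (rule integral_mono) (use assms integrable_pmf_unit in auto)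
  then show ?thesis using assms by (simp add: Bochner_Integration.integral_nonneg)
qed

lemma pmf_closeD:
  "pmf_close d p q \<Longrightarrow> (\<And>x. 0 \<le> h x \<and> h x \<le> 1) \<Longrightarrow>
    \<bar>measure_pmf.expectation p h - measure_pmf.expectation q h\<bar> \<le> d"
  unfolding pmf_close_def by auto

lemma pmf_closeD_sets:
  fixes p q :: "'a pmf"
  assumes "pmf_close d p q"
  shows "\<bar>measure p E - measure q E\<bar> \<le> d"
  using pmf_closeD[OF assms, of "indicator E"] by (auto simp: indicator_def)

text \<open>Replacing \<open>h\<close> by \<open>1 - h\<close> changes the sign of the difference.\<close>

lemma pmf_close_one_sided:
  fixes p q :: "'a pmf"
  assumes "\<And>h. (\<And>x. 0 \<le> h x \<and> h x \<le> 1) \<Longrightarrow>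
     measure_pmf.expectation p h - measure_pmf.expectation q h \<le> d"
  shows "pmf_close d p q"
  unfolding pmf_close_def
proof (intro allI impI)
  fix h :: "'a \<Rightarrow> real"
  assume h: "\<forall>x. 0 \<le> h x \<and> h x \<le> 1"
  have e: "measure_pmf.expectation r (\<lambda>x. 1 - h x) = 1 - measure_pmf.expectation r h" for r
    using h by (subst Bochner_Integration.integral_diff) (auto intro: integrable_pmf_unit)
  have "measure_pmf.expectation p h - measure_pmf.expectation q h \<le> d" using assms h by blast
  moreover have "measure_pmf.expectation p (\<lambda>x. 1 - h x) - measure_pmf.expectation q (\<lambda>x. 1 - h x) \<le> d"
    by (rule assms) (use h in auto)
  ultimately show "\<bar>measure_pmf.expectation p h - measure_pmf.expectation q h\<bar> \<le> d"
    unfolding e by linarith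
qed

text \<open>The test function that maximises the difference is the indicator of the set where the first
probability mass function dominates the second.\<close>

lemma pmf_close_setsI:
  fixes p q :: "'a pmf"
  assumes "\<And>E. \<bar>measure p E - measure q E\<bar> \<le> d"
  shows "pmf_close d p q"
proof (rule pmf_close_one_sided)
  fix h :: "'a \<Rightarrow> real"
  assume h: "\<And>x. 0 \<le> h x \<and> h x \<le> 1"
  define E where "E = {x. pmf q x \<le> pmf p x}"
  have ex: "measure_pmf.expectation r f = (LINT x|count_space UNIV. pmf r x * f x)"
    for r and f :: "'a \<Rightarrow> real"
    unfolding measure_pmf_eq_density by (subst integral_density) auto
  have int: "integrable (count_space UNIV) (\<lambda>x. pmf r x * f x)"
    if "\<And>x. 0 \<le> f x \<and> f x \<le> 1" for r and f :: "'a \<Rightarrow> real"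
    by (rule Bochner_Integration.integrable_bound[OF integrable_pmf[of UNIV r]])
       (use that in \<open>auto intro!: mult_left_le\<close>)
  have "measure_pmf.expectation p h - measure_pmf.expectation q h
      = (LINT x|count_space UNIV. pmf p x * h x - pmf q x * h x)"
    unfolding ex by (subst Bochner_Integration.integral_diff) (use h int in auto)
  also have "\<dots> \<le> (LINT x|count_space UNIV. pmf p x * indicator E x - pmf q x * indicator E x)"
  proof (rule integral_mono)
    fix x
    have "(pmf p x - pmf q x) * h x \<le> (pmf p x - pmf q x) * indicator E x"
    proof (cases "x \<in> E")
      case True
      then show ?thesis using h[of x] by (auto simp: E_def intro!: mult_left_le)
    next
      case False
      then show ?thesis using h[of x] by (auto simp: E_def intro!: mult_nonpos_nonneg)
    qed
    then show "pmf p x * h x - pmf q x * h x \<le> pmf p x * indicator E x - pmf q x * indicator E x"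
      by (simp add: algebra_simps)
  qed (use h in \<open>auto intro!: Bochner_Integration.integrable_diff int simp: indicator_def\<close>)
  also have "\<dots> = measure_pmf.expectation p (indicator E) - measure_pmf.expectation q (indicator E)"
    unfolding ex by (subst Bochner_Integration.integral_diff) (auto intro!: int simp: indicator_def)
  also have "\<dots> = measure p E - measure q E" by simp
  also have "\<dots> \<le> d" using assms[of E] by linarith
  finally show "measure_pmf.expectation p h - measure_pmf.expectation q h \<le> d" .
qed

lemma pmf_close_mono: "pmf_close d p q \<Longrightarrow> d \<le> d' \<Longrightarrow> pmf_close d' p q"
  unfolding pmf_close_def by (meson order_trans)

lemma pmf_close_trans: "pmf_close d p q \<Longrightarrow> pmf_close d' q r \<Longrightarrow> pmf_close (d + d') p r"
  unfolding pmf_close_def by (smt (verit, best))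

lemma pmf_close_refl: "0 \<le> d \<Longrightarrow> pmf_close d p p"
  unfolding pmf_close_def by auto

lemma pmf_close_return:
  "pmf_close (1 - pmf p x) p (return_pmf x)"
proof (rule pmf_close_setsI)
  fix E
  have "measure p {x} = pmf p x" by (simp add: measure_pmf_single)
  moreover have "measure p {x} \<le> measure p E" if "x \<in> E"
    by (rule measure_pmf.finite_measure_mono) (use that in auto)
  moreover have "measure p {x} \<le> 1 - measure p E" if "x \<notin> E"
    using measure_pmf.finite_measure_mono[of "{x}" "- E" p] that
    by (auto simp: measure_pmf.prob_compl[of E p, simplified] Compl_eq_Diff_UNIV)
  ultimately show "\<bar>measure p E - measure (return_pmf x) E\<bar> \<le> 1 - pmf p x"
    using measure_pmf.prob_le_1[of p E] by (cases "x \<in> E") (auto simp: measure_return_pmf)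
qed

text \<open>The law of the sum of two independent variables.\<close>

definition conv_pmf :: "'v::plus pmf \<Rightarrow> 'v pmf \<Rightarrow> 'v pmf" where
  "conv_pmf p q = bind_pmf p (\<lambda>a. map_pmf (\<lambda>b. a + b) q)"

lemma expectation_bind_unit:
  fixes h :: "'b \<Rightarrow> real"
  assumes "\<And>x. 0 \<le> h x \<and> h x \<le> 1"
  shows "measure_pmf.expectation (bind_pmf p q) h
     = measure_pmf.expectation p (\<lambda>a. measure_pmf.expectation (q a) h)"
proof -
  have "ennreal (measure_pmf.expectation (bind_pmf p q) h) = (\<integral>\<^sup>+x. h x \<partial>bind_pmf p q)"
    by (rule nn_integral_eq_integral[symmetric]) (use assms in \<open>auto intro: integrable_pmf_unit\<close>)
  also have "\<dots> = (\<integral>\<^sup>+a. \<integral>\<^sup>+x. h x \<partial>q a \<partial>p)"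
    by simp
  also have "\<dots> = (\<integral>\<^sup>+a. ennreal (measure_pmf.expectation (q a) h) \<partial>p)"
    by (intro nn_integral_cong nn_integral_eq_integral)
       (use assms in \<open>auto intro: integrable_pmf_unit\<close>)
  also have "\<dots> = ennreal (measure_pmf.expectation p (\<lambda>a. measure_pmf.expectation (q a) h))"
    by (rule nn_integral_eq_integral)
       (use assms expectation_unit[of h] in \<open>auto intro!: integrable_pmf_unit\<close>)
  finally show ?thesis
    using assms expectation_unit
    by (subst (asm) ennreal_inj) (auto intro!: Bochner_Integration.integral_nonneg)
qed

lemma expectation_conv:
  fixes h :: "'v::plus \<Rightarrow> real"
  assumes "\<And>x. 0 \<le> h x \<and> h x \<le> 1"
  shows "measure_pmf.expectation (conv_pmf p q) h
     = measure_pmf.expectation p (\<lambda>a. measure_pmf.expectation q (\<lambda>b. h (a + b)))"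
  unfolding conv_pmf_def by (subst expectation_bind_unit) (use assms in auto)

text \<open>Change one factor at a time. For a fixed value of the other factor, a test function of the sum is a
test function of the changed factor.\<close>

lemma pmf_close_conv:
  assumes "pmf_close a p p'" "pmf_close b q q'"
  shows "pmf_close (a + b) (conv_pmf p q) (conv_pmf p' q')"
proof (rule pmf_close_trans)
  show "pmf_close a (conv_pmf p q) (conv_pmf p' q)"
    unfolding pmf_close_def
    by (auto simp: expectation_conv intro!: pmf_closeD[OF assms(1)] expectation_unit[THEN conjunct1] expectation_unit[THEN conjunct2])
  show "pmf_close b (conv_pmf p' q) (conv_pmf p' q')"
    unfolding pmf_close_def
  proof (intro allI impI)
    fix h :: "'a \<Rightarrow> real" assume h: "\<forall>x. 0 \<le> h x \<and> h x \<le> 1"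
    let ?f = "\<lambda>q a. measure_pmf.expectation q (\<lambda>b. h (a + b))"
    have i: "integrable p' (?f r)" for r
      by (rule integrable_pmf_unit) (use h in \<open>auto intro!: expectation_unit[THEN conjunct1] expectation_unit[THEN conjunct2]\<close>)
    have "\<bar>measure_pmf.expectation p' (?f q) - measure_pmf.expectation p' (?f q')\<bar>
       = \<bar>measure_pmf.expectation p' (\<lambda>a. ?f q a - ?f q' a)\<bar>"
      by (simp add: i)
    also have "\<dots> \<le> measure_pmf.expectation p' (\<lambda>a. \<bar>?f q a - ?f q' a\<bar>)"
      by (rule integral_abs_bound)
    also have "\<dots> \<le> measure_pmf.expectation p' (\<lambda>a. b)"
      by (rule integral_mono) (use h in \<open>auto intro!: pmf_closeD[OF assms(2)] integrable_abs Bochner_Integration.integrable_diff i\<close>)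
    finally show "\<bar>measure_pmf.expectation (conv_pmf p' q) h - measure_pmf.expectation (conv_pmf p' q') h\<bar> \<le> b"
      using h by (simp add: expectation_conv)
  qed
qed

text \<open>The law of \<open>\<Sum>i\<in>F. X\<^sub>i\<close> for independent \<open>X\<^sub>i\<close> with laws \<open>b i\<close>.\<close>

definition indep_sum_pmf :: "'i set \<Rightarrow> ('i \<Rightarrow> 'v::comm_monoid_add pmf) \<Rightarrow> 'v pmf" where
  "indep_sum_pmf F b = map_pmf (\<lambda>s. \<Sum>i\<in>F. s i) (Pi_pmf F 0 b)"

lemma indep_sum_pmf_empty: "indep_sum_pmf {} b = return_pmf 0"
  by (simp add: indep_sum_pmf_def)

lemma indep_sum_pmf_insert:
  assumes "finite F" "j \<notin> F"
  shows "indep_sum_pmf (insert j F) b = conv_pmf (b j) (indep_sum_pmf F b)"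
proof -
  have s: "(\<Sum>i\<in>F. if i = j then y else f i) = (\<Sum>i\<in>F. f i)" for y :: 'b and f
    by (rule sum.cong) (use assms in auto)
  show ?thesis
  unfolding indep_sum_pmf_def conv_pmf_def using assms
  by (simp add: Pi_pmf_insert' map_bind_pmf map_pmf_comp s fun_upd_def flip: map_pmf_def)
qed

section \<open>Poisson vectors and the bound of Le Cam\<close>

text \<open>The Poisson law, extended by the point mass at \<open>0\<close> for mean \<open>0\<close>, since cells may have mean \<open>0\<close>.\<close>

definition pois :: "real \<Rightarrow> nat pmf" where
  "pois m = (if m = 0 then return_pmf 0 else poisson_pmf m)"

lemma pmf_pois: "0 \<le> m \<Longrightarrow> pmf (pois m) k = exp (- m) * m ^ k / fact k"
  by (cases "k = 0") (auto simp: pois_def pmf_return)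

lemma pmf_conv_nat:
  "pmf (conv_pmf p q) n = (\<Sum>a\<le>n. pmf p a * pmf q (n - a))" for n :: nat
proof -
  have "pmf (conv_pmf p q) n = measure_pmf.expectation p (\<lambda>a. pmf (map_pmf (\<lambda>b. a + b) q) n)"
    by (simp add: conv_pmf_def pmf_bind)
  also have "\<dots> = measure_pmf.expectation p (\<lambda>a. if a \<le> n then pmf q (n - a) else 0)"
  proof (rule Bochner_Integration.integral_cong)
    fix a
    show "pmf (map_pmf (\<lambda>b. a + b) q) n = (if a \<le> n then pmf q (n - a) else 0)"
    proof (cases "a \<le> n")
      case True
      then have "(\<lambda>b. a + b) -` {n} = {n - a}" by auto
      then show ?thesis using True by (simp add: pmf_map measure_pmf_single)
    next
      case False
      then have "(\<lambda>b. a + b) -` {n} = {}" by auto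
      then show ?thesis using False by (simp add: pmf_map)
    qed
  qed auto
  also have "\<dots> = (\<Sum>a\<le>n. (if a \<le> n then pmf q (n - a) else 0) * pmf p a)"
    by (rule integral_measure_pmf_real) (auto split: if_splits)
  also have "\<dots> = (\<Sum>a\<le>n. pmf p a * pmf q (n - a))"
    by (rule sum.cong) auto
  finally show ?thesis .
qed

lemma pois_add:
  assumes "0 \<le> a" "0 \<le> b"
  shows "conv_pmf (pois a) (pois b) = pois (a + b)"
proof (rule pmf_eqI)
  fix n
  have "pmf (conv_pmf (pois a) (pois b)) n
     = (\<Sum>k\<le>n. exp (- a) * a ^ k / fact k * (exp (- b) * b ^ (n - k) / fact (n - k)))"
    using assms by (simp add: pmf_conv_nat pmf_pois)
  also have "\<dots> = exp (- (a + b)) / fact n * (\<Sum>k\<le>n. of_nat (n choose k) * a ^ k * b ^ (n - k))"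
    unfolding sum_distrib_left
    by (rule sum.cong) (auto simp: binomial_fact mult_exp_exp field_simps simp flip: exp_add)
  also have "\<dots> = pmf (pois (a + b)) n"
    using assms by (simp add: pmf_pois binomial_ring)
  finally show "pmf (conv_pmf (pois a) (pois b)) n = pmf (pois (a + b)) n" .
qed

text \<open>Independent Poisson coordinates with means \<open>q k\<close>, extended by \<open>0\<close> outside \<open>K\<close>.\<close>

definition mpois :: "'k set \<Rightarrow> ('k \<Rightarrow> real) \<Rightarrow> ('k \<Rightarrow> nat) pmf" where
  "mpois K q = Pi_pmf K 0 (\<lambda>k. pois (q k))"

text \<open>In each coordinate this is additivity of the Poisson law. Given the first vector \<open>f\<close>, the product of the laws shifted by
\<open>f k\<close> is the product law shifted by \<open>f\<close>.\<close>

lemma mpois_add: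
  assumes K: "finite K" and "\<And>k. k \<in> K \<Longrightarrow> 0 \<le> a k" "\<And>k. k \<in> K \<Longrightarrow> 0 \<le> b k"
  shows "mpois K (\<lambda>k. a k + b k) = conv_pmf (mpois K a) (mpois K b)"
proof -
  have "mpois K (\<lambda>k. a k + b k) =
     Pi_pmf K 0 (\<lambda>k. bind_pmf (pois (a k)) (\<lambda>m. map_pmf (\<lambda>b. m + b) (pois (b k))))"
    unfolding mpois_def by (rule Pi_pmf_cong) (use assms in \<open>auto simp: pois_add[symmetric] conv_pmf_def\<close>)
  also have "\<dots> = bind_pmf (Pi_pmf K 0 (\<lambda>k. pois (a k)))
        (\<lambda>f. Pi_pmf K 0 (\<lambda>k. map_pmf (\<lambda>b. f k + b) (pois (b k))))"
    by (rule Pi_pmf_bind[OF K])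
  also have "\<dots> = bind_pmf (Pi_pmf K 0 (\<lambda>k. pois (a k)))
        (\<lambda>f. map_pmf (\<lambda>g. f + g) (Pi_pmf K 0 (\<lambda>k. pois (b k))))"
  proof (rule bind_pmf_cong[OF refl])
    fix f assume f: "f \<in> set_pmf (Pi_pmf K 0 (\<lambda>k. pois (a k)))"
    have f0: "f k = 0" if "k \<notin> K" for k using set_Pi_pmf_subset[OF K] f that by fastforce
    have fs: "\<forall>x\<in>K. f x \<in> set_pmf (pois (a x))"
      using f set_Pi_pmf_subset'[OF K, of 0 "\<lambda>k. pois (a k)"] by (auto simp: PiE_dflt_def)
    show "Pi_pmf K 0 (\<lambda>k. map_pmf (\<lambda>b. f k + b) (pois (b k)))
        = map_pmf (\<lambda>g. f + g) (Pi_pmf K 0 (\<lambda>k. pois (b k)))"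
    proof (rule pmf_eqI)
      fix v
      have inj: "(\<lambda>g. f + g) -` {v} = (if (\<forall>k. f k \<le> v k) then {\<lambda>k. v k - f k} else {})"
        by (auto simp: fun_eq_iff)
      have one: "pmf (map_pmf (\<lambda>b. f k + b) (pois (b k))) (v k)
          = (if f k \<le> v k then pmf (pois (b k)) (v k - f k) else 0)" for k
      proof -
        have "(\<lambda>b. f k + b) -` {v k} = (if f k \<le> v k then {v k - f k} else {})" by auto
        then show ?thesis by (simp add: pmf_map measure_pmf_single)
      qed
      have all: "(\<forall>k. f k \<le> v k) \<longleftrightarrow> (\<forall>k\<in>K. f k \<le> v k)" using f0 by (metis le0)
      have out: "(\<forall>k. k \<notin> K \<longrightarrow> v k - f k = 0) \<longleftrightarrow> (\<forall>k. k \<notin> K \<longrightarrow> v k = 0)" using f0 by auto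
      show "pmf (Pi_pmf K 0 (\<lambda>k. map_pmf (\<lambda>b. f k + b) (pois (b k)))) v
         = pmf (map_pmf (\<lambda>g. f + g) (Pi_pmf K 0 (\<lambda>k. pois (b k)))) v"
      proof (cases "\<forall>k\<in>K. f k \<le> v k")
        case True
        then show ?thesis
          using out all
          by (simp add: pmf_Pi[OF K] one pmf_map[of "\<lambda>g. f + g"] inj measure_pmf_single cong: if_cong)
      next
        case False
        then have "(\<Prod>k\<in>K. if f k \<le> v k then pmf (pois (b k)) (v k - f k) else 0) = 0"
          using K by (subst prod_zero_iff) auto
        then show ?thesis
          using False all by (auto simp: pmf_Pi[OF K] one pmf_map[of "\<lambda>g. f + g"] inj)
      qed
    qed
  qed
  finally show ?thesis by (simp add: conv_pmf_def mpois_def)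
qed

definition unit_vec :: "'k \<Rightarrow> 'k \<Rightarrow> nat" where
  "unit_vec k = (\<lambda>j. if j = k then 1 else 0)"

lemma unit_vec_inj: "unit_vec k = unit_vec l \<longleftrightarrow> k = l"
  by (auto simp: unit_vec_def fun_eq_iff)

lemma unit_vec_nonzero: "unit_vec k \<noteq> 0"
  by (auto simp: unit_vec_def fun_eq_iff)

lemma pmf_mpois_0:
  assumes "finite K" "\<And>k. k \<in> K \<Longrightarrow> 0 \<le> q k"
  shows "pmf (mpois K q) 0 = exp (- (\<Sum>k\<in>K. q k))"
  using assms by (simp add: mpois_def pmf_Pi pmf_pois exp_sum sum_negf flip: sum_negf)

lemma pmf_mpois_unit_vec:
  assumes "finite K" "\<And>k. k \<in> K \<Longrightarrow> 0 \<le> q k" "k \<in> K"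
  shows "pmf (mpois K q) (unit_vec k) = q k * exp (- (\<Sum>k\<in>K. q k))"
proof -
  have "pmf (mpois K q) (unit_vec k) = (\<Prod>j\<in>K. exp (- q j) * (if j = k then q k else 1))"
    using assms by (auto simp: mpois_def pmf_Pi pmf_pois unit_vec_def intro!: prod.cong)
  also have "\<dots> = q k * exp (- (\<Sum>k\<in>K. q k))"
    using assms by (simp add: prod.distrib exp_sum flip: sum_negf)
  finally show ?thesis .
qed

text \<open>The larger mean is obtained by convolution with an independent Poisson vector, which is nonzero with
probability at most the sum of its means.\<close>

lemma pmf_close_mpois_extra:
  assumes "finite K" "\<And>k. k \<in> K \<Longrightarrow> 0 \<le> a k" "\<And>k. k \<in> K \<Longrightarrow> a k \<le> b k"
  shows "pmf_close (\<Sum>k\<in>K. b k - a k) (mpois K b) (mpois K a)"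
proof -
  let ?c = "\<lambda>k. b k - a k"
  have "pmf_close (1 - pmf (mpois K ?c) 0) (mpois K ?c) (return_pmf 0)"
    by (rule pmf_close_return)
  then have "pmf_close (sum ?c K) (mpois K ?c) (return_pmf 0)"
    using assms exp_ge_add_one_self[of "- sum ?c K"]
    by (elim pmf_close_mono) (simp add: pmf_mpois_0)
  then have "pmf_close (0 + sum ?c K) (conv_pmf (mpois K a) (mpois K ?c)) (conv_pmf (mpois K a) (return_pmf 0))"
    by (intro pmf_close_conv pmf_close_refl) auto
  moreover have "conv_pmf (mpois K a) (mpois K ?c) = mpois K b"
    using assms by (subst mpois_add[symmetric]) auto
  moreover have "conv_pmf (mpois K a) (return_pmf 0) = mpois K a"
    by (simp add: conv_pmf_def bind_return_pmf')
  ultimately show ?thesis by simp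
qed

lemma expectation_finite_support:
  fixes h :: "'v \<Rightarrow> real"
  assumes "finite V" "set_pmf b \<subseteq> V"
  shows "measure_pmf.expectation b h = (\<Sum>v\<in>V. pmf b v * h v)"
  using integral_measure_pmf_real[OF assms(1), of b h] assms(2) by (auto simp: mult.commute)

lemma expectation_ge_finite_sum:
  fixes h :: "'v \<Rightarrow> real"
  assumes "finite V" "\<And>x. 0 \<le> h x \<and> h x \<le> 1"
  shows "(\<Sum>v\<in>V. pmf b v * h v) \<le> measure_pmf.expectation b h"
proof -
  have "(\<Sum>v\<in>V. pmf b v * h v) = (\<Sum>v\<in>V. pmf b v * (indicator V v * h v))"
    by (intro sum.cong) auto
  also have "\<dots> = measure_pmf.expectation b (\<lambda>v. indicator V v * h v)"
    by (subst integral_measure_pmf_real[OF assms(1)]) (auto split: split_indicator_asm simp: mult.commute)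
  also have "\<dots> \<le> measure_pmf.expectation b h"
    by (rule integral_mono) (use assms(2) in \<open>auto intro!: integrable_pmf_unit simp: indicator_def\<close>)
  finally show ?thesis .
qed

text \<open>The Poisson vector charges \<open>0\<close> with \<open>exp (-r) \<ge> 1 - r\<close> and the \<open>k\<close>-th unit vector with
\<open>exp (-r) q\<^sub>k\<close>. So the first law exceeds the second only on the unit vectors, where the total excess is
\<open>r (1 - exp (-r)) \<le> r\<^sup>2\<close>.\<close>

lemma le_cam_single:
  assumes K: "finite K" and supp: "set_pmf b \<subseteq> insert 0 (unit_vec ` K)"
  defines "r \<equiv> (\<Sum>k\<in>K. pmf b (unit_vec k))"
  shows "pmf_close (r\<^sup>2) b (mpois K (\<lambda>k. pmf b (unit_vec k)))"
proof (rule pmf_close_one_sided)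
  fix h :: "('a \<Rightarrow> nat) \<Rightarrow> real"
  assume h: "\<And>x. 0 \<le> h x \<and> h x \<le> 1"
  let ?q = "\<lambda>k. pmf b (unit_vec k)"
  let ?V = "insert 0 (unit_vec ` K)"
  have split: "(\<Sum>v\<in>?V. f v) = f 0 + (\<Sum>k\<in>K. f (unit_vec k))" for f :: "('a \<Rightarrow> nat) \<Rightarrow> real"
    using K by (subst sum.insert)
       (auto simp: unit_vec_nonzero[symmetric] sum.reindex inj_on_def unit_vec_inj unit_vec_nonzero)
  have r0: "0 \<le> r" by (simp add: r_def sum_nonneg)
  have b0: "pmf b 0 = 1 - r"
    using expectation_finite_support[OF _ supp, of "\<lambda>_. 1"] K split[of "\<lambda>v. pmf b v"]
    by (simp add: r_def)
  have S: "(\<Sum>k\<in>K. ?q k * h (unit_vec k)) \<le> r"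
    unfolding r_def by (rule sum_mono) (use h in \<open>auto intro!: mult_left_le\<close>)
  have S0: "0 \<le> (\<Sum>k\<in>K. ?q k * h (unit_vec k))"
    by (intro sum_nonneg) (use h in auto)
  have e1: "1 - exp (- r) \<le> r" using exp_ge_add_one_self[of "-r"] by simp
  have "measure_pmf.expectation b h = (1 - r) * h 0 + (\<Sum>k\<in>K. ?q k * h (unit_vec k))"
    using K by (subst expectation_finite_support[OF _ supp]) (auto simp: split b0)
  moreover have "exp (- r) * h 0 + (\<Sum>k\<in>K. ?q k * exp (- r) * h (unit_vec k))
      \<le> measure_pmf.expectation (mpois K ?q) h"
    using expectation_ge_finite_sum[of ?V h "mpois K ?q"] h K
    by (simp add: split pmf_mpois_0 pmf_mpois_unit_vec r_def cong: sum.cong)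
  moreover have "(\<Sum>k\<in>K. ?q k * exp (- r) * h (unit_vec k)) = exp (- r) * (\<Sum>k\<in>K. ?q k * h (unit_vec k))"
    by (simp add: sum_distrib_left mult_ac)
  moreover have "(1 - r) * h 0 \<le> exp (- r) * h 0"
    using e1 h[of 0] by (intro mult_right_mono) auto
  moreover have "(\<Sum>k\<in>K. ?q k * h (unit_vec k)) * (1 - exp (- r)) \<le> r * r"
    using e1 r0 S S0 by (intro mult_mono) auto
  ultimately show "measure_pmf.expectation b h - measure_pmf.expectation (mpois K ?q) h \<le> r\<^sup>2"
    by (simp add: algebra_simps power2_eq_square)
qed

lemma le_cam_finite:
  assumes K: "finite K" and F: "finite F"
    and supp: "\<And>i. i \<in> F \<Longrightarrow> set_pmf (b i) \<subseteq> insert 0 (unit_vec ` K)"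
  shows "pmf_close (\<Sum>i\<in>F. (\<Sum>k\<in>K. pmf (b i) (unit_vec k))\<^sup>2)
     (indep_sum_pmf F b) (mpois K (\<lambda>k. \<Sum>i\<in>F. pmf (b i) (unit_vec k)))"
  using F supp
proof (induction F rule: finite_induct)
  case empty
  have "mpois K (\<lambda>k. 0) = return_pmf 0"
    using K by (simp add: mpois_def pois_def zero_fun_def)
  then show ?case by (simp add: indep_sum_pmf_empty pmf_close_refl)
next
  case (insert j F)
  have "pmf_close ((\<Sum>k\<in>K. pmf (b j) (unit_vec k))\<^sup>2 + (\<Sum>i\<in>F. (\<Sum>k\<in>K. pmf (b i) (unit_vec k))\<^sup>2))
    (conv_pmf (b j) (indep_sum_pmf F b))
    (conv_pmf (mpois K (\<lambda>k. pmf (b j) (unit_vec k))) (mpois K (\<lambda>k. \<Sum>i\<in>F. pmf (b i) (unit_vec k))))"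
    by (intro pmf_close_conv le_cam_single insert.IH K) (use insert.prems in blast)+
  then show ?case
    using insert.hyps K by (simp add: indep_sum_pmf_insert mpois_add sum_nonneg)
qed

section \<open>The lower bound of Barbour and Hall\<close>

text \<open>The expectation of \<open>h W\<close> for a sum \<open>W\<close> of independent Bernoulli variables with success probabilities
\<open>p i\<close>, where \<open>A\<close> is the set of successes. As a finite sum it is defined for unbounded \<open>h\<close> as well.\<close>

definition pbin :: "'i set \<Rightarrow> ('i \<Rightarrow> real) \<Rightarrow> (nat \<Rightarrow> real) \<Rightarrow> real" where
  "pbin F p h = (\<Sum>A\<in>Pow F. (\<Prod>i\<in>A. p i) * (\<Prod>i\<in>F - A. 1 - p i) * h (card A))"

lemma pbin_empty: "pbin {} p h = h 0"
  by (simp add: pbin_def)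

lemma pbin_insert:
  assumes "finite F" "j \<notin> F"
  shows "pbin (insert j F) p h = (1 - p j) * pbin F p h + p j * pbin F p (\<lambda>n. h (Suc n))"
proof -
  let ?w = "\<lambda>F A. (\<Prod>i\<in>A. p i) * (\<Prod>i\<in>F - A. 1 - p i)"
  have disj: "Pow F \<inter> insert j ` Pow F = {}" using assms by auto
  have inj: "inj_on (insert j) (Pow F)" using assms by (auto simp: inj_on_def)
  have 1: "?w (insert j F) A = (1 - p j) * ?w F A" if "A \<in> Pow F" for A
  proof -
    have "insert j F - A = insert j (F - A)" using that assms by auto
    then show ?thesis using assms by simp
  qed
  have 2: "?w (insert j F) (insert j A) * h (card (insert j A)) = p j * (?w F A * h (Suc (card A)))"
    if "A \<in> Pow F" for A
  proof -
    have "insert j F - insert j A = F - A" using assms by auto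
    moreover have "finite A" "j \<notin> A" using that assms finite_subset by auto
    ultimately show ?thesis by simp
  qed
  have "pbin (insert j F) p h = (\<Sum>A\<in>Pow F. ?w (insert j F) A * h (card A))
      + (\<Sum>A\<in>insert j ` Pow F. ?w (insert j F) A * h (card A))"
    unfolding pbin_def Pow_insert using assms disj by (subst sum.union_disjoint) auto
  also have "(\<Sum>A\<in>insert j ` Pow F. ?w (insert j F) A * h (card A))
     = p j * pbin F p (\<lambda>n. h (Suc n))"
    unfolding pbin_def sum_distrib_left by (subst sum.reindex[OF inj], rule sum.cong, simp, simp only: o_def 2)
  also have "(\<Sum>A\<in>Pow F. ?w (insert j F) A * h (card A)) = (1 - p j) * pbin F p h"
    unfolding pbin_def sum_distrib_left by (auto simp: 1 mult.assoc intro!: sum.cong)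
  finally show ?thesis .
qed

lemma pbin_add: "pbin F p (\<lambda>n. f n + g n) = pbin F p f + pbin F p g"
  by (simp add: pbin_def sum.distrib algebra_simps)

lemma pbin_cmult: "pbin F p (\<lambda>n. c * f n) = c * pbin F p f"
  by (simp add: pbin_def sum_distrib_left mult_ac)

lemma pbin_diff: "pbin F p (\<lambda>n. f n - g n) = pbin F p f - pbin F p g"
  by (simp add: pbin_def sum_subtractf algebra_simps)

lemma pbin_const: "finite F \<Longrightarrow> pbin F p (\<lambda>_. c) = c"
  by (induction F rule: finite_induct) (auto simp: pbin_empty pbin_insert algebra_simps)

lemma pbin_mono:
  assumes "\<And>i. i \<in> F \<Longrightarrow> 0 \<le> p i \<and> p i \<le> 1" "\<And>n. f n \<le> g n"
  shows "pbin F p f \<le> pbin F p g"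
  unfolding pbin_def
  by (intro sum_mono mult_left_mono mult_nonneg_nonneg prod_nonneg) (use assms in auto)

lemma pbin_mean:
  "finite F \<Longrightarrow> pbin F p (\<lambda>n. real n - a) = sum p F - a"
  by (induction F arbitrary: a rule: finite_induct)
     (auto simp: pbin_empty pbin_insert algebra_simps, simp add: algebra_simps pbin_diff pbin_add pbin_const)

lemma pbin_square:
  "finite F \<Longrightarrow> pbin F p (\<lambda>n. (real n - a)\<^sup>2) = (\<Sum>i\<in>F. p i * (1 - p i)) + (sum p F - a)\<^sup>2"
proof (induction F arbitrary: a rule: finite_induct)
  case (insert j F)
  have "pbin F p (\<lambda>n. (real (Suc n) - a)\<^sup>2) = pbin F p (\<lambda>n. (real n - (a - 1))\<^sup>2)"
    by (rule arg_cong[where f="pbin F p"]) (simp add: algebra_simps)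
  then show ?case
    using insert by (simp add: pbin_insert) (simp add: algebra_simps power2_eq_square)
qed (simp add: pbin_empty)

text \<open>This is \<open>E (W h(W)) = \<Sum>i. E (X\<^sub>i h(W\<^sub>i + 1))\<close>, with \<open>X\<^sub>i\<close> independent of \<open>W\<^sub>i = W - X\<^sub>i\<close>.\<close>

lemma pbin_size_bias:
  assumes "finite F"
  shows "pbin F p (\<lambda>n. real n * h n) = (\<Sum>i\<in>F. p i * pbin (F - {i}) p (\<lambda>n. h (Suc n)))"
  using assms
proof (induction F arbitrary: h rule: finite_induct)
  case empty
  then show ?case by (simp add: pbin_empty)
next
  case (insert j F)
  have rem: "pbin (insert j F - {i}) p f
      = (1 - p j) * pbin (F - {i}) p f + p j * pbin (F - {i}) p (\<lambda>n. f (Suc n))"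
    if "i \<in> F" for i f
  proof -
    have "insert j F - {i} = insert j (F - {i})" using that insert.hyps by auto
    then show ?thesis using insert.hyps by (simp add: pbin_insert)
  qed
  have "pbin F p (\<lambda>n. real (Suc n) * h (Suc n))
      = pbin F p (\<lambda>n. real n * h (Suc n)) + pbin F p (\<lambda>n. h (Suc n))"
    by (subst pbin_add[symmetric]) (simp add: algebra_simps)
  then show ?case
    using insert.hyps
    by (simp add: pbin_insert insert.IH[of h] insert.IH[of "\<lambda>n. h (Suc n)"] rem
          algebra_simps sum.distrib sum_distrib_left sum_subtractf)
qed

text \<open>Conditioning on \<open>X\<^sub>i\<close> gives \<open>E h(W + 1) - E h(W\<^sub>i + 1) = p\<^sub>i E (h(W\<^sub>i + 2) - h(W\<^sub>i + 1))\<close>; now multiply by \<open>p\<^sub>i\<close>, sum over \<open>i\<close>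
and use the size-bias formula.\<close>

lemma pbin_stein:
  assumes "finite F"
  shows "pbin F p (\<lambda>n. sum p F * h (Suc n) - real n * h n)
     = (\<Sum>i\<in>F. (p i)\<^sup>2 * pbin (F - {i}) p (\<lambda>n. h (Suc (Suc n)) - h (Suc n)))"
proof -
  have "pbin F p (\<lambda>n. h (Suc n)) = (1 - p i) * pbin (F - {i}) p (\<lambda>n. h (Suc n))
      + p i * pbin (F - {i}) p (\<lambda>n. h (Suc (Suc n)))" if "i \<in> F" for i
    using pbin_insert[of "F - {i}" i p] assms that by (simp add: insert_absorb)
  then have "(\<Sum>i\<in>F. p i * pbin F p (\<lambda>n. h (Suc n))) =
     (\<Sum>i\<in>F. p i * ((1 - p i) * pbin (F - {i}) p (\<lambda>n. h (Suc n))
      + p i * pbin (F - {i}) p (\<lambda>n. h (Suc (Suc n)))))"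
    by (intro sum.cong) auto
  then have "sum p F * pbin F p (\<lambda>n. h (Suc n)) = \<dots>"
    by (simp only: sum_distrib_right)
  then have "pbin F p (\<lambda>n. sum p F * h (Suc n) - real n * h n) = \<dots>
      - (\<Sum>i\<in>F. p i * pbin (F - {i}) p (\<lambda>n. h (Suc n)))"
    using assms by (simp only: pbin_diff pbin_cmult pbin_size_bias)
  also have "\<dots> = (\<Sum>i\<in>F. (p i)\<^sup>2 * pbin (F - {i}) p (\<lambda>n. h (Suc (Suc n)) - h (Suc n)))"
    unfolding sum_subtractf[symmetric] pbin_diff
    by (rule sum.cong) (auto simp: algebra_simps power2_eq_square)
  finally show ?thesis .
qed

definition gauss_bump :: "real \<Rightarrow> real \<Rightarrow> real" where
  "gauss_bump c x = x * exp (- (x\<^sup>2 / c))"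

lemma gauss_bump_deriv:
  "c > 0 \<Longrightarrow> (gauss_bump c has_real_derivative exp (- (x\<^sup>2 / c)) * (1 - 2 * (x\<^sup>2 / c))) (at x)"
  unfolding gauss_bump_def
  by (auto intro!: derivative_eq_intros simp: field_simps power2_eq_square)

lemma exp_lower: "u \<ge> 0 \<Longrightarrow> 2 * u \<le> exp (u::real)"
proof -
  assume "u \<ge> 0"
  then have "1 + u + u\<^sup>2 / 2 \<le> exp u" by (rule exp_lower_Taylor_quadratic)
  moreover have "0 \<le> (u - 1)\<^sup>2" by simp
  ultimately show ?thesis by (simp add: power2_eq_square algebra_simps)
qed

text \<open>Bounds for the derivative of the test function, with \<open>u = x\<^sup>2 / c\<close>. The third one is the quantitative
form of the slope being close to \<open>1\<close> near the mean.\<close>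

lemma bump_slope_bounds:
  fixes u :: real
  assumes "0 \<le> u"
  shows "exp (- u) * (1 - 2 * u) \<le> 1" "- 1 \<le> exp (- u) * (1 - 2 * u)"
    "1 - 3 * u \<le> exp (- u) * (1 - 2 * u)"
proof -
  have e: "0 < exp (- u)" "exp (- u) \<le> 1" "1 - u \<le> exp (- u)"
    using assms exp_ge_add_one_self[of "-u"] by auto
  have u: "exp (- u) * (2 * u) \<le> 1"
    using exp_lower[OF assms] by (simp add: exp_minus field_simps)
  have eq: "exp (- u) * (1 - 2 * u) = exp (- u) - exp (- u) * (2 * u)" by (simp add: algebra_simps)
  have nn: "0 \<le> exp (- u) * (2 * u)" using assms by simp
  show "exp (- u) * (1 - 2 * u) \<le> 1" using eq nn e(2) by linarith
  show "- 1 \<le> exp (- u) * (1 - 2 * u)" using eq u e(1) by linarith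
  show "1 - 3 * u \<le> exp (- u) * (1 - 2 * u)"
  proof (cases "2 * u \<le> 1")
    case True
    then have "(1 - u) * (1 - 2 * u) \<le> exp (- u) * (1 - 2 * u)"
      using e by (intro mult_right_mono) auto
    moreover have "(1 - u) * (1 - 2 * u) = 1 - 3 * u + 2 * u * u" by (simp add: algebra_simps)
    ultimately show ?thesis using assms mult_nonneg_nonneg[of u u] by linarith
  next
    case False
    then have "1 * (2 * u - 1) \<ge> exp (- u) * (2 * u - 1)"
      using e by (intro mult_right_mono) auto
    then show ?thesis using assms by (simp add: algebra_simps)
  qed
qed

text \<open>Each bound says that the test function plus a polynomial is monotone; the third polynomial is
\<open>x\<^sup>3 / c - x\<close>, whose derivative compensates the lower bound \<open>1 - 3 x\<^sup>2 / c\<close> of the slope.\<close>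

lemma gauss_bump_step:
  assumes c: "c > 0"
  shows "gauss_bump c (x + 1) - gauss_bump c x \<le> 1"
    "- 1 \<le> gauss_bump c (x + 1) - gauss_bump c x"
    "1 - (3 * x\<^sup>2 + 3 * x + 1) / c \<le> gauss_bump c (x + 1) - gauss_bump c x"
proof -
  note d = gauss_bump_deriv[OF c]
  have u: "0 \<le> y\<^sup>2 / c" for y using c by simp
  have "x - gauss_bump c x \<le> (x + 1) - gauss_bump c (x + 1)"
    by (rule DERIV_nonneg_imp_nondecreasing)
       (use bump_slope_bounds(1)[OF u] in \<open>auto intro!: exI derivative_eq_intros d\<close>)
  then show "gauss_bump c (x + 1) - gauss_bump c x \<le> 1" by simp
  have "x + gauss_bump c x \<le> (x + 1) + gauss_bump c (x + 1)"
    by (rule DERIV_nonneg_imp_nondecreasing)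
       (use bump_slope_bounds(2)[OF u] in \<open>auto intro!: exI derivative_eq_intros d simp: algebra_simps\<close>)
  then show "- 1 \<le> gauss_bump c (x + 1) - gauss_bump c x" by simp
  have "gauss_bump c x - x + x ^ 3 / c \<le> gauss_bump c (x + 1) - (x + 1) + (x + 1) ^ 3 / c"
  proof (rule DERIV_nonneg_imp_nondecreasing[where f="\<lambda>x. gauss_bump c x - x + x ^ 3 / c"])
    fix y
    have "((\<lambda>x. gauss_bump c x - x + x ^ 3 / c) has_real_derivative
       exp (- (y\<^sup>2 / c)) * (1 - 2 * (y\<^sup>2 / c)) - 1 + 3 * (y\<^sup>2 / c)) (at y)"
      using c by (auto intro!: derivative_eq_intros d)
    moreover have "0 \<le> exp (- (y\<^sup>2 / c)) * (1 - 2 * (y\<^sup>2 / c)) - 1 + 3 * (y\<^sup>2 / c)"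
      using bump_slope_bounds(3)[OF u[of y]] by simp
    ultimately show "\<exists>z. ((\<lambda>x. gauss_bump c x - x + x ^ 3 / c) has_real_derivative z) (at y) \<and> 0 \<le> z"
      by blast
  qed simp
  moreover have "(x + 1) ^ 3 = x ^ 3 + (3 * x\<^sup>2 + 3 * x + 1)"
    by (simp add: power3_eq_cube power2_eq_square algebra_simps)
  ultimately show "1 - (3 * x\<^sup>2 + 3 * x + 1) / c \<le> gauss_bump c (x + 1) - gauss_bump c x"
    using c by (simp add: add_divide_distrib)
qed

lemma gauss_bump_times:
  assumes c: "c > 0"
  shows "0 \<le> x * gauss_bump c x" "x * gauss_bump c x \<le> c / 2"
proof -
  have e: "x * gauss_bump c x = c * ((x\<^sup>2 / c) * exp (- (x\<^sup>2 / c)))"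
    using c by (simp add: gauss_bump_def power2_eq_square)
  have "(x\<^sup>2 / c) * exp (- (x\<^sup>2 / c)) \<le> 1 / 2"
    using exp_lower[of "x\<^sup>2 / c"] c by (simp add: exp_minus field_simps)
  then show "x * gauss_bump c x \<le> c / 2" unfolding e using c
    by (metis mult_left_mono less_imp_le mult.right_neutral times_divide_eq_right)
  show "0 \<le> x * gauss_bump c x" unfolding e using c by simp
qed

lemma gauss_bump_bound:
  assumes c: "c > 0"
  shows "\<bar>gauss_bump c x\<bar> \<le> 1 + c / 2"
proof (cases "\<bar>x\<bar> \<le> 1")
  case True
  have "exp (- (x\<^sup>2 / c)) \<le> 1" using c by simp
  then have "\<bar>x\<bar> * exp (- (x\<^sup>2 / c)) \<le> 1 * 1" using True by (intro mult_mono) auto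
  then show ?thesis using c by (simp add: gauss_bump_def abs_mult)
next
  case False
  then have "1 * \<bar>gauss_bump c x\<bar> \<le> \<bar>x\<bar> * \<bar>gauss_bump c x\<bar>" by (intro mult_right_mono) auto
  also have "\<dots> = x * gauss_bump c x" using gauss_bump_times(1)[OF c, of x] by (simp add: abs_mult[symmetric])
  also have "\<dots> \<le> c / 2" by (rule gauss_bump_times(2)[OF c])
  finally show ?thesis by simp
qed

text \<open>For Poisson weights \<open>w\<^sub>n\<close> one has \<open>m w\<^sub>n = (n+1) w\<^sub>n\<^sub>+\<^sub>1\<close>, so the series that defines the
expectation telescopes.\<close>

lemma pois_stein:
  fixes h :: "nat \<Rightarrow> real"
  assumes m: "0 \<le> m" and h: "\<And>n. \<bar>h n\<bar> \<le> B"
    and f: "\<And>n. \<bar>m * h (Suc n) - real n * h n\<bar> \<le> C"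
  shows "measure_pmf.expectation (pois m) (\<lambda>n. m * h (Suc n) - real n * h n) = 0"
proof -
  let ?p = "pmf (pois m)"
  let ?f = "\<lambda>n. m * h (Suc n) - real n * h n"
  have C: "0 \<le> C" using f[of 0] by linarith
  have ip: "integrable (count_space UNIV) ?p" by (rule integrable_pmf)
  have "(\<lambda>n. ?p n) sums (LINT x|count_space UNIV. ?p x)"
    by (rule sums_integral_count_space_nat[OF ip])
  then have lim: "?p \<longlonglongrightarrow> 0" by (intro summable_LIMSEQ_zero) (auto simp: sums_iff)
  have iC: "integrable (count_space UNIV) (\<lambda>n. C * ?p n)" using ip by simp
  have "pmf (pois m) n * \<bar>?f n\<bar> \<le> C * pmf (pois m) n" for n
    using mult_left_mono[OF f[of n] pmf_nonneg[of "pois m" n]] by (simp add: mult.commute)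
  then have nb: "norm (pmf (pois m) n * ?f n) \<le> norm (C * pmf (pois m) n)" for n
    using C by (simp add: abs_mult)
  have int: "integrable (count_space UNIV) (\<lambda>n. ?p n * ?f n)"
    by (rule Bochner_Integration.integrable_bound[OF iC _ AE_I2[OF nb]]) simp
  have s1: "(\<lambda>n. ?p n * ?f n) sums (LINT x|count_space UNIV. ?p x * ?f x)"
    by (rule sums_integral_count_space_nat[OF int])
  let ?a = "\<lambda>n. real n * ?p n * h n"
  have rec: "real (Suc n) * ?p (Suc n) = m * ?p n" for n
    using m by (simp add: pmf_pois fact_Suc del: of_nat_Suc)
  have step: "?p n * ?f n = ?a (Suc n) - ?a n" for n
  proof -
    have "?a (Suc n) = m * ?p n * h (Suc n)" by (simp only: rec)
    then show ?thesis by (simp add: algebra_simps)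
  qed
  have "(\<lambda>n. m * ?p n * h (Suc n)) \<longlonglongrightarrow> 0"
  proof (rule Lim_null_comparison)
    show "\<forall>\<^sub>F n in sequentially. norm (m * ?p n * h (Suc n)) \<le> m * ?p n * B"
      using m h by (intro always_eventually allI) (simp add: abs_mult mult_left_mono)
    show "(\<lambda>n. m * ?p n * B) \<longlonglongrightarrow> 0"
      using tendsto_mult_left_zero[OF tendsto_mult_right_zero[OF lim]] .
  qed
  then have "(\<lambda>n. ?a (Suc n)) \<longlonglongrightarrow> 0" by (simp only: rec)
  then have "?a \<longlonglongrightarrow> 0" by (rule LIMSEQ_imp_Suc)
  then have "(\<lambda>n. ?a (Suc n) - ?a n) sums (0 - ?a 0)" by (rule telescope_sums)
  then have "(\<lambda>n. ?p n * ?f n) sums 0" by (simp only: step) simp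
  then have "(LINT x|count_space UNIV. ?p x * ?f x) = 0" using s1 sums_unique2 by blast
  then show ?thesis unfolding measure_pmf_eq_density by (subst integral_density) auto
qed

text \<open>The choice \<open>c = 20 m\<close> with \<open>m = max 1 l\<close> makes the mean increment of the test function at least
\<open>1 - (3 l + 7) / c \<ge> 1/2\<close>. The Stein transform \<open>f\<close> takes values in \<open>[-11 m, m]\<close>, an interval of length \<open>12 m\<close>; this gives
the constant \<open>24\<close>.\<close>

lemma barbour_hall_finite:
  fixes p :: "'i \<Rightarrow> real"
  assumes F: "finite F" and p: "\<And>i. i \<in> F \<Longrightarrow> 0 \<le> p i \<and> p i \<le> 1"
    and W: "\<And>h. (\<And>n. 0 \<le> h n \<and> h n \<le> 1) \<Longrightarrow> measure_pmf.expectation W h = pbin F p h"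
    and close: "pmf_close d W (pois (sum p F))"
  shows "(\<Sum>i\<in>F. (p i)\<^sup>2) \<le> 24 * max 1 (sum p F) * d"
proof -
  define l where "l = sum p F"
  define m where "m = max 1 l"
  define c where "c = 20 * m"
  have l0: "0 \<le> l" unfolding l_def by (rule sum_nonneg) (use p in auto)
  have m: "1 \<le> m" "l \<le> m" by (auto simp: m_def)
  have c: "c > 0" using m by (simp add: c_def)
  define h where "h = (\<lambda>n. gauss_bump c (real n - l))"
  define f where "f = (\<lambda>n. l * h (Suc n) - real n * h n)"
  have f_eq: "f n = l * (gauss_bump c (real n - l + 1) - gauss_bump c (real n - l))
       - (real n - l) * gauss_bump c (real n - l)" for n
    by (simp add: f_def h_def algebra_simps)
  have fb: "- (11 * m) \<le> f n \<and> f n \<le> m" for n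
  proof -
    note st = gauss_bump_step[OF c, of "real n - l"] and ti = gauss_bump_times[OF c, of "real n - l"]
    have "l * (gauss_bump c (real n - l + 1) - gauss_bump c (real n - l)) \<le> l * 1"
      using st l0 by (intro mult_left_mono) auto
    moreover have "l * (-1) \<le> l * (gauss_bump c (real n - l + 1) - gauss_bump c (real n - l))"
      using st l0 by (intro mult_left_mono) auto
    ultimately show ?thesis using ti m unfolding f_eq c_def by linarith
  qed
  have lower: "1 / 2 \<le> pbin (F - {i}) p (\<lambda>n. h (Suc (Suc n)) - h (Suc n))" if i: "i \<in> F" for i
  proof -
    let ?G = "F - {i}"
    have pi: "0 \<le> p i" "p i \<le> 1" using p i by auto
    have lG: "sum p ?G = l - p i" using F i by (simp add: l_def sum_diff1)
    have "(\<Sum>j\<in>?G. p j * (1 - p j)) \<le> sum p ?G"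
      by (rule sum_mono) (use p in \<open>auto intro!: mult_left_le\<close>)
    then have sq: "pbin ?G p (\<lambda>n. (real n - (l - 1))\<^sup>2) \<le> l - p i + (1 - p i)\<^sup>2"
      using F by (simp add: pbin_square lG)
    have sq1: "(1 - p i)\<^sup>2 \<le> 1" using pi by (simp add: power_le_one)
    have mean: "pbin ?G p (\<lambda>n. real n - (l - 1)) = 1 - p i"
      using F by (simp add: pbin_mean lG)
    \<comment> \<open>The mean of \<open>3 x\<^sup>2 + 3 x + 1\<close> at \<open>x = W\<^sub>i + 1 - l\<close> is at most \<open>3 l + 7\<close>.\<close>
    have "3 * l + 7 \<le> 10 * m" using m by linarith
    then have "(3 * l + 7) / c \<le> 1 / 2" using m by (simp add: c_def field_simps)
    moreover have "3 * pbin ?G p (\<lambda>n. (real n - (l - 1))\<^sup>2) + 3 * pbin ?G p (\<lambda>n. real n - (l - 1)) + 1 \<le> 3 * l + 7"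
      using sq sq1 mean pi by linarith
    then have "(3 * pbin ?G p (\<lambda>n. (real n - (l - 1))\<^sup>2) + 3 * pbin ?G p (\<lambda>n. real n - (l - 1)) + 1) / c
       \<le> (3 * l + 7) / c"
      using c by (intro divide_right_mono) auto
    moreover have "1 - (3 * pbin ?G p (\<lambda>n. (real n - (l - 1))\<^sup>2) + 3 * pbin ?G p (\<lambda>n. real n - (l - 1)) + 1) / c
       = pbin ?G p (\<lambda>n. 1 - (1 / c) * (3 * (real n - (l - 1))\<^sup>2 + 3 * (real n - (l - 1)) + 1))"
      using F by (simp only: pbin_diff pbin_cmult pbin_add) (simp add: pbin_const pbin_diff)
    moreover have "\<dots> \<le> pbin ?G p (\<lambda>n. h (Suc (Suc n)) - h (Suc n))"
    proof (rule pbin_mono)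
      fix n
      show "1 - (1 / c) * (3 * (real n - (l - 1))\<^sup>2 + 3 * (real n - (l - 1)) + 1) \<le> h (Suc (Suc n)) - h (Suc n)"
      proof -
        have "real n - (l - 1) = real (Suc n) - l" "real n - (l - 1) + 1 = real (Suc (Suc n)) - l" by auto
        then show ?thesis
          using gauss_bump_step(3)[OF c, of "real n - (l - 1)"] by (simp only: h_def) simp
      qed
    qed (use p in auto)
    ultimately show ?thesis by linarith
  qed
  have "(\<Sum>i\<in>F. (p i)\<^sup>2) * (1 / 2) \<le> pbin F p f"
    unfolding f_def l_def[symmetric] pbin_stein[OF F, of p h, folded l_def] sum_distrib_right
    by (intro sum_mono mult_left_mono lower) auto
  then have Ef: "(\<Sum>i\<in>F. (p i)\<^sup>2) / 2 \<le> pbin F p f" by simp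
  have P0: "measure_pmf.expectation (pois l) f = 0"
    unfolding f_def
  proof (rule pois_stein[OF l0])
    show "\<bar>h n\<bar> \<le> 1 + c / 2" for n unfolding h_def by (rule gauss_bump_bound[OF c])
    show "\<bar>l * h (Suc n) - real n * h n\<bar> \<le> 11 * m" for n
      using fb[of n] m unfolding f_def by auto
  qed
  \<comment> \<open>The affine image of \<open>f\<close> with values in the unit interval.\<close>
  define t where "t = (\<lambda>n. 1 / (12 * m) * f n + 11 / 12)"
  have t: "0 \<le> t n \<and> t n \<le> 1" for n
    using fb[of n] m by (auto simp: t_def field_simps)
  have fabs: "\<bar>f n\<bar> \<le> 11 * m" for n
    using fb[of n] m by (auto simp: abs_le_iff)
  have int: "integrable (pois l) f"
    by (rule measure_pmf.integrable_const_bound[where B="11 * m"])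
       (use fabs in auto)
  have "measure_pmf.expectation (pois l) t = 11 / 12"
    using P0 int by (simp add: t_def)
  moreover have "measure_pmf.expectation W t = 1 / (12 * m) * pbin F p f + 11 / 12"
    using F t by (subst W) (simp_all only: t_def pbin_add pbin_cmult pbin_const)
  moreover have "\<bar>measure_pmf.expectation W t - measure_pmf.expectation (pois l) t\<bar> \<le> d"
    by (rule pmf_closeD[OF close[folded l_def]]) (rule t)
  ultimately have "pbin F p f / (12 * m) \<le> d" by simp
  then have "pbin F p f \<le> 12 * m * d" using m by (simp add: field_simps)
  then show ?thesis using Ef by (simp add: m_def l_def)
qed

text \<open>With a single cell, the vectors are Bernoulli variables in one coordinate.\<close>

lemma expectation_indep_sum_single_cell:
  assumes F: "finite F" and supp: "\<And>i. i \<in> F \<Longrightarrow> set_pmf (b i) \<subseteq> {0, unit_vec k}"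
    and h: "\<And>n. 0 \<le> h n \<and> h n \<le> 1"
  shows "measure_pmf.expectation (map_pmf (\<lambda>v. v k) (indep_sum_pmf F b)) h
     = pbin F (\<lambda>i. pmf (b i) (unit_vec k)) h"
  using F supp h
proof (induction F arbitrary: h rule: finite_induct)
  case empty
  then show ?case by (simp add: indep_sum_pmf_empty pbin_empty)
next
  case (insert j F)
  have two: "measure_pmf.expectation (b j) f
     = (1 - pmf (b j) (unit_vec k)) * f 0 + pmf (b j) (unit_vec k) * f (unit_vec k)" for f :: "_ \<Rightarrow> real"
  proof -
    have S: "set_pmf (b j) \<subseteq> {0, unit_vec k}" using insert.prems by blast
    have "measure_pmf.expectation (b j) g = pmf (b j) 0 * g 0 + pmf (b j) (unit_vec k) * g (unit_vec k)" for g :: "_ \<Rightarrow> real"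
      by (subst expectation_finite_support[OF _ S]) (auto simp: unit_vec_nonzero[symmetric])
    from this[of f] this[of "\<lambda>_. 1"] show ?thesis by simp
  qed
  have IH: "measure_pmf.expectation (indep_sum_pmf F b) (\<lambda>v. g (v k)) = pbin F (\<lambda>i. pmf (b i) (unit_vec k)) g"
    if "\<And>n. 0 \<le> g n \<and> g n \<le> 1" for g
    using insert.IH[of g] insert.prems that by simp
  have "measure_pmf.expectation (map_pmf (\<lambda>v. v k) (indep_sum_pmf (insert j F) b)) h
     = measure_pmf.expectation (b j) (\<lambda>a. measure_pmf.expectation (indep_sum_pmf F b) (\<lambda>v. h (a k + v k)))"
    using insert.hyps insert.prems by (simp add: indep_sum_pmf_insert expectation_conv)
  also have "\<dots> = (1 - pmf (b j) (unit_vec k)) * pbin F (\<lambda>i. pmf (b i) (unit_vec k)) h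
       + pmf (b j) (unit_vec k) * pbin F (\<lambda>i. pmf (b i) (unit_vec k)) (\<lambda>n. h (Suc n))"
    unfolding two using IH[of h] IH[of "\<lambda>n. h (Suc n)"] insert.prems by (simp add: unit_vec_def)
  finally show ?case using insert.hyps by (simp add: pbin_insert)
qed

section \<open>Counting independent points in cells\<close>

lemma pmf_with_finite_support:
  assumes "finite V" "\<And>v. v \<in> V \<Longrightarrow> 0 \<le> f v" "(\<Sum>v\<in>V. f v) = 1"
  shows "\<exists>b. \<forall>v. pmf b v = (if v \<in> V then f v else 0)"
proof -
  let ?f = "\<lambda>v. if v \<in> V then f v else 0"
  have "(\<integral>\<^sup>+v. ennreal (?f v) \<partial>count_space UNIV) = (\<integral>\<^sup>+v. ennreal (f v) * indicator V v \<partial>count_space UNIV)"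
    by (rule nn_integral_cong) auto
  also have "\<dots> = (\<integral>\<^sup>+v. ennreal (f v) \<partial>count_space V)"
    by (simp add: nn_integral_count_space_indicator)
  also have "\<dots> = (\<Sum>v\<in>V. ennreal (f v))"
    using assms by (simp add: nn_integral_count_space_finite)
  also have "\<dots> = 1" using assms by (simp add: sum_ennreal)
  finally show ?thesis
    using assms by (intro exI[of _ "embed_pmf ?f"] allI pmf_embed_pmf) auto
qed

text \<open>A lower bound for the point masses gives one for every event by countable additivity. Since both
total masses are \<open>1\<close>, such a lower bound even determines the law, as the next lemma states.\<close>

lemma (in prob_space) discrete_law_ge:
  assumes meas: "\<And>v. {w \<in> space M. X w = v} \<in> events"
    and E: "{w \<in> space M. X w \<in> E} \<in> events"
    and le: "\<And>v. pmf p v \<le> prob {w \<in> space M. X w = v}"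
  shows "measure p E \<le> prob {w \<in> space M. X w \<in> E}"
proof -
  let ?D = "E \<inter> set_pmf p"
  have D: "countable ?D" by (simp add: countable_Int2)
  have "emeasure p E = emeasure p ?D"
    by (rule emeasure_Int_set_pmf[symmetric])
  also have "\<dots> = (\<integral>\<^sup>+v. ennreal (pmf p v) \<partial>count_space ?D)"
    by (rule nn_integral_pmf[symmetric])
  also have "\<dots> \<le> (\<integral>\<^sup>+v. emeasure M {w \<in> space M. X w = v} \<partial>count_space ?D)"
    by (intro nn_integral_mono) (use le in \<open>auto simp: emeasure_eq_measure\<close>)
  also have "\<dots> = emeasure M (\<Union>v\<in>?D. {w \<in> space M. X w = v})"
    by (intro emeasure_UN_countable[symmetric] D) (use meas in \<open>auto simp: disjoint_family_on_def\<close>)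
  also have "\<dots> \<le> emeasure M {w \<in> space M. X w \<in> E}"
    by (rule emeasure_mono[OF _ E]) auto
  finally show ?thesis
    by (simp add: emeasure_eq_measure measure_pmf.emeasure_eq_measure)
qed

lemma (in prob_space) discrete_law_eqI:
  assumes meas: "\<And>E. {w \<in> space M. X w \<in> E} \<in> events"
    and le: "\<And>v. pmf p v \<le> prob {w \<in> space M. X w = v}"
  shows "prob {w \<in> space M. X w \<in> E} = measure p E"
proof -
  have m: "{w \<in> space M. X w = v} \<in> events" for v using meas[of "{v}"] by simp
  have "measure p E \<le> prob {w \<in> space M. X w \<in> E}"
    by (rule discrete_law_ge[OF m meas le])
  moreover have "measure p (- E) \<le> prob {w \<in> space M. X w \<in> - E}"
    by (rule discrete_law_ge[OF m meas le])
  moreover have "prob {w \<in> space M. X w \<in> - E} = 1 - prob {w \<in> space M. X w \<in> E}"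
    by (subst prob_compl[OF meas, symmetric]) (rule arg_cong[where f=prob], auto)
  moreover have "measure p (- E) = 1 - measure p E"
    using measure_pmf.prob_compl[of E p] by (simp add: Compl_eq_Diff_UNIV)
  ultimately show ?thesis by linarith
qed

lemma countable_finite_support:
  assumes "finite K"
  shows "countable {v :: 'k \<Rightarrow> nat. \<forall>k. k \<notin> K \<longrightarrow> v k = 0}"
proof -
  have "{v :: 'k \<Rightarrow> nat. \<forall>k. k \<notin> K \<longrightarrow> v k = 0} \<subseteq> (\<lambda>g k. if k \<in> K then g k else 0) ` (PiE K (\<lambda>_. UNIV))"
  proof
    fix v :: "'k \<Rightarrow> nat" assume v: "v \<in> {v. \<forall>k. k \<notin> K \<longrightarrow> v k = 0}"
    then have "v = (\<lambda>k. if k \<in> K then restrict v K k else 0)" by (auto simp: fun_eq_iff)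
    moreover have "restrict v K \<in> PiE K (\<lambda>_. UNIV)" by auto
    ultimately show "v \<in> (\<lambda>g k. if k \<in> K then g k else 0) ` (PiE K (\<lambda>_. UNIV))" by blast
  qed
  moreover have "countable (PiE K (\<lambda>_. UNIV :: nat set))"
    using assms by (intro countable_PiE) auto
  ultimately show ?thesis by (meson countable_image countable_subset)
qed

text \<open>Vectors of natural numbers that vanish outside a finite set form a countable set, so their law is discrete
and arbitrary sets \<open>E\<close> of vectors give events.\<close>

lemma sets_finite_support_valued:
  fixes X :: "'a \<Rightarrow> 'k \<Rightarrow> nat"
  assumes K: "finite K" and supp: "\<And>w k. k \<notin> K \<Longrightarrow> X w k = 0"
    and meas: "\<And>k n. k \<in> K \<Longrightarrow> {w \<in> space M. X w k = n} \<in> sets M"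
  shows "{w \<in> space M. X w \<in> E} \<in> sets M"
proof -
  let ?S = "E \<inter> {v. \<forall>k. k \<notin> K \<longrightarrow> v k = 0}"
  have one: "{w \<in> space M. X w = v} \<in> sets M" if v: "\<forall>k. k \<notin> K \<longrightarrow> v k = 0" for v
  proof -
    have "{w \<in> space M. X w = v} = {w \<in> space M. \<forall>k\<in>K. X w k = v k}"
      using supp v by (auto simp: fun_eq_iff)
    also have "\<dots> \<in> sets M"
      using K meas by (intro sets.sets_Collect_finite_All) auto
    finally show ?thesis .
  qed
  have "{w \<in> space M. X w \<in> E} = (\<Union>v\<in>?S. {w \<in> space M. X w = v})"
    using supp by auto
  also have "\<dots> \<in> sets M"
    by (intro sets.countable_UN' countable_subset[OF _ countable_finite_support[OF K]])
       (use one in auto)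
  finally show ?thesis .
qed

definition cell_vec :: "'k set \<Rightarrow> ('k \<Rightarrow> 'c set) \<Rightarrow> 'c \<Rightarrow> 'k \<Rightarrow> nat" where
  "cell_vec K C y = (\<lambda>k. if k \<in> K \<and> y \<in> C k then 1 else 0)"

definition cell_counts :: "'k set \<Rightarrow> ('k \<Rightarrow> 'c set) \<Rightarrow> 'i set \<Rightarrow> ('i \<Rightarrow> 'c) \<Rightarrow> 'k \<Rightarrow> nat" where
  "cell_counts K C I y = (\<lambda>k. if k \<in> K then card {i \<in> I. y i \<in> C k} else 0)"

lemma cell_vec_cases:
  assumes "disjoint_family_on C K"
  shows "(\<exists>k\<in>K. y \<in> C k \<and> cell_vec K C y = unit_vec k) \<or>
     (y \<notin> (\<Union>k\<in>K. C k) \<and> cell_vec K C y = 0)"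
proof (cases "y \<in> (\<Union>k\<in>K. C k)")
  case True
  then obtain k where k: "k \<in> K" "y \<in> C k" by auto
  then have "j = k" if "j \<in> K" "y \<in> C j" for j
    using assms that by (auto simp: disjoint_family_on_def)
  then show ?thesis using k by (auto simp: cell_vec_def unit_vec_def fun_eq_iff)
qed (auto simp: cell_vec_def fun_eq_iff)

lemma cell_vec_eq_unit:
  assumes "disjoint_family_on C K" "k \<in> K"
  shows "cell_vec K C y = unit_vec k \<longleftrightarrow> y \<in> C k"
  using cell_vec_cases[OF assms(1), of y] assms(2)
  by (auto simp: cell_vec_def unit_vec_def fun_eq_iff split: if_splits)

lemma cell_vec_eq_0: "cell_vec K C y = 0 \<longleftrightarrow> y \<notin> (\<Union>k\<in>K. C k)"
  by (auto simp: cell_vec_def fun_eq_iff)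

lemma cell_counts_finite:
  assumes "finite F"
  shows "cell_counts K C F y = (\<Sum>i\<in>F. cell_vec K C (y i))"
proof
  fix k
  have "(\<Sum>i\<in>F. cell_vec K C (y i)) k = (\<Sum>i\<in>F. cell_vec K C (y i) k)"
    using assms by (induction F rule: finite_induct) auto
  also have "\<dots> = cell_counts K C F y k"
    using assms by (auto simp: cell_vec_def cell_counts_def sum.If_cases Int_def)
  finally show "cell_counts K C F y k = (\<Sum>i\<in>F. cell_vec K C (y i)) k" by simp
qed

text \<open>Countability of \<open>I\<close> reduces the claim to random sets of natural numbers.\<close>

lemma (in prob_space) measurable_card_indices:
  assumes I: "countable I" and meas: "\<And>i. i \<in> I \<Longrightarrow> {w \<in> space M. R i w} \<in> events"
  shows "(\<lambda>w. card {i \<in> I. R i w}) \<in> measurable M (count_space UNIV)"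
    and "{w \<in> space M. finite {i \<in> I. R i w}} \<in> events"
proof -
  let ?S = "\<lambda>w. to_nat_on I ` {i \<in> I. R i w}"
  have inj: "inj_on (to_nat_on I) {i \<in> I. R i w}" for w
    by (rule inj_on_subset[OF inj_on_to_nat_on[OF I]]) auto
  have S: "{w \<in> space M. n \<in> ?S w} \<in> events" for n
  proof -
    have "{w \<in> space M. n \<in> ?S w} = (\<Union>i\<in>{i\<in>I. to_nat_on I i = n}. {w \<in> space M. R i w})" by auto
    also have "\<dots> \<in> events"
      by (rule sets.countable_UN') (use I meas in \<open>auto intro: countable_subset\<close>)
    finally show ?thesis .
  qed
  have "(\<lambda>w. card (?S w)) \<in> measurable M (count_space UNIV)"
    by (rule measurable_card[OF S])
  then show "(\<lambda>w. card {i \<in> I. R i w}) \<in> measurable M (count_space UNIV)"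
    by (simp add: card_image[OF inj])
  have "{w \<in> space M. finite (?S w)} \<in> events"
    using S unfolding finite_nat_iff_bounded_le subset_iff atMost_iff
    by (intro sets.sets_Collect) auto
  then show "{w \<in> space M. finite {i \<in> I. R i w}} \<in> events"
    by (simp add: finite_image_iff[OF inj])
qed

text \<open>Subadditivity, in the form that only refers to finite partial sums.\<close>

lemma (in prob_space) prob_countable_union_le:
  assumes J: "countable J" and meas: "\<And>i. i \<in> J \<Longrightarrow> A i \<in> events"
    and fin: "\<And>G. finite G \<Longrightarrow> G \<subseteq> J \<Longrightarrow> (\<Sum>i\<in>G. prob (A i)) \<le> c"
  shows "prob (\<Union>i\<in>J. A i) \<le> c"
proof (cases "J = {}")
  case True
  then show ?thesis using fin[of "{}"] by simp
next
  case False
  let ?e = "from_nat_into J"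
  have e: "?e n \<in> J" for n using False by (rule from_nat_into)
  let ?B = "\<lambda>n. \<Union>i\<in>?e ` {..n}. A i"
  have B: "?B n \<in> events" for n using meas e by (intro sets.finite_UN) auto
  have "(\<lambda>n. prob (?B n)) \<longlonglongrightarrow> prob (\<Union>n. ?B n)"
    by (rule finite_Lim_measure_incseq) (use B in \<open>auto simp: incseq_def, force+\<close>)
  moreover have "prob (?B n) \<le> c" for n
  proof -
    have "prob (?B n) \<le> (\<Sum>i\<in>?e ` {..n}. prob (A i))"
      by (rule finite_measure_subadditive_finite) (use meas e in auto)
    also have "\<dots> \<le> c" by (rule fin) (use e in auto)
    finally show ?thesis .
  qed
  ultimately have "prob (\<Union>n. ?B n) \<le> c" by (intro LIMSEQ_le_const2) auto
  moreover have "(\<Union>n. ?B n) = (\<Union>i\<in>J. A i)"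
  proof -
    have "(\<Union>n. ?B n) = (\<Union>n. A (?e n))" by auto
    also have "\<dots> = (\<Union>i\<in>range ?e. A i)" by simp
    also have "range ?e = J" by (rule range_from_nat_into[OF False J])
    finally show ?thesis .
  qed
  ultimately show ?thesis by simp
qed

text \<open>Independent real random variables and finitely many disjoint cells that are hit finitely often in
the mean.\<close>

locale indep_points = prob_space M for M :: "'a measure" +
  fixes I :: "'i set" and Y :: "'i \<Rightarrow> 'a \<Rightarrow> real"
    and K :: "'k set" and C :: "'k \<Rightarrow> real set"
  assumes countable_I: "countable I"
    and indep: "indep_vars (\<lambda>_. borel) Y I"
    and finite_K: "finite K"
    and cell_borel: "\<And>k. k \<in> K \<Longrightarrow> C k \<in> sets borel"
    and disjoint_C: "disjoint_family_on C K"
    and summable_hits: "(\<lambda>i. \<Sum>k\<in>K. prob {w \<in> space M. Y i w \<in> C k}) summable_on I"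
begin

definition hit :: "'i \<Rightarrow> 'k \<Rightarrow> real" where
  "hit i k = prob {w \<in> space M. Y i w \<in> C k}"

definition hits :: "'i \<Rightarrow> real" where
  "hits i = (\<Sum>k\<in>K. hit i k)"

definition cell_mean :: "'k \<Rightarrow> real" where
  "cell_mean k = (\<Sum>\<^sub>\<infinity>i\<in>I. hit i k)"

text \<open>The truncation error: the expected number of hits by indices outside \<open>F\<close>.\<close>

definition tail :: "'i set \<Rightarrow> real" where
  "tail F = (\<Sum>\<^sub>\<infinity>i\<in>I. hits i) - sum hits F"

lemma hit_nonneg: "0 \<le> hit i k" by (simp add: hit_def)

lemma hits_nonneg: "0 \<le> hits i" by (simp add: hits_def sum_nonneg hit_nonneg)

lemma Y_meas: "i \<in> I \<Longrightarrow> Y i \<in> borel_measurable M"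
  using indep by (auto simp: indep_vars_def2)

lemma cell_event: "i \<in> I \<Longrightarrow> B \<in> sets borel \<Longrightarrow> {w \<in> space M. Y i w \<in> B} \<in> events"
  using measurable_sets[OF Y_meas, of i B] by (simp add: vimage_def Int_def conj_commute)

lemma cells_borel: "(\<Union>k\<in>K. C k) \<in> sets borel"
  using finite_K cell_borel by (intro sets.finite_UN) auto

lemma hits_eq: "i \<in> I \<Longrightarrow> hits i = prob {w \<in> space M. Y i w \<in> (\<Union>k\<in>K. C k)}"
proof -
  assume i: "i \<in> I"
  have "{w \<in> space M. Y i w \<in> (\<Union>k\<in>K. C k)} = (\<Union>k\<in>K. {w \<in> space M. Y i w \<in> C k})" by auto
  also have "prob \<dots> = (\<Sum>k\<in>K. prob {w \<in> space M. Y i w \<in> C k})"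
  proof (intro finite_measure_finite_Union finite_K)
    show "(\<lambda>k. {w \<in> space M. Y i w \<in> C k}) ` K \<subseteq> events"
      using i cell_event cell_borel by blast
    show "disjoint_family_on (\<lambda>k. {w \<in> space M. Y i w \<in> C k}) K"
      using disjoint_C unfolding disjoint_family_on_def by blast
  qed
  finally show ?thesis by (simp add: hits_def hit_def)
qed

lemma hits_summable: "hits summable_on I"
  using summable_hits by (simp add: hits_def[abs_def] hit_def)

lemma hits_le_1: "i \<in> I \<Longrightarrow> hits i \<le> 1" by (simp add: hits_eq)

lemma hits_sq_summable: "(\<lambda>i. (hits i)\<^sup>2) summable_on I"
  by (rule summable_on_comparison_test[OF hits_summable])
     (use hits_nonneg hits_le_1 in \<open>auto simp: power2_eq_square mult_left_le\<close>)

lemma hit_summable: "k \<in> K \<Longrightarrow> (\<lambda>i. hit i k) summable_on I"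
  by (rule summable_on_comparison_test[OF hits_summable])
     (use finite_K hit_nonneg in \<open>auto simp: hits_def intro!: member_le_sum\<close>)

lemma sum_cell_mean: "(\<Sum>k\<in>K. cell_mean k) = (\<Sum>\<^sub>\<infinity>i\<in>I. hits i)"
proof -
  have "((\<lambda>i. \<Sum>k\<in>L. hit i k) has_sum (\<Sum>k\<in>L. cell_mean k)) I" if "L \<subseteq> K" for L
    using finite_subset[OF that finite_K] that
  proof (induction L rule: finite_induct)
    case (insert k L)
    then show ?case
      by (simp add: cell_mean_def) (intro has_sum_add has_sum_infsum hit_summable, auto)
  qed simp
  from this[of K] show ?thesis by (simp add: hits_def[abs_def] infsumI)
qed

lemma tail_nonneg_sub: "finite F \<Longrightarrow> F \<subseteq> I \<Longrightarrow> finite G \<Longrightarrow> G \<subseteq> I - F \<Longrightarrow> sum hits G \<le> tail F"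
proof -
  assume a: "finite F" "F \<subseteq> I" "finite G" "G \<subseteq> I - F"
  have "sum hits (F \<union> G) \<le> (\<Sum>\<^sub>\<infinity>i\<in>I. hits i)"
    by (rule finite_sum_le_infsum[OF hits_summable]) (use a hits_nonneg in auto)
  moreover have "sum hits (F \<union> G) = sum hits F + sum hits G"
    by (rule sum.union_disjoint) (use a in auto)
  ultimately show ?thesis by (simp add: tail_def)
qed

lemma tail_small:
  assumes "0 < e"
  obtains F where "finite F" "F \<subseteq> I" "\<And>G. finite G \<Longrightarrow> F \<subseteq> G \<Longrightarrow> G \<subseteq> I \<Longrightarrow> tail G \<le> e"
proof -
  obtain F where F: "finite F" "F \<subseteq> I" "dist (sum hits F) (\<Sum>\<^sub>\<infinity>i\<in>I. hits i) \<le> e"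
    using infsum_finite_approximation[OF hits_summable assms] by blast
  have "tail G \<le> e" if G: "finite G" "F \<subseteq> G" "G \<subseteq> I" for G
  proof -
    have "sum hits F \<le> sum hits G" by (rule sum_mono2) (use G hits_nonneg in auto)
    then show ?thesis using F(3) by (auto simp: tail_def dist_real_def)
  qed
  then show thesis using that F by blast
qed

lemma cell_counts_event:
  assumes "J \<subseteq> I"
  shows "{w \<in> space M. cell_counts K C J (\<lambda>i. Y i w) \<in> E} \<in> events"
proof (rule sets_finite_support_valued[OF finite_K])
  fix k n assume k: "k \<in> K"
  have "(\<lambda>w. card {i \<in> J. Y i w \<in> C k}) \<in> measurable M (count_space UNIV)"
    by (rule measurable_card_indices)
       (use assms countable_I k cell_borel cell_event in \<open>auto intro: countable_subset\<close>)
  from measurable_sets[OF this, of "{n}"]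
  have "{w \<in> space M. card {i \<in> J. Y i w \<in> C k} = n} \<in> events"
    by (simp add: vimage_def Int_def conj_commute)
  then show "{w \<in> space M. cell_counts K C J (\<lambda>i. Y i w) k = n} \<in> events"
    using k by (simp add: cell_counts_def)
qed (simp add: cell_counts_def)

lemma cell_law:
  obtains b where
    "\<And>i. i \<in> I \<Longrightarrow> set_pmf (b i) \<subseteq> insert 0 (unit_vec ` K)"
    "\<And>i k. i \<in> I \<Longrightarrow> k \<in> K \<Longrightarrow> pmf (b i) (unit_vec k) = hit i k"
    "\<And>i v. i \<in> I \<Longrightarrow> pmf (b i) v = prob {w \<in> space M. cell_vec K C (Y i w) = v}"
proof -
  let ?V = "insert 0 (unit_vec ` K)"
  let ?p = "\<lambda>i v. prob {w \<in> space M. cell_vec K C (Y i w) = v}"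
  have V: "cell_vec K C y \<in> ?V" for y using cell_vec_cases[OF disjoint_C, of y] by auto
  have ev: "{w \<in> space M. cell_vec K C (Y i w) = v} \<in> events" if "i \<in> I" for i v
    using cell_counts_event[of "{i}" "{v}"] that by (simp add: cell_counts_finite)
  have "\<exists>b. \<forall>v. pmf b v = (if v \<in> ?V then ?p i v else 0)" if i: "i \<in> I" for i
  proof (rule pmf_with_finite_support)
    have "(\<Sum>v\<in>?V. ?p i v) = prob (\<Union>v\<in>?V. {w \<in> space M. cell_vec K C (Y i w) = v})"
      by (rule finite_measure_finite_Union[symmetric])
         (use finite_K ev[OF i] in \<open>auto simp: disjoint_family_on_def\<close>)
    also have "(\<Union>v\<in>?V. {w \<in> space M. cell_vec K C (Y i w) = v}) = space M" using V by blast
    finally show "(\<Sum>v\<in>?V. ?p i v) = 1" by (simp only: prob_space)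
  qed (use finite_K in auto)
  then have "\<forall>i\<in>I. \<exists>b. \<forall>v. pmf b v = (if v \<in> ?V then ?p i v else 0)" by blast
  from bchoice[OF this] obtain b
    where "\<forall>i\<in>I. \<forall>v. pmf (b i) v = (if v \<in> ?V then ?p i v else 0)" by blast
  then have b: "\<And>i v. i \<in> I \<Longrightarrow> pmf (b i) v = (if v \<in> ?V then ?p i v else 0)" by blast
  have b': "pmf (b i) v = ?p i v" if "i \<in> I" for i v
  proof (cases "v \<in> ?V")
    case False
    then have "{w \<in> space M. cell_vec K C (Y i w) = v} = {}" using V by blast
    then have "?p i v = 0" by (simp only: measure_empty)
    then show ?thesis using False that b by simp
  qed (use that b in auto)
  show thesis
  proof (rule that)
    fix i assume i: "i \<in> I"
    show "set_pmf (b i) \<subseteq> ?V"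
    proof
      fix v assume "v \<in> set_pmf (b i)"
      then have "pmf (b i) v \<noteq> 0" by (simp only: set_pmf_iff not_False_eq_True)
      then show "v \<in> ?V" using b[OF i, of v] by (metis (full_types))
    qed
    show "pmf (b i) v = ?p i v" for v by (rule b'[OF i])
    show "pmf (b i) (unit_vec k) = hit i k" if "k \<in> K" for k
      using b'[OF i] cell_vec_eq_unit[OF disjoint_C that] by (simp add: hit_def)
  qed
qed

text \<open>Independence identifies the joint law of the single contributions, and the sum is a function of them.\<close>

lemma cell_counts_law_finite:
  assumes F: "finite F" "F \<subseteq> I"
    and b: "\<And>i v. i \<in> F \<Longrightarrow> pmf (b i) v = prob {w \<in> space M. cell_vec K C (Y i w) = v}"
  shows "prob {w \<in> space M. cell_counts K C F (\<lambda>i. Y i w) \<in> E} = measure (indep_sum_pmf F b) E"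
proof -
  let ?X = "\<lambda>w i. if i \<in> F then cell_vec K C (Y i w) else 0"
  let ?V = "insert 0 (unit_vec ` K)"
  have V: "cell_vec K C y \<in> ?V" for y using cell_vec_cases[OF disjoint_C, of y] by auto
  have borel1: "{y. cell_vec K C y = v} \<in> sets borel" for v
  proof -
    have "{y. cell_vec K C y = v} = (if v = 0 then - (\<Union>k\<in>K. C k) else (\<Union>k\<in>{k\<in>K. unit_vec k = v}. C k))"
      using cell_vec_eq_0[of K C] cell_vec_eq_unit[OF disjoint_C] cell_vec_cases[OF disjoint_C] V
      by (auto simp: unit_vec_nonzero) (metis unit_vec_inj)+
    also have "\<dots> \<in> sets borel"
    proof (cases "v = 0")
      case True
      then show ?thesis using borel_comp[OF cells_borel] by (simp only: simp_thms if_True)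
    next
      case False
      have "(\<Union>k\<in>{k\<in>K. unit_vec k = v}. C k) \<in> sets borel"
        using cell_borel finite_K by (intro sets.finite_UN) auto
      then show ?thesis using False by (simp only: if_False)
    qed
    finally show ?thesis .
  qed
  have ev: "{w \<in> space M. cell_vec K C (Y i w) = v} \<in> events" if "i \<in> F" for i v
    using cell_counts_event[of "{i}" "{v}"] that F by (auto simp: cell_counts_finite)
  have X1: "{w \<in> space M. ?X w = s} \<in> events" for s
  proof (cases "\<forall>i. i \<notin> F \<longrightarrow> s i = 0")
    case True
    then have "{w \<in> space M. ?X w = s} = {w \<in> space M. \<forall>i\<in>F. cell_vec K C (Y i w) = s i}"
      by (auto simp: fun_eq_iff[of "?X _" s])
    then show ?thesis using F(1) ev by (simp add: sets.sets_Collect_finite_All)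
  next
    case False
    then have "{w \<in> space M. ?X w = s} = {}" by (auto simp: fun_eq_iff[of "?X _" s])
    then show ?thesis by (simp only: sets.empty_sets)
  qed
  have Xfin: "?X w \<in> PiE_dflt F 0 (\<lambda>_. ?V)" for w using V by (auto simp: PiE_dflt_def)
  have finV: "finite (PiE_dflt F 0 (\<lambda>_. ?V))" using F finite_K by (intro finite_PiE_dflt) auto
  have Xev: "{w \<in> space M. ?X w \<in> E} \<in> events" for E
  proof -
    have "{w \<in> space M. ?X w \<in> E} = (\<Union>s\<in>E \<inter> PiE_dflt F 0 (\<lambda>_. ?V). {w \<in> space M. ?X w = s})"
      using Xfin by blast
    also have "\<dots> \<in> events" by (rule sets.finite_UN) (use finV X1 in auto)
    finally show ?thesis .
  qed
  have le: "pmf (Pi_pmf F 0 b) s \<le> prob {w \<in> space M. ?X w = s}" for s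
  proof (cases "\<forall>i. i \<notin> F \<longrightarrow> s i = 0")
    case True
    then have eq: "{w \<in> space M. ?X w = s} = {w \<in> space M. \<forall>i\<in>F. cell_vec K C (Y i w) = s i}"
      by (auto simp: fun_eq_iff[of "?X _" s])
    show ?thesis
    proof (cases "F = {}")
      case True
      then show ?thesis using eq by (simp add: prob_space pmf_le_1)
    next
      case False
      have "prob (\<Inter>i\<in>F. Y i -` {y. cell_vec K C y = s i} \<inter> space M)
         = (\<Prod>i\<in>F. prob (Y i -` {y. cell_vec K C y = s i} \<inter> space M))"
        by (rule indep_varsD[OF indep False F]) (rule borel1)
      also have "(\<Inter>i\<in>F. Y i -` {y. cell_vec K C y = s i} \<inter> space M) = {w \<in> space M. ?X w = s}"
        unfolding eq using False by auto
      also have "(\<Prod>i\<in>F. prob (Y i -` {y. cell_vec K C y = s i} \<inter> space M)) = (\<Prod>i\<in>F. pmf (b i) (s i))"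
        by (rule prod.cong) (auto simp: b vimage_def Int_def conj_commute)
      finally show ?thesis using True F(1) by (simp add: pmf_Pi)
    qed
  next
    case False
    then show ?thesis using F(1) by (simp add: pmf_Pi_outside)
  qed
  have "measure (indep_sum_pmf F b) E = measure (Pi_pmf F 0 b) ((\<lambda>s. \<Sum>i\<in>F. s i) -` E)"
    by (simp add: indep_sum_pmf_def measure_map_pmf)
  also have "\<dots> = prob {w \<in> space M. ?X w \<in> (\<lambda>s. \<Sum>i\<in>F. s i) -` E}"
    by (rule discrete_law_eqI[symmetric]) (rule Xev, rule le)
  also have "\<dots> = prob {w \<in> space M. cell_counts K C F (\<lambda>i. Y i w) \<in> E}"
    using F(1) by (simp add: cell_counts_finite)
  finally show ?thesis by simp
qed

text \<open>The two counts differ only if some index outside \<open>F\<close> hits a cell.\<close>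

lemma truncation_error:
  assumes F: "finite F" "F \<subseteq> I"
  shows "\<bar>prob {w \<in> space M. cell_counts K C I (\<lambda>i. Y i w) \<in> E}
       - prob {w \<in> space M. cell_counts K C F (\<lambda>i. Y i w) \<in> E}\<bar> \<le> tail F"
proof -
  let ?bad = "\<Union>i\<in>I - F. {w \<in> space M. Y i w \<in> (\<Union>k\<in>K. C k)}"
  let ?A = "{w \<in> space M. cell_counts K C I (\<lambda>i. Y i w) \<in> E}"
  let ?B = "{w \<in> space M. cell_counts K C F (\<lambda>i. Y i w) \<in> E}"
  have cIF: "countable (I - F)" using countable_I by (rule countable_Diff)
  have hev: "{w \<in> space M. Y i w \<in> (\<Union>k\<in>K. C k)} \<in> events" if "i \<in> I - F" for i
    using cell_event[OF _ cells_borel] that by blast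
  have bad_ev: "?bad \<in> events"
    by (rule sets.countable_UN'[OF cIF]) (use hev in blast)
  have bad: "prob ?bad \<le> tail F"
  proof (rule prob_countable_union_le[OF cIF hev])
    fix G assume G: "finite G" "G \<subseteq> I - F"
    have "(\<Sum>i\<in>G. prob {w \<in> space M. Y i w \<in> (\<Union>k\<in>K. C k)}) = sum hits G"
      by (rule sum.cong) (use G hits_eq in auto)
    then show "(\<Sum>i\<in>G. prob {w \<in> space M. Y i w \<in> (\<Union>k\<in>K. C k)}) \<le> tail F"
      using tail_nonneg_sub[OF F G] by simp
  qed
  have same: "cell_counts K C I (\<lambda>i. Y i w) = cell_counts K C F (\<lambda>i. Y i w)"
    if "w \<in> space M" "w \<notin> ?bad" for w
  proof -
    have "{i \<in> I. Y i w \<in> C k} = {i \<in> F. Y i w \<in> C k}" if "k \<in> K" for k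
      using that \<open>w \<in> space M\<close> \<open>w \<notin> ?bad\<close> F by auto
    then show ?thesis by (auto simp: cell_counts_def fun_eq_iff)
  qed
  have A: "?A \<in> events" and B: "?B \<in> events" by (rule cell_counts_event; use F in simp)+
  have "prob ?A \<le> prob (?B \<union> ?bad)"
    by (rule finite_measure_mono) (use same B bad_ev in auto)
  moreover have "prob (?B \<union> ?bad) \<le> prob ?B + prob ?bad"
    by (rule measure_Un_le[OF B bad_ev])
  moreover have "prob ?B \<le> prob (?A \<union> ?bad)"
    by (rule finite_measure_mono) (use same A bad_ev in auto)
  moreover have "prob (?A \<union> ?bad) \<le> prob ?A + prob ?bad"
    by (rule measure_Un_le[OF A bad_ev])
  ultimately show ?thesis using bad by linarith
qed

lemma poisson_truncation:
  assumes F: "finite F" "F \<subseteq> I"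
  shows "pmf_close (tail F) (mpois K cell_mean) (mpois K (\<lambda>k. \<Sum>i\<in>F. hit i k))"
proof -
  have "(\<Sum>k\<in>K. cell_mean k - (\<Sum>i\<in>F. hit i k)) = tail F"
    by (simp add: sum_subtractf sum_cell_mean tail_def hits_def sum.swap[of _ K F])
  moreover have "pmf_close (\<Sum>k\<in>K. cell_mean k - (\<Sum>i\<in>F. hit i k))
     (mpois K cell_mean) (mpois K (\<lambda>k. \<Sum>i\<in>F. hit i k))"
    by (rule pmf_close_mpois_extra[OF finite_K])
       (use F hit_nonneg hit_summable in \<open>auto simp: cell_mean_def intro!: sum_nonneg finite_sum_le_infsum\<close>)
  ultimately show ?thesis by simp
qed

text \<open>The error for a finite set of indices is bounded by Le Cam's estimate, plus twice the tail: once for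
the points and once for the Poisson vector.\<close>

lemma cell_counts_upper:
  "\<bar>prob {w \<in> space M. cell_counts K C I (\<lambda>i. Y i w) \<in> E} - measure (mpois K cell_mean) E\<bar>
     \<le> (\<Sum>\<^sub>\<infinity>i\<in>I. (hits i)\<^sup>2)" (is "?d \<le> ?s")
proof (rule field_le_epsilon)
  fix e :: real assume "0 < e"
  then obtain F where F: "finite F" "F \<subseteq> I" and t: "tail F \<le> e / 2"
    using tail_small[of "e / 2"] by (metis half_gt_zero order_refl)
  obtain b where b: "\<And>i. i \<in> I \<Longrightarrow> set_pmf (b i) \<subseteq> insert 0 (unit_vec ` K)"
    "\<And>i k. i \<in> I \<Longrightarrow> k \<in> K \<Longrightarrow> pmf (b i) (unit_vec k) = hit i k"
    "\<And>i v. i \<in> I \<Longrightarrow> pmf (b i) v = prob {w \<in> space M. cell_vec K C (Y i w) = v}"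
    by (rule cell_law) blast
  have "pmf_close (\<Sum>i\<in>F. (\<Sum>k\<in>K. pmf (b i) (unit_vec k))\<^sup>2)
     (indep_sum_pmf F b) (mpois K (\<lambda>k. \<Sum>i\<in>F. pmf (b i) (unit_vec k)))"
    by (rule le_cam_finite[OF finite_K F(1)]) (use b(1) F in blast)
  moreover have "mpois K (\<lambda>k. \<Sum>i\<in>F. pmf (b i) (unit_vec k)) = mpois K (\<lambda>k. \<Sum>i\<in>F. hit i k)"
    unfolding mpois_def
    by (rule Pi_pmf_cong[OF refl refl]) (use b F in \<open>auto intro!: arg_cong[where f=pois] sum.cong\<close>)
  moreover have "(\<Sum>i\<in>F. (\<Sum>k\<in>K. pmf (b i) (unit_vec k))\<^sup>2) = (\<Sum>i\<in>F. (hits i)\<^sup>2)"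
    unfolding hits_def by (intro sum.cong refl arg_cong[where f="\<lambda>x. x\<^sup>2"]) (use b F in auto)
  ultimately have "pmf_close (\<Sum>i\<in>F. (hits i)\<^sup>2) (indep_sum_pmf F b) (mpois K (\<lambda>k. \<Sum>i\<in>F. hit i k))"
    by simp
  then have "\<bar>measure (indep_sum_pmf F b) E - measure (mpois K (\<lambda>k. \<Sum>i\<in>F. hit i k)) E\<bar> \<le> (\<Sum>i\<in>F. (hits i)\<^sup>2)"
    by (rule pmf_closeD_sets)
  moreover have "(\<Sum>i\<in>F. (hits i)\<^sup>2) \<le> ?s"
    by (rule finite_sum_le_infsum[OF hits_sq_summable]) (use F in auto)
  moreover have "prob {w \<in> space M. cell_counts K C F (\<lambda>i. Y i w) \<in> E} = measure (indep_sum_pmf F b) E"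
    by (rule cell_counts_law_finite[OF F]) (use b F in auto)
  moreover note truncation_error[OF F, of E] pmf_closeD_sets[OF poisson_truncation[OF F], of E]
  ultimately show "?d \<le> ?s + e" using t by linarith
qed

text \<open>The same truncation transfers the finite lower bound. The finite set is enlarged beyond any given \<open>F0\<close>, so
that the left-hand side is exhausted while the tail stays small.\<close>

lemma cell_counts_lower:
  assumes K1: "K = {k}"
    and d: "\<And>E. \<bar>prob {w \<in> space M. cell_counts K C I (\<lambda>i. Y i w) \<in> E} - measure (mpois K cell_mean) E\<bar> \<le> d"
  shows "(\<Sum>\<^sub>\<infinity>i\<in>I. (hits i)\<^sup>2) \<le> 24 * max 1 (\<Sum>\<^sub>\<infinity>i\<in>I. hits i) * d"
proof (rule infsum_le_finite_sums[OF hits_sq_summable], rule field_le_epsilon)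
  fix F0 and e :: real assume F0: "finite F0" "F0 \<subseteq> I" and e: "0 < e"
  let ?m = "max 1 (\<Sum>\<^sub>\<infinity>i\<in>I. hits i)"
  obtain F1 where F1: "finite F1" "F1 \<subseteq> I" "\<And>G. finite G \<Longrightarrow> F1 \<subseteq> G \<Longrightarrow> G \<subseteq> I \<Longrightarrow> tail G \<le> e / (48 * ?m)"
    \<comment> \<open>The tail enters twice and is multiplied by \<open>24 m\<close>.\<close>
    by (rule tail_small[of "e / (48 * ?m)"]) (use e in \<open>auto intro!: divide_pos_pos\<close>)
  define F where "F = F0 \<union> F1"
  have F: "finite F" "F \<subseteq> I" and t: "tail F \<le> e / (48 * ?m)" using F0 F1 by (auto simp: F_def)
  obtain b where b: "\<And>i. i \<in> I \<Longrightarrow> set_pmf (b i) \<subseteq> insert 0 (unit_vec ` K)"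
    "\<And>i k. i \<in> I \<Longrightarrow> k \<in> K \<Longrightarrow> pmf (b i) (unit_vec k) = hit i k"
    "\<And>i v. i \<in> I \<Longrightarrow> pmf (b i) v = prob {w \<in> space M. cell_vec K C (Y i w) = v}"
    by (rule cell_law) blast
  have hits1: "hits i = hit i k" for i unfolding hits_def by (simp add: K1)
  have "\<bar>measure (indep_sum_pmf F b) E - measure (mpois K (\<lambda>k. \<Sum>i\<in>F. hit i k)) E\<bar> \<le> d + 2 * tail F" for E
    using cell_counts_law_finite[OF F, of b E] b F d[of E] truncation_error[OF F, of E]
      pmf_closeD_sets[OF poisson_truncation[OF F], of E]
    by (smt (verit) subsetD)
  then have close: "pmf_close (d + 2 * tail F) (map_pmf (\<lambda>v. v k) (indep_sum_pmf F b))
      (map_pmf (\<lambda>v. v k) (mpois K (\<lambda>k. \<Sum>i\<in>F. hit i k)))"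
    by (intro pmf_close_setsI) (simp add: measure_map_pmf)
  have "map_pmf (\<lambda>v. v k) (mpois K (\<lambda>k. \<Sum>i\<in>F. hit i k)) = pois (\<Sum>i\<in>F. hit i k)"
    unfolding mpois_def using finite_K by (subst Pi_pmf_component) (auto simp: K1)
  also have "(\<Sum>i\<in>F. hit i k) = sum hits F" by (simp add: hits1)
  finally have "map_pmf (\<lambda>v. v k) (mpois K (\<lambda>k. \<Sum>i\<in>F. hit i k)) = pois (sum hits F)" .
  with close have close': "pmf_close (d + 2 * tail F) (map_pmf (\<lambda>v. v k) (indep_sum_pmf F b)) (pois (sum hits F))"
    by simp
  have bk: "pmf (b i) (unit_vec k) = hits i" if "i \<in> F" for i
    using b(2)[of i k] that F unfolding hits1 by (auto simp: K1)
  have "(\<Sum>i\<in>F. (hits i)\<^sup>2) \<le> 24 * max 1 (sum hits F) * (d + 2 * tail F)"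
  proof (rule barbour_hall_finite[OF F(1) _ _ close'])
    show "0 \<le> hits i \<and> hits i \<le> 1" if "i \<in> F" for i using that F hits_nonneg hits_le_1 by auto
    fix h :: "nat \<Rightarrow> real" assume h: "\<And>n. 0 \<le> h n \<and> h n \<le> 1"
    have "measure_pmf.expectation (map_pmf (\<lambda>v. v k) (indep_sum_pmf F b)) h
       = pbin F (\<lambda>i. pmf (b i) (unit_vec k)) h"
      by (rule expectation_indep_sum_single_cell[OF F(1) _ h]) (use b(1) F K1 in auto)
    also have "\<dots> = pbin F hits h"
      unfolding pbin_def
      by (intro sum.cong refl arg_cong2[where f="(*)"] prod.cong) (use bk in auto)
    finally show "measure_pmf.expectation (map_pmf (\<lambda>v. v k) (indep_sum_pmf F b)) h = pbin F hits h" .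
  qed
  also have "\<dots> \<le> 24 * ?m * (d + 2 * tail F)"
  proof (rule mult_right_mono)
    have "sum hits F \<le> (\<Sum>\<^sub>\<infinity>i\<in>I. hits i)"
      by (rule finite_sum_le_infsum[OF hits_summable]) (use F hits_nonneg in auto)
    then show "24 * max 1 (sum hits F) \<le> 24 * ?m" by auto
    show "0 \<le> d + 2 * tail F" using tail_nonneg_sub[OF F, of "{}"] d[of "{}"] by simp
  qed
  also have "\<dots> \<le> 24 * ?m * d + e"
  proof -
    have "48 * ?m * tail F \<le> 48 * ?m * (e / (48 * ?m))" by (rule mult_left_mono[OF t]) auto
    also have "\<dots> = e" by simp
    finally show ?thesis by (simp add: algebra_simps)
  qed
  also have "(\<Sum>i\<in>F0. (hits i)\<^sup>2) \<le> (\<Sum>i\<in>F. (hits i)\<^sup>2)"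
    by (rule sum_mono2) (use F in \<open>auto simp: F_def\<close>)
  finally show "(\<Sum>i\<in>F0. (hits i)\<^sup>2) \<le> 24 * ?m * d + e" by simp
qed

end

text \<open>A total version of reading off a finite count; it sends infinity, which is not a count, to \<open>0\<close>.\<close>

definition nat_value :: "ennreal \<Rightarrow> nat" where
  "nat_value x = nat \<lfloor>enn2real x\<rfloor>"

lemma nat_value_of_nat [simp]: "nat_value (of_nat n) = n"
  by (simp add: nat_value_def)

text \<open>It suffices to bound the point masses from below, which takes care of the outcomes in which some count
is infinite or not an integer.\<close>

lemma (in prob_space) poisson_counts_law:
  assumes K: "finite K"
    and indep: "indep_vars (\<lambda>_. borel) X K"
    and law: "\<And>k n. k \<in> K \<Longrightarrow> prob {w \<in> space M. X k w = of_nat n} = pmf (pois (m k)) n"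
  shows "{w \<in> space M. (\<lambda>k. if k \<in> K then nat_value (X k w) else 0) \<in> E} \<in> events" (is "?A E \<in> _")
    and "prob {w \<in> space M. (\<lambda>k. if k \<in> K then nat_value (X k w) else 0) \<in> E} = measure (mpois K m) E"
proof -
  let ?V = "\<lambda>w k. if k \<in> K then nat_value (X k w) else 0"
  have X [measurable]: "X k \<in> borel_measurable M" if "k \<in> K" for k
    using indep that by (auto simp: indep_vars_def2)
  have meas: "?A E \<in> events" for E
  proof (rule sets_finite_support_valued[OF K])
    fix k n assume k: "k \<in> K"
    have "(\<lambda>w. nat_value (X k w)) \<in> measurable M (count_space UNIV)"
      unfolding nat_value_def using X[OF k] by measurable
    from measurable_sets[OF this, of "{n}"] k
    show "{w \<in> space M. ?V w k = n} \<in> events"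
      by (simp add: vimage_def Int_def conj_commute)
  qed simp
  then show "?A E \<in> events" .
  have "pmf (mpois K m) v \<le> prob {w \<in> space M. ?V w = v}" for v
  proof (cases "(\<forall>k. k \<notin> K \<longrightarrow> v k = 0) \<and> K \<noteq> {}")
    case True
    have "pmf (mpois K m) v = (\<Prod>k\<in>K. prob {w \<in> space M. X k w = of_nat (v k)})"
      using True K by (simp add: mpois_def pmf_Pi law)
    also have "\<dots> = (\<Prod>k\<in>K. prob (X k -` {of_nat (v k)} \<inter> space M))"
      by (rule prod.cong) (auto intro!: arg_cong[where f=prob])
    also have "\<dots> = prob (\<Inter>k\<in>K. X k -` {of_nat (v k)} \<inter> space M)"
      by (rule indep_varsD[symmetric, OF indep _ K]) (use True in auto)
    also have "\<dots> \<le> prob {w \<in> space M. ?V w = v}"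
    proof (rule finite_measure_mono)
      show "(\<Inter>k\<in>K. X k -` {of_nat (v k)} \<inter> space M) \<subseteq> {w \<in> space M. ?V w = v}"
        using True by (auto simp: fun_eq_iff)
      show "{w \<in> space M. ?V w = v} \<in> events" using meas[of "{v}"] by simp
    qed
    finally show ?thesis .
  next
    case False
    show ?thesis
    proof (cases "\<forall>k. k \<notin> K \<longrightarrow> v k = 0")
      case True
      then have "{w \<in> space M. ?V w = v} = space M" using False by auto
      then show ?thesis by (simp only: prob_space pmf_le_1)
    next
      case False
      then show ?thesis using K by (simp add: mpois_def pmf_Pi_outside)
    qed
  qed
  then show "prob (?A E) = measure (mpois K m) E"
    by (intro discrete_law_eqI meas)
qed

section \<open>Point measures\<close>

lemma sets_pos_borel: "B \<in> sets pos_borel \<longleftrightarrow> B \<in> sets borel \<and> B \<subseteq> {0<..}"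
  by (subst sets_restrict_space_iff) auto

lemma sets_dirac_sum [simp, measurable_cong]: "sets (dirac_sum J y) = sets pos_borel"
  by (simp add: dirac_sum_def)

lemma space_dirac_sum [simp]: "space (dirac_sum J y) = {0<..}"
  by (simp add: dirac_sum_def space_restrict_space)

lemma measurable_points: "y \<in> measurable (count_space {i \<in> J. 0 < y i}) pos_borel"
  by (auto simp: space_restrict_space)

lemma emeasure_dirac_sum:
  assumes "B \<in> sets pos_borel"
  shows "emeasure (dirac_sum J y) B =
    (if finite {i \<in> J. y i \<in> B} then of_nat (card {i \<in> J. y i \<in> B}) else \<infinity>)"
proof -
  have pre: "y -` B \<inter> space (count_space {i \<in> J. 0 < y i}) = {i \<in> J. y i \<in> B}"
    and sub: "{i \<in> J. y i \<in> B} \<subseteq> {i \<in> J. 0 < y i}"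
    using assms by (auto simp: sets_pos_borel)
  have "emeasure (dirac_sum J y) B = emeasure (count_space {i \<in> J. 0 < y i}) {i \<in> J. y i \<in> B}"
    unfolding dirac_sum_def pre[symmetric] by (rule emeasure_distr[OF measurable_points assms])
  then show ?thesis by (simp add: emeasure_count_space[OF sub])
qed

lemma dirac_sum_cong_card:
  assumes "\<And>B. B \<in> sets pos_borel \<Longrightarrow> finite {i \<in> I. x i \<in> B} \<longleftrightarrow> finite {j \<in> J. y j \<in> B}"
    "\<And>B. B \<in> sets pos_borel \<Longrightarrow> card {i \<in> I. x i \<in> B} = card {j \<in> J. y j \<in> B}"
  shows "dirac_sum I x = dirac_sum J y"
  by (rule measure_eqI) (auto simp: emeasure_dirac_sum assms)

lemma dirac_sum_reindex_nat:
  assumes "countable I"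
  shows "\<exists>(J :: nat set) z. dirac_sum I y = dirac_sum J z"
proof -
  let ?e = "to_nat_on I"
  have inj: "inj_on ?e I" using assms by (rule inj_on_to_nat_on)
  let ?z = "\<lambda>n. y (the_inv_into I ?e n)"
  have "{j \<in> ?e ` I. ?z j \<in> B} = ?e ` {i \<in> I. y i \<in> B}" for B
    by (auto simp: the_inv_into_f_f[OF inj])
  moreover have "inj_on ?e {i \<in> I. y i \<in> B}" for B
    by (rule inj_on_subset[OF inj]) auto
  ultimately have "dirac_sum I y = dirac_sum (?e ` I) ?z"
    by (intro dirac_sum_cong_card) (simp_all add: finite_image_iff card_image)
  then show ?thesis by blast
qed

text \<open>Every compact subset of \<open>(0,\<infinity>)\<close> lies in some interval \<open>[1/(n+1), n+1]\<close>. The countable family of conditions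
makes local finiteness a measurable property.\<close>

lemma dirac_sum_in_lf:
  assumes "countable I"
  shows "dirac_sum I y \<in> lf_point_measures \<longleftrightarrow>
    (\<forall>n::nat. finite {i \<in> I. 1 / real (Suc n) \<le> y i \<and> y i \<le> real (Suc n)})"
proof -
  have iff: "emeasure (dirac_sum I y) K < \<infinity> \<longleftrightarrow> finite {i \<in> I. y i \<in> K}"
    if "compact K" "K \<subseteq> {0<..}" for K
  proof -
    have "K \<in> sets pos_borel" using that by (simp add: sets_pos_borel borel_compact)
    then show ?thesis by (simp add: emeasure_dirac_sum of_nat_less_top)
  qed
  have "(\<forall>K. compact K \<and> K \<subseteq> {0<..} \<longrightarrow> finite {i \<in> I. y i \<in> K}) \<longleftrightarrow>
    (\<forall>n::nat. finite {i \<in> I. 1 / real (Suc n) \<le> y i \<and> y i \<le> real (Suc n)})" (is "?L \<longleftrightarrow> ?R")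
  proof
    assume L: ?L
    show ?R
    proof
      fix n
      have "compact {1 / real (Suc n)..real (Suc n)} \<and> {1 / real (Suc n)..real (Suc n)} \<subseteq> {0<..}"
        using less_le_trans[of 0 "1 / real (Suc n)"] by auto
      with L have "finite {i \<in> I. y i \<in> {1 / real (Suc n)..real (Suc n)}}" by blast
      then show "finite {i \<in> I. 1 / real (Suc n) \<le> y i \<and> y i \<le> real (Suc n)}" by simp
    qed
  next
    assume R: ?R
    show ?L
    proof (intro allI impI)
      fix K :: "real set" assume K: "compact K \<and> K \<subseteq> {0<..}"
      show "finite {i \<in> I. y i \<in> K}"
      proof (cases "K = {}")
        case False
        obtain a where a: "a \<in> K" "\<forall>x\<in>K. a \<le> x" using compact_attains_inf K False by metis
        obtain b where b: "b \<in> K" "\<forall>x\<in>K. x \<le> b" using compact_attains_sup K False by metis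
        have a0: "0 < a" using K a by auto
        obtain n1 where n1: "1 / a < real n1" using reals_Archimedean2 by blast
        obtain n2 where n2: "b < real n2" using reals_Archimedean2 by blast
        let ?n = "n1 + n2"
        have "1 / a \<le> real (Suc ?n)" using n1 by simp
        then have "1 / real (Suc ?n) \<le> a" using a0 by (simp add: pos_divide_le_eq mult.commute del: of_nat_Suc)
        moreover have "b \<le> real (Suc ?n)" using n2 by simp
        ultimately have "{i \<in> I. y i \<in> K} \<subseteq> {i \<in> I. 1 / real (Suc ?n) \<le> y i \<and> y i \<le> real (Suc ?n)}"
          using a b by force
        then show ?thesis using R finite_subset by blast
      qed simp
    qed
  qed
  moreover have "dirac_sum I y \<in> lf_point_measures \<longleftrightarrow>
     (\<forall>K. compact K \<and> K \<subseteq> {0<..} \<longrightarrow> finite {i \<in> I. y i \<in> K})"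
    unfolding lf_point_measures_def using dirac_sum_reindex_nat[OF assms, of y] iff by auto
  ultimately show ?thesis by simp
qed

lemma lf_finite_between:
  assumes "dirac_sum I y \<in> lf_point_measures" "0 < a"
  shows "finite {i \<in> I. a \<le> y i \<and> y i \<le> b}"
proof -
  have "compact {a..b} \<and> {a..b} \<subseteq> {0<..}" using assms by auto
  then have "emeasure (dirac_sum I y) {a..b} < \<infinity>" "{a..b} \<in> sets pos_borel"
    using assms by (auto simp: lf_point_measures_def sets_pos_borel)
  then have "finite {i \<in> I. y i \<in> {a..b}}" by (auto simp: emeasure_dirac_sum split: if_splits)
  then show ?thesis by simp
qed

lemma restrict_upto_dirac_sum:
  "restrict_upto \<tau> (dirac_sum J y) = dirac_sum {i \<in> J. y i \<le> \<tau>} y"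
proof (rule measure_eqI)
  fix B assume "B \<in> sets (restrict_upto \<tau> (dirac_sum J y))"
  then have B: "B \<in> sets pos_borel" by (simp add: restrict_upto_def)
  have I: "{0<..\<tau>} \<in> sets pos_borel" by (auto simp: sets_pos_borel)
  have "emeasure (restrict_upto \<tau> (dirac_sum J y)) B
     = (\<integral>\<^sup>+x. indicator {0<..\<tau>} x * indicator B x \<partial>dirac_sum J y)"
    unfolding restrict_upto_def using B I by (subst emeasure_density) auto
  also have "\<dots> = (\<integral>\<^sup>+x. indicator ({0<..\<tau>} \<inter> B) x \<partial>dirac_sum J y)"
    by (intro nn_integral_cong) (auto split: split_indicator)
  also have "\<dots> = emeasure (dirac_sum J y) ({0<..\<tau>} \<inter> B)"
    using B I by (intro nn_integral_indicator) auto
  also have "\<dots> = emeasure (dirac_sum {i \<in> J. y i \<le> \<tau>} y) B"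
  proof -
    have "{i \<in> J. y i \<in> {0<..\<tau>} \<inter> B} = {i \<in> {i \<in> J. y i \<le> \<tau>}. y i \<in> B}"
      using B by (auto simp: sets_pos_borel)
    moreover have "{0<..\<tau>} \<inter> B \<in> sets pos_borel" using B I by blast
    ultimately show ?thesis using B by (simp add: emeasure_dirac_sum)
  qed
  finally show "emeasure (restrict_upto \<tau> (dirac_sum J y)) B = emeasure (dirac_sum {i \<in> J. y i \<le> \<tau>} y) B" .
qed (simp add: restrict_upto_def)

lemma dirac_sum_subset_lf:
  assumes "dirac_sum (I :: nat set) y \<in> lf_point_measures" "J \<subseteq> I"
  shows "dirac_sum J y \<in> lf_point_measures"
  unfolding dirac_sum_in_lf[OF countableI_type]
proof
  fix n
  have "finite {i \<in> I. 1 / real (Suc n) \<le> y i \<and> y i \<le> real (Suc n)}"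
    using assms(1) unfolding dirac_sum_in_lf[OF countableI_type] by (rule spec)
  then show "finite {i \<in> J. 1 / real (Suc n) \<le> y i \<and> y i \<le> real (Suc n)}"
    by (rule finite_subset[rotated]) (use assms(2) in auto)
qed

text \<open>The range of restriction to \<open>(0,\<tau>]\<close> within \<open>\<H>\<close>.\<close>

definition lf_upto :: "real \<Rightarrow> real measure set" where
  "lf_upto \<tau> = {\<eta> \<in> lf_point_measures. \<exists>(J :: nat set) y. \<eta> = dirac_sum J y \<and> (\<forall>i\<in>J. y i \<le> \<tau>)}"

lemma restrict_upto_in_lf_upto:
  assumes "\<eta> \<in> lf_point_measures"
  shows "restrict_upto \<tau> \<eta> \<in> lf_upto \<tau>"
proof -
  obtain J :: "nat set" and y where e: "\<eta> = dirac_sum J y"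
    using assms by (auto simp: lf_point_measures_def)
  have "dirac_sum {i \<in> J. y i \<le> \<tau>} y \<in> lf_point_measures"
    by (rule dirac_sum_subset_lf[of J]) (use assms e in auto)
  then show ?thesis
    unfolding e restrict_upto_dirac_sum lf_upto_def
    by blast
qed

section \<open>Dyadic cells\<close>

definition dyadic_cell :: "real \<Rightarrow> nat \<Rightarrow> nat \<Rightarrow> real set" where
  "dyadic_cell \<tau> m k = {\<tau> * real k / 2 ^ m <.. \<tau> * real (Suc k) / 2 ^ m}"

text \<open>The index \<open>0\<close> is left out: its cell touches \<open>0\<close> and may contain infinitely many points.\<close>

definition dyadic_index :: "nat \<Rightarrow> nat set" where
  "dyadic_index m = {1..<2 ^ m}"

definition grid_counts :: "real \<Rightarrow> nat \<Rightarrow> real measure \<Rightarrow> nat \<Rightarrow> nat" where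
  "grid_counts \<tau> m \<eta> =
     (\<lambda>k. if k \<in> dyadic_index m then nat_value (emeasure \<eta> (dyadic_cell \<tau> m k)) else 0)"

lemma dyadic_cell_pos:
  assumes "0 < \<tau>"
  shows "dyadic_cell \<tau> m k \<in> sets pos_borel"
  using assms by (auto simp: sets_pos_borel dyadic_cell_def intro: le_less_trans[rotated])

lemma dyadic_cell_unique:
  assumes "0 < \<tau>" "x \<in> dyadic_cell \<tau> m k" "x \<in> dyadic_cell \<tau> m l"
  shows "k = l"
proof -
  have "real k < x * 2 ^ m / \<tau>" "x * 2 ^ m / \<tau> \<le> real (Suc k)"
    "real l < x * 2 ^ m / \<tau>" "x * 2 ^ m / \<tau> \<le> real (Suc l)"
    using assms by (auto simp: dyadic_cell_def field_simps)
  then have "real k < real (Suc l)" "real l < real (Suc k)" by linarith+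
  then show ?thesis by linarith
qed

lemma dyadic_cells_disjoint:
  "0 < \<tau> \<Longrightarrow> disjoint_family_on (dyadic_cell \<tau> m) K"
  using dyadic_cell_unique by (fastforce simp: disjoint_family_on_def)

lemma dyadic_cell_exists:
  assumes "0 < \<tau>" "0 < x" "x \<le> \<tau>"
  obtains k where "k < 2 ^ m" "x \<in> dyadic_cell \<tau> m k"
proof -
  let ?u = "x * 2 ^ m / \<tau>"
  have u: "0 < ?u" "?u \<le> 2 ^ m" using assms by (auto simp: field_simps)
  define k where "k = nat (\<lceil>?u\<rceil> - 1)"
  have c: "1 \<le> \<lceil>?u\<rceil>" using u by linarith
  then have k: "real k = of_int \<lceil>?u\<rceil> - 1" by (simp add: k_def)
  have "real k < ?u" "?u \<le> real (Suc k)" using k by linarith+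
  then have "x \<in> dyadic_cell \<tau> m k" using assms by (auto simp: dyadic_cell_def field_simps)
  moreover have "real k < 2 ^ m" using \<open>real k < ?u\<close> u by linarith
  then have "k < 2 ^ m" by (metis of_nat_less_iff of_nat_numeral of_nat_power)
  ultimately show thesis using that by blast
qed

lemma dyadic_cell_bounds:
  assumes "0 < \<tau>" "k \<in> dyadic_index m"
  shows "dyadic_cell \<tau> m k \<subseteq> {\<tau> / 2 ^ m<..\<tau>}"
proof
  fix x assume x: "x \<in> dyadic_cell \<tau> m k"
  have k: "1 \<le> real k" "real (Suc k) \<le> 2 ^ m"
    using assms(2) by (auto simp: dyadic_index_def Suc_le_eq) (metis Suc_le_eq of_nat_Suc of_nat_le_iff of_nat_numeral of_nat_power)
  have "\<tau> / 2 ^ m \<le> \<tau> * real k / 2 ^ m" using k assms by (simp add: divide_right_mono)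
  moreover have "\<tau> * real (Suc k) / 2 ^ m \<le> \<tau>"
    using k assms by (simp add: pos_divide_le_eq del: of_nat_Suc)
  ultimately show "x \<in> {\<tau> / 2 ^ m<..\<tau>}" using x by (auto simp: dyadic_cell_def)
qed

lemma dyadic_cell_split:
  "dyadic_cell \<tau> m k = dyadic_cell \<tau> (Suc m) (2 * k) \<union> dyadic_cell \<tau> (Suc m) (Suc (2 * k))"
  if "0 < \<tau>"
proof -
  have "\<tau> * real (2 * k) / 2 ^ Suc m = \<tau> * real k / 2 ^ m"
    "\<tau> * real (Suc (Suc (2 * k))) / 2 ^ Suc m = \<tau> * real (Suc k) / 2 ^ m"
    by (auto simp: field_simps)
  moreover have "\<tau> * real (2 * k) / 2 ^ Suc m \<le> \<tau> * real (Suc (2 * k)) / 2 ^ Suc m"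
    "\<tau> * real (Suc (2 * k)) / 2 ^ Suc m \<le> \<tau> * real (Suc (Suc (2 * k))) / 2 ^ Suc m"
    by (intro divide_right_mono mult_left_mono; use that in simp)+
  ultimately show ?thesis unfolding dyadic_cell_def by (subst ivl_disj_un_two(6)) auto
qed

lemma grid_counts_dirac_sum:
  assumes t: "0 < \<tau>" and lf: "dirac_sum J y \<in> lf_point_measures"
  shows "grid_counts \<tau> m (dirac_sum J y) = cell_counts (dyadic_index m) (dyadic_cell \<tau> m) J y"
    and "k \<in> dyadic_index m \<Longrightarrow> finite {i \<in> J. y i \<in> dyadic_cell \<tau> m k}"
proof -
  show fin: "finite {i \<in> J. y i \<in> dyadic_cell \<tau> m k}" if k: "k \<in> dyadic_index m" for k
    using dyadic_cell_bounds[OF t k] t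
    by (intro finite_subset[OF _ lf_finite_between[OF lf, of "\<tau> / 2 ^ m" \<tau>]]) force+
  then show "grid_counts \<tau> m (dirac_sum J y) = cell_counts (dyadic_index m) (dyadic_cell \<tau> m) J y"
    using dyadic_cell_pos[OF t] by (auto simp: grid_counts_def cell_counts_def emeasure_dirac_sum fun_eq_iff)
qed

lemma grid_counts_coarsen:
  assumes t: "0 < \<tau>" and lf: "\<eta> \<in> lf_point_measures"
  shows "grid_counts \<tau> m \<eta> = (\<lambda>k. if k \<in> dyadic_index m
     then grid_counts \<tau> (Suc m) \<eta> (2 * k) + grid_counts \<tau> (Suc m) \<eta> (Suc (2 * k)) else 0)"
proof
  fix k
  obtain J :: "nat set" and y where e: "\<eta> = dirac_sum J y"
    using lf by (auto simp: lf_point_measures_def)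
  show "grid_counts \<tau> m \<eta> k = (if k \<in> dyadic_index m
     then grid_counts \<tau> (Suc m) \<eta> (2 * k) + grid_counts \<tau> (Suc m) \<eta> (Suc (2 * k)) else 0)"
  proof (cases "k \<in> dyadic_index m")
    case True
    then have k2: "2 * k \<in> dyadic_index (Suc m)" "Suc (2 * k) \<in> dyadic_index (Suc m)"
      by (auto simp: dyadic_index_def)
    have "{i \<in> J. y i \<in> dyadic_cell \<tau> m k} =
      {i \<in> J. y i \<in> dyadic_cell \<tau> (Suc m) (2 * k)} \<union> {i \<in> J. y i \<in> dyadic_cell \<tau> (Suc m) (Suc (2 * k))}"
      using dyadic_cell_split[OF t, of m k] by auto
    moreover have "{i \<in> J. y i \<in> dyadic_cell \<tau> (Suc m) (2 * k)} \<inter> {i \<in> J. y i \<in> dyadic_cell \<tau> (Suc m) (Suc (2 * k))} = {}"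
      using dyadic_cell_unique[OF t, of _ "Suc m" "2 * k" "Suc (2 * k)"] by auto
    ultimately have "card {i \<in> J. y i \<in> dyadic_cell \<tau> m k} =
       card {i \<in> J. y i \<in> dyadic_cell \<tau> (Suc m) (2 * k)} + card {i \<in> J. y i \<in> dyadic_cell \<tau> (Suc m) (Suc (2 * k))}"
      using grid_counts_dirac_sum(2)[OF t lf[unfolded e] k2(1)] grid_counts_dirac_sum(2)[OF t lf[unfolded e] k2(2)]
      by (simp add: card_Un_disjoint)
    then show ?thesis
      using True k2 unfolding e grid_counts_dirac_sum(1)[OF t lf[unfolded e]] by (simp add: cell_counts_def)
  qed (simp add: grid_counts_def)
qed

section \<open>Vaguely open sets are determined by dyadic counts\<close>

lemma integral_dirac_sum:
  assumes f: "f \<in> borel_measurable pos_borel"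
    and T: "finite T" "T \<subseteq> {i \<in> J. 0 < y i}" "\<And>i. i \<in> J \<Longrightarrow> 0 < y i \<Longrightarrow> i \<notin> T \<Longrightarrow> f (y i) = 0"
  shows "(LINT x|dirac_sum J y. f x) = (\<Sum>i\<in>T. f (y i :: real) :: real)"
proof -
  have "(LINT x|dirac_sum J y. f x) = (LINT i|count_space {i \<in> J. 0 < y i}. f (y i))"
    unfolding dirac_sum_def by (rule integral_distr[OF measurable_points f])
  also have "\<dots> = (\<Sum>i | i \<in> {i \<in> J. 0 < y i} \<and> f (y i) \<noteq> 0. f (y i))"
    by (rule lebesgue_integral_count_space_finite_support) (rule finite_subset[OF _ T(1)], use T in auto)
  also have "\<dots> = (\<Sum>i\<in>T. f (y i))"
    by (rule sum.mono_neutral_left) (use T in auto)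
  finally show ?thesis .
qed

lemma test_function_measurable: "f \<in> vague_test_functions \<Longrightarrow> f \<in> borel_measurable pos_borel"
  unfolding vague_test_functions_def by (auto intro: borel_measurable_continuous_on_restrict)

lemma test_function_vanishes_near_0:
  assumes "f \<in> vague_test_functions"
  obtains a where "0 < a" "\<And>x. 0 < x \<Longrightarrow> x \<le> a \<Longrightarrow> f x = 0"
proof -
  obtain K where K: "compact K" "K \<subseteq> {0<..}" "\<And>x. x \<in> {0<..} - K \<Longrightarrow> f x = 0"
    using assms by (auto simp: vague_test_functions_def)
  show thesis
  proof (cases "K = {}")
    case True
    then show ?thesis using that[of 1] K by auto
  next
    case False
    obtain b where b: "b \<in> K" "\<forall>x\<in>K. b \<le> x" using compact_attains_inf K(1) False by metis
    then have "0 < b" using K(2) by auto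
    then show ?thesis using that[of "b / 2"] b K(3) by fastforce
  qed
qed

text \<open>The cells that lie above \<open>a\<close>. The points in them are at most the points in \<open>[a,\<tau>]\<close>, for every mesh.\<close>

definition upper_index :: "real \<Rightarrow> nat \<Rightarrow> real \<Rightarrow> nat set" where
  "upper_index \<tau> m a = {k \<in> dyadic_index m. a \<le> \<tau> * real k / 2 ^ m}"

text \<open>The Riemann sum of \<open>f\<close> with the counts as weights and the right end points as nodes.\<close>

definition grid_sum :: "real \<Rightarrow> nat \<Rightarrow> real \<Rightarrow> (real \<Rightarrow> real) \<Rightarrow> real measure \<Rightarrow> real" where
  "grid_sum \<tau> m a f \<eta> =
     (\<Sum>k\<in>upper_index \<tau> m a. real (grid_counts \<tau> m \<eta> k) * f (\<tau> * real (Suc k) / 2 ^ m))"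

text \<open>Below \<open>2 a\<close> the test function vanishes, and on \<open>[a,\<tau>]\<close> it is uniformly continuous, so that it varies by
less than \<open>e\<close> on each cell of a fine grid. The mesh may be chosen independently of \<open>\<eta>\<close>, and \<open>a\<close> independently of
\<open>e\<close>.\<close>

lemma integral_near_grid_sum:
  assumes t: "0 < \<tau>" and f: "f \<in> vague_test_functions"
  obtains a where "0 < a" "\<And>e. 0 < e \<Longrightarrow> \<exists>m0. \<forall>m\<ge>m0. \<forall>\<eta>\<in>lf_upto \<tau>.
     \<bar>(LINT x|\<eta>. f x) - grid_sum \<tau> m a f \<eta>\<bar> \<le> e * grid_sum \<tau> m a (\<lambda>_. 1) \<eta>"
proof -
  obtain b where b: "0 < b" "\<And>x. 0 < x \<Longrightarrow> x \<le> b \<Longrightarrow> f x = 0"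
    by (rule test_function_vanishes_near_0[OF f]) blast
  define a where "a = b / 2"
  have a: "0 < a" using b by (simp add: a_def)
  show thesis
  proof (rule that[OF a])
  fix e :: real assume e: "0 < e"
  have "continuous_on {a..\<tau>} f"
    using f a by (auto simp: vague_test_functions_def intro: continuous_on_subset)
  then have "uniformly_continuous_on {a..\<tau>} f" by (rule compact_uniformly_continuous) auto
  then obtain \<delta> where \<delta>: "0 < \<delta>"
    "\<And>x x'. x \<in> {a..\<tau>} \<Longrightarrow> x' \<in> {a..\<tau>} \<Longrightarrow> dist x' x < \<delta> \<Longrightarrow> dist (f x') (f x) < e"
    by (rule uniformly_continuous_onE[OF _ e]) blast
  obtain m0 where m0: "\<tau> / min a \<delta> < 2 ^ m0" using real_arch_pow[of 2] by auto
  have small: "\<tau> / 2 ^ m < a \<and> \<tau> / 2 ^ m < \<delta>" if "m0 \<le> m" for m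
  proof -
    have "(2::real) ^ m0 \<le> 2 ^ m" using that by simp
    then have "\<tau> / min a \<delta> < 2 ^ m" using m0 by linarith
    then have "\<tau> < 2 ^ m * min a \<delta>" using a \<delta>(1) by (simp add: pos_divide_less_eq)
    then have "\<tau> < min a \<delta> * 2 ^ m" by (simp only: mult.commute)
    then have "\<tau> / 2 ^ m < min a \<delta>" by (subst pos_divide_less_eq) (simp, assumption)
    then show ?thesis by simp
  qed
  show "\<exists>m0. \<forall>m\<ge>m0. \<forall>\<eta>\<in>lf_upto \<tau>.
     \<bar>(LINT x|\<eta>. f x) - grid_sum \<tau> m a f \<eta>\<bar> \<le> e * grid_sum \<tau> m a (\<lambda>_. 1) \<eta>"
  proof (intro exI[of _ m0] allI impI ballI)
    fix m \<eta> assume m: "m0 \<le> m" and \<eta>: "\<eta> \<in> lf_upto \<tau>"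
    define \<kappa> where "\<kappa> = {k \<in> dyadic_index m. a \<le> \<tau> * real k / 2 ^ m}"
    have \<kappa>: "finite \<kappa>" by (simp add: \<kappa>_def dyadic_index_def)
    obtain J :: "nat set" and y where J: "\<eta> = dirac_sum J y" "\<And>i. i \<in> J \<Longrightarrow> y i \<le> \<tau>"
      using \<eta> unfolding lf_upto_def by blast
    have lf: "dirac_sum J y \<in> lf_point_measures" using \<eta> J(1) by (auto simp: lf_upto_def)
    let ?J = "\<lambda>k. {i \<in> J. y i \<in> dyadic_cell \<tau> m k}"
    let ?t = "\<lambda>k. \<tau> * real (Suc k) / 2 ^ m"
    have finJ: "finite (?J k)" if "k \<in> \<kappa>" for k
      using grid_counts_dirac_sum(2)[OF t lf] that by (auto simp: \<kappa>_def)
    have cnt: "grid_counts \<tau> m \<eta> k = card (?J k)" if "k \<in> \<kappa>" for k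
      using that unfolding J(1) grid_counts_dirac_sum(1)[OF t lf] by (simp add: cell_counts_def \<kappa>_def)
    have "(LINT x|\<eta>. f x) = (\<Sum>i\<in>(\<Union>k\<in>\<kappa>. ?J k). f (y i))"
      unfolding J(1)
    proof (rule integral_dirac_sum[OF test_function_measurable[OF f]])
      show "finite (\<Union>k\<in>\<kappa>. ?J k)" using \<kappa> finJ by blast
      show "(\<Union>k\<in>\<kappa>. ?J k) \<subseteq> {i \<in> J. 0 < y i}"
        using dyadic_cell_pos[OF t] unfolding sets_pos_borel by blast
      fix i assume i: "i \<in> J" "0 < y i" "i \<notin> (\<Union>k\<in>\<kappa>. ?J k)"
      obtain k where k: "k < 2 ^ m" "y i \<in> dyadic_cell \<tau> m k"
        by (rule dyadic_cell_exists[OF t i(2) J(2)[OF i(1)]]) blast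
      have "k \<notin> \<kappa>" using i k by auto
      then have "\<tau> * real k / 2 ^ m < a"
        using k(1) a by (cases "k = 0") (auto simp: \<kappa>_def dyadic_index_def)
      moreover have "y i \<le> \<tau> * real k / 2 ^ m + \<tau> / 2 ^ m"
        using k(2) by (auto simp: dyadic_cell_def add_divide_distrib algebra_simps)
      moreover have "b = a + a" by (simp add: a_def)
      ultimately have "y i \<le> b" using small[OF m, THEN conjunct1] by linarith
      then show "f (y i) = 0" using b(2) i by auto
    qed
    also have "\<dots> = (\<Sum>k\<in>\<kappa>. \<Sum>i\<in>?J k. f (y i))"
      by (rule sum.UNION_disjoint) (use \<kappa> finJ dyadic_cell_unique[OF t] in auto)
    finally have int: "(LINT x|\<eta>. f x) = (\<Sum>k\<in>\<kappa>. \<Sum>i\<in>?J k. f (y i))" .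
    have "\<bar>(LINT x|\<eta>. f x) - (\<Sum>k\<in>\<kappa>. real (grid_counts \<tau> m \<eta> k) * f (?t k))\<bar>
       = \<bar>\<Sum>k\<in>\<kappa>. \<Sum>i\<in>?J k. (f (y i) - f (?t k))\<bar>"
      unfolding int by (simp add: sum_subtractf cnt cong: sum.cong)
    also have "\<dots> \<le> (\<Sum>k\<in>\<kappa>. \<Sum>i\<in>?J k. \<bar>f (y i) - f (?t k)\<bar>)"
      by (rule order_trans[OF sum_abs sum_mono[OF sum_abs]])
    also have "\<dots> \<le> (\<Sum>k\<in>\<kappa>. \<Sum>i\<in>?J k. e)"
    proof (intro sum_mono)
      fix k i assume k: "k \<in> \<kappa>" and i: "i \<in> ?J k"
      have kI: "k \<in> dyadic_index m" using k by (simp add: \<kappa>_def)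
      have bounds: "\<tau> * real k / 2 ^ m < y i" "y i \<le> ?t k" using i by (auto simp: dyadic_cell_def)
      have tk: "?t k = \<tau> * real k / 2 ^ m + \<tau> / 2 ^ m" by (simp add: add_divide_distrib algebra_simps)
      have "0 < \<tau> / 2 ^ m" using t by simp
      then have "?t k \<in> dyadic_cell \<tau> m k" using tk by (auto simp: dyadic_cell_def)
      then have "?t k \<le> \<tau>" using dyadic_cell_bounds[OF t kI] by auto
      moreover have "a \<le> \<tau> * real k / 2 ^ m" using k by (simp add: \<kappa>_def)
      ultimately have "dist (f (y i)) (f (?t k)) < e"
        using bounds tk small[OF m] by (intro \<delta>(2)) (auto simp: dist_real_def)
      then show "\<bar>f (y i) - f (?t k)\<bar> \<le> e" by (simp add: dist_real_def)
    qed
    also have "\<dots> = e * (\<Sum>k\<in>\<kappa>. real (grid_counts \<tau> m \<eta> k))"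
      by (simp add: sum_distrib_left cnt mult.commute cong: sum.cong)
    finally show "\<bar>(LINT x|\<eta>. f x) - grid_sum \<tau> m a f \<eta>\<bar> \<le> e * grid_sum \<tau> m a (\<lambda>_. 1) \<eta>"
      by (simp only: \<kappa>_def upper_index_def grid_sum_def mult_1_right)
  qed
  qed
qed

lemma grid_counts_upper_sum_le:
  assumes t: "0 < \<tau>" and lf: "dirac_sum J y \<in> lf_point_measures" and a: "0 < a"
  shows "(\<Sum>k\<in>upper_index \<tau> m a. grid_counts \<tau> m (dirac_sum J y) k) \<le> card {i \<in> J. a \<le> y i \<and> y i \<le> \<tau>}"
proof -
  let ?J = "\<lambda>k. {i \<in> J. y i \<in> dyadic_cell \<tau> m k}"
  have fin: "finite (upper_index \<tau> m a)" by (simp add: upper_index_def dyadic_index_def)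
  have "(\<Sum>k\<in>upper_index \<tau> m a. grid_counts \<tau> m (dirac_sum J y) k) = (\<Sum>k\<in>upper_index \<tau> m a. card (?J k))"
    unfolding grid_counts_dirac_sum(1)[OF t lf]
    by (rule sum.cong) (auto simp: cell_counts_def upper_index_def)
  also have "\<dots> = card (\<Union>k\<in>upper_index \<tau> m a. ?J k)"
    by (rule card_UN_disjoint[symmetric])
       (use fin grid_counts_dirac_sum(2)[OF t lf] dyadic_cell_unique[OF t] in \<open>auto simp: upper_index_def\<close>)
  also have "\<dots> \<le> card {i \<in> J. a \<le> y i \<and> y i \<le> \<tau>}"
  proof (rule card_mono[OF lf_finite_between[OF lf a]], safe)
    fix k i assume k: "k \<in> upper_index \<tau> m a" and i: "i \<in> J" "y i \<in> dyadic_cell \<tau> m k"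
    have "a \<le> \<tau> * real k / 2 ^ m" "\<tau> * real k / 2 ^ m < y i"
      using k i by (auto simp: upper_index_def dyadic_cell_def)
    then show "a \<le> y i" by linarith
    show "y i \<le> \<tau>" using dyadic_cell_bounds[OF t, of k m] k i by (auto simp: upper_index_def)
  qed
  finally show ?thesis .
qed

text \<open>It is enough to treat the sets that generate the topology. Measures with the same counts have the same
Riemann sums, so their integrals of \<open>f\<close> differ by at most \<open>2 e'\<close> times the number \<open>c\<close> of points of \<open>\<eta>0\<close> in
\<open>[a,\<tau>]\<close>. The claim holds for all sufficiently fine grids because this form is stable under finite intersections.\<close>

lemma open_determined_by_grid:
  assumes t: "0 < \<tau>" and U: "openin vague_topology U" and \<eta>0: "\<eta>0 \<in> lf_upto \<tau>" "\<eta>0 \<in> U"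
  shows "\<exists>m0. \<forall>m\<ge>m0. \<forall>\<eta>\<in>lf_upto \<tau>. grid_counts \<tau> m \<eta> = grid_counts \<tau> m \<eta>0 \<longrightarrow> \<eta> \<in> U"
proof -
  have "generate_topology_on
     {{\<eta> \<in> lf_point_measures. (LINT x|\<eta>. f x) \<in> U} | f U. f \<in> vague_test_functions \<and> open U} U"
    using U unfolding vague_topology_def by (simp add: openin_topology_generated_by_iff)
  then show ?thesis using \<eta>0(2)
  proof (induction rule: generate_topology_on.induct)
    case Empty
    then show ?case by simp
  next
    case (Int A B)
    then obtain m1 m2 where
      "\<forall>m\<ge>m1. \<forall>\<eta>\<in>lf_upto \<tau>. grid_counts \<tau> m \<eta> = grid_counts \<tau> m \<eta>0 \<longrightarrow> \<eta> \<in> A"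
      "\<forall>m\<ge>m2. \<forall>\<eta>\<in>lf_upto \<tau>. grid_counts \<tau> m \<eta> = grid_counts \<tau> m \<eta>0 \<longrightarrow> \<eta> \<in> B" by blast
    then show ?case by (intro exI[of _ "max m1 m2"]) auto
  next
    case (UN \<K>)
    then obtain A where "A \<in> \<K>" "\<eta>0 \<in> A" by blast
    then show ?case using UN.IH[of A] by blast
  next
    case (Basis A)
    then obtain f V where A: "A = {\<eta> \<in> lf_point_measures. (LINT x|\<eta>. f x) \<in> V}"
      and f: "f \<in> vague_test_functions" and V: "open V" by auto
    have "(LINT x|\<eta>0. f x) \<in> V" using A Basis by auto
    with V have "\<exists>e>0. \<forall>z. dist z (LINT x|\<eta>0. f x) < e \<longrightarrow> z \<in> V"
      unfolding open_dist by (rule bspec)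
    then obtain e where e: "0 < e" "\<And>z. \<bar>z - (LINT x|\<eta>0. f x)\<bar> < e \<Longrightarrow> z \<in> V"
      unfolding dist_real_def by metis
    obtain a where a: "0 < a" and app: "\<And>e. 0 < e \<Longrightarrow> \<exists>m0. \<forall>m\<ge>m0. \<forall>\<eta>\<in>lf_upto \<tau>.
     \<bar>(LINT x|\<eta>. f x) - grid_sum \<tau> m a f \<eta>\<bar> \<le> e * grid_sum \<tau> m a (\<lambda>_. 1) \<eta>"
      by (rule integral_near_grid_sum[OF t f]) blast
    obtain J :: "nat set" and y where J: "\<eta>0 = dirac_sum J y" using \<eta>0(1) by (auto simp: lf_upto_def)
    have lf: "dirac_sum J y \<in> lf_point_measures" using \<eta>0(1) J by (auto simp: lf_upto_def)
    define c where "c = real (card {i \<in> J. a \<le> y i \<and> y i \<le> \<tau>})"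
    define e' where "e' = e / (2 * c + 1)"
    have c: "0 \<le> c" by (simp add: c_def)
    have e': "0 < e'" using e c by (simp add: e'_def)
    have ce: "2 * (e' * c) < e" using e c by (simp add: e'_def field_simps)
    obtain m0 where m0: "\<And>m \<eta>. m0 \<le> m \<Longrightarrow> \<eta> \<in> lf_upto \<tau> \<Longrightarrow>
      \<bar>(LINT x|\<eta>. f x) - grid_sum \<tau> m a f \<eta>\<bar> \<le> e' * grid_sum \<tau> m a (\<lambda>_. 1) \<eta>"
      using app[OF e'] by blast
    show ?case
    proof (intro exI[of _ m0] allI impI ballI)
      fix m \<eta> assume m: "m0 \<le> m" and \<eta>: "\<eta> \<in> lf_upto \<tau>" and eq: "grid_counts \<tau> m \<eta> = grid_counts \<tau> m \<eta>0"
      have "grid_sum \<tau> m a (\<lambda>_. 1) \<eta>0 \<le> c"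
        using grid_counts_upper_sum_le[OF t lf a, of m] unfolding J c_def by (simp add: grid_sum_def flip: of_nat_sum)
      then have "e' * grid_sum \<tau> m a (\<lambda>_. 1) \<eta>0 \<le> e' * c"
        using e' by (intro mult_left_mono) auto
      moreover have "grid_sum \<tau> m a h \<eta> = grid_sum \<tau> m a h \<eta>0" for h
        by (simp only: grid_sum_def eq)
      ultimately have "\<bar>(LINT x|\<eta>. f x) - (LINT x|\<eta>0. f x)\<bar> < e"
        using m0[OF m \<eta>] m0[OF m \<eta>0(1)] ce by (simp only:)
      then have "(LINT x|\<eta>. f x) \<in> V" by (rule e(2))
      then show "\<eta> \<in> A" using \<eta> unfolding A by (auto simp: lf_upto_def)
    qed
  qed
qed

section \<open>Approximation by a generating algebra\<close>

text \<open>The sets that can be approximated form a sigma-algebra. A countable union is first replaced by a finite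
one, and then each member by an element of the algebra. Both measures are treated at once, since the same element
has to serve for both.\<close>

lemma generating_algebra_approx:
  assumes alg: "algebra \<Omega> \<A>" and fm: "finite_measure M1" "finite_measure M2"
    and s1: "sets M1 = sigma_sets \<Omega> \<A>" and s2: "sets M2 = sigma_sets \<Omega> \<A>"
    and A: "A \<in> sigma_sets \<Omega> \<A>" and e: "0 < e"
  shows "\<exists>B\<in>\<A>. measure M1 ((A - B) \<union> (B - A)) < e \<and> measure M2 ((A - B) \<union> (B - A)) < e"
  using A e
proof (induction arbitrary: e)
  case (Basic a)
  then show ?case by (intro bexI[of _ a]) auto
next
  case Empty
  interpret algebra \<Omega> \<A> by fact
  show ?case using Empty by (intro bexI[of _ "{}"]) auto
next
  case (Compl a)
  interpret algebra \<Omega> \<A> by fact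
  obtain B where B: "B \<in> \<A>" "measure M1 ((a - B) \<union> (B - a)) < e" "measure M2 ((a - B) \<union> (B - a)) < e"
    using Compl by blast
  have "B \<subseteq> \<Omega>" "a \<subseteq> \<Omega>"
    using B space_closed Compl.hyps sigma_sets_into_sp[OF space_closed] by auto
  then have "(\<Omega> - a - (\<Omega> - B)) \<union> (\<Omega> - B - (\<Omega> - a)) = (a - B) \<union> (B - a)" by auto
  then show ?case using B by (intro bexI[of _ "\<Omega> - B"]) auto
next
  case (Union a)
  interpret algebra \<Omega> \<A> by fact
  interpret M1: finite_measure M1 by fact
  interpret M2: finite_measure M2 by fact
  let ?U = "\<Union>i. a i"
  let ?V = "\<lambda>n. \<Union>i<n. a i"
  have as: "a i \<in> sigma_sets \<Omega> \<A>" for i using Union.hyps by blast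
  have V: "?V n \<in> sigma_sets \<Omega> \<A>" for n
    using as sets.finite_UN[of "{..<n}" a M1] by (simp add: s1)
  have U: "?U \<in> sigma_sets \<Omega> \<A>" using as by (rule sigma_sets.Union)
  have U_eq: "(\<Union>n. ?V n) = ?U" by auto
  have inc: "incseq ?V" unfolding incseq_def by (intro allI impI UN_mono) auto
  have "(\<lambda>n. measure M1 (?V n)) \<longlonglongrightarrow> measure M1 ?U"
    using M1.finite_Lim_measure_incseq[OF _ inc] V by (auto simp: s1 U_eq)
  then have e1: "eventually (\<lambda>n. measure M1 ?U - e / 2 < measure M1 (?V n)) sequentially"
    using Union.prems by (intro order_tendstoD(1)) auto
  have "(\<lambda>n. measure M2 (?V n)) \<longlonglongrightarrow> measure M2 ?U"
    using M2.finite_Lim_measure_incseq[OF _ inc] V by (auto simp: s2 U_eq)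
  then have e2: "eventually (\<lambda>n. measure M2 ?U - e / 2 < measure M2 (?V n)) sequentially"
    using Union.prems by (intro order_tendstoD(1)) auto
  obtain n where n: "measure M1 ?U - e / 2 < measure M1 (?V n)" "measure M2 ?U - e / 2 < measure M2 (?V n)"
    using eventually_happens[OF eventually_conj[OF e1 e2]] by auto
  \<comment> \<open>Passing to a finite union has cost one half of \<open>e\<close>; the summand \<open>1\<close> is there for \<open>n = 0\<close>.\<close>
  let ?d = "e / (2 * (real n + 1))"
  have d: "0 < ?d" using Union.prems by simp
  have "\<forall>i. \<exists>B. B \<in> \<A> \<and> measure M1 ((a i - B) \<union> (B - a i)) < ?d \<and> measure M2 ((a i - B) \<union> (B - a i)) < ?d"
    using Union.IH[OF d] by blast
  from choice[OF this] obtain B where B: "\<And>i. B i \<in> \<A>" "\<And>i. measure M1 ((a i - B i) \<union> (B i - a i)) < ?d"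
    "\<And>i. measure M2 ((a i - B i) \<union> (B i - a i)) < ?d" by blast
  let ?B = "\<Union>i<n. B i"
  let ?D = "\<lambda>i. (a i - B i) \<union> (B i - a i)"
  have BA: "?B \<in> \<A>" using B by (intro finite_UN) auto
  have bound: "measure N ((?U - ?B) \<union> (?B - ?U)) < e"
    if N: "finite_measure N" "sets N = sigma_sets \<Omega> \<A>" and nn: "measure N ?U - e / 2 < measure N (?V n)"
      and BN: "\<And>i. measure N (?D i) < ?d" for N
  proof -
    interpret N: finite_measure N by fact
    have aN: "a i \<in> sets N" and BN': "B i \<in> sets N" for i
      unfolding N(2) by (rule as, rule sigma_sets.Basic[OF B(1)])
    have Ds: "?D i \<in> sets N" for i
      by (intro sets.Un sets.Diff aN BN')
    have UV: "?U - ?V n \<in> sets N" by (intro sets.Diff) (simp_all only: N(2) U V)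
    have Dn: "(\<Union>i<n. ?D i) \<in> sets N" using Ds by (intro sets.finite_UN) auto
    have "measure N ((?U - ?B) \<union> (?B - ?U)) \<le> measure N ((?U - ?V n) \<union> (\<Union>i<n. ?D i))"
      by (rule N.finite_measure_mono) (use UV Dn in \<open>auto intro!: sets.Un\<close>)
    also have "\<dots> \<le> measure N (?U - ?V n) + measure N (\<Union>i<n. ?D i)"
      by (rule measure_Un_le[OF UV Dn])
    also have "measure N (?U - ?V n) = measure N ?U - measure N (?V n)"
      by (rule N.finite_measure_Diff) (use U V N(2) in auto)
    also have "measure N (\<Union>i<n. ?D i) \<le> (\<Sum>i<n. measure N (?D i))"
      by (rule N.finite_measure_subadditive_finite) (use Ds in auto)
    also have "(\<Sum>i<n. measure N (?D i)) \<le> (\<Sum>i<n. ?d)"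
      by (intro sum_mono less_imp_le BN)
    also have "(\<Sum>i<n. ?d) \<le> e / 2" using Union.prems by (simp add: field_simps)
    finally show ?thesis using nn by linarith
  qed
  show ?case
    by (intro bexI[OF _ BA] conjI bound fm s1 s2 n B)
qed

lemma measure_diff_bound_on_generating_algebra:
  assumes alg: "algebra \<Omega> \<A>" and fm: "finite_measure M1" "finite_measure M2"
    and s1: "sets M1 = sigma_sets \<Omega> \<A>" and s2: "sets M2 = sigma_sets \<Omega> \<A>"
    and bound: "\<And>B. B \<in> \<A> \<Longrightarrow> \<bar>measure M1 B - measure M2 B\<bar> \<le> c"
    and A: "A \<in> sigma_sets \<Omega> \<A>"
  shows "\<bar>measure M1 A - measure M2 A\<bar> \<le> c"
proof (rule field_le_epsilon)
  fix e :: real assume "0 < e"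
  then have e: "0 < e / 2" by simp
  obtain B where B: "B \<in> \<A>" "measure M1 ((A - B) \<union> (B - A)) < e / 2" "measure M2 ((A - B) \<union> (B - A)) < e / 2"
    using generating_algebra_approx[OF alg fm s1 s2 A e] by blast
  have diff: "\<bar>measure N A - measure N B\<bar> \<le> measure N ((A - B) \<union> (B - A))"
    if N: "finite_measure N" "sets N = sigma_sets \<Omega> \<A>" for N
  proof -
    interpret N: finite_measure N by fact
    have s: "A \<in> sets N" "B \<in> sets N" using A B N by auto
    then have D: "(A - B) \<union> (B - A) \<in> sets N" by blast
    have "measure N A \<le> measure N (B \<union> ((A - B) \<union> (B - A)))"
      by (rule N.finite_measure_mono) (use s D in \<open>auto intro!: sets.Un\<close>)
    moreover have "measure N (B \<union> ((A - B) \<union> (B - A))) \<le> measure N B + measure N ((A - B) \<union> (B - A))"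
      by (rule measure_Un_le[OF s(2) D])
    moreover have "measure N B \<le> measure N (A \<union> ((A - B) \<union> (B - A)))"
      by (rule N.finite_measure_mono) (use s D in \<open>auto intro!: sets.Un\<close>)
    moreover have "measure N (A \<union> ((A - B) \<union> (B - A))) \<le> measure N A + measure N ((A - B) \<union> (B - A))"
      by (rule measure_Un_le[OF s(1) D])
    ultimately show ?thesis by linarith
  qed
  from diff[OF fm(1) s1] diff[OF fm(2) s2] bound[OF B(1)] B(2,3)
  show "\<bar>measure M1 A - measure M2 A\<bar> \<le> c + e" by linarith
qed

section \<open>The vague sigma-algebra\<close>

lemma openin_vague_subset: "openin vague_topology U \<Longrightarrow> U \<subseteq> lf_point_measures"
proof -
  assume "openin vague_topology U"
  then have "U \<subseteq> topspace vague_topology" by (rule openin_subset)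
  also have "\<dots> \<subseteq> lf_point_measures"
    unfolding vague_topology_def topology_generated_by_topspace by auto
  finally show ?thesis .
qed

lemma sets_vague_borel: "sets vague_borel = sigma_sets lf_point_measures {U. openin vague_topology U}"
  unfolding vague_borel_def by (rule sets_measure_of) (use openin_vague_subset in auto)

lemma space_vague_borel: "space vague_borel = lf_point_measures"
  unfolding vague_borel_def by (rule space_measure_of) (use openin_vague_subset in auto)

text \<open>Events that depend on the counts in the cells of one dyadic grid.\<close>

definition grid_algebra :: "real \<Rightarrow> real measure set set" where
  "grid_algebra \<tau> = {{\<eta> \<in> lf_upto \<tau>. grid_counts \<tau> m \<eta> \<in> E} | m E. True}"

text \<open>A count on a grid is the sum of two counts on the next finer one.\<close>

lemma grid_algebra_refine:
  assumes t: "0 < \<tau>" and "m \<le> m'"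
  shows "\<exists>E'. {\<eta> \<in> lf_upto \<tau>. grid_counts \<tau> m \<eta> \<in> E} = {\<eta> \<in> lf_upto \<tau>. grid_counts \<tau> m' \<eta> \<in> E'}"
  using assms(2)
proof (induction rule: dec_induct)
  case base
  then show ?case by blast
next
  case (step n)
  then obtain E' where E': "{\<eta> \<in> lf_upto \<tau>. grid_counts \<tau> m \<eta> \<in> E} = {\<eta> \<in> lf_upto \<tau>. grid_counts \<tau> n \<eta> \<in> E'}"
    by blast
  let ?c = "\<lambda>v k. if k \<in> dyadic_index n then v (2 * k) + v (Suc (2 * k)) else (0::nat)"
  have "grid_counts \<tau> n \<eta> = ?c (grid_counts \<tau> (Suc n) \<eta>)" if "\<eta> \<in> lf_upto \<tau>" for \<eta>
    using grid_counts_coarsen[OF t, of \<eta> n] that by (simp add: lf_upto_def)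
  then have "{\<eta> \<in> lf_upto \<tau>. grid_counts \<tau> n \<eta> \<in> E'} = {\<eta> \<in> lf_upto \<tau>. grid_counts \<tau> (Suc n) \<eta> \<in> ?c -` E'}"
    by auto
  then show ?case using E' by blast
qed

lemma algebra_grid:
  assumes t: "0 < \<tau>"
  shows "algebra (lf_upto \<tau>) (grid_algebra \<tau>)"
  unfolding algebra_iff_Un
proof (intro conjI ballI)
  show "grid_algebra \<tau> \<subseteq> Pow (lf_upto \<tau>)" by (auto simp: grid_algebra_def)
  have "{} = {\<eta> \<in> lf_upto \<tau>. grid_counts \<tau> 0 \<eta> \<in> {}}" by simp
  then show "{} \<in> grid_algebra \<tau>" unfolding grid_algebra_def by blast
next
  fix A assume "A \<in> grid_algebra \<tau>"
  then obtain m E where A: "A = {\<eta> \<in> lf_upto \<tau>. grid_counts \<tau> m \<eta> \<in> E}" by (auto simp: grid_algebra_def)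
  have "lf_upto \<tau> - A = {\<eta> \<in> lf_upto \<tau>. grid_counts \<tau> m \<eta> \<in> - E}" unfolding A by auto
  then show "lf_upto \<tau> - A \<in> grid_algebra \<tau>" unfolding grid_algebra_def by blast
next
  fix A B assume "A \<in> grid_algebra \<tau>" "B \<in> grid_algebra \<tau>"
  then obtain m E n F where A: "A = {\<eta> \<in> lf_upto \<tau>. grid_counts \<tau> m \<eta> \<in> E}"
    and B: "B = {\<eta> \<in> lf_upto \<tau>. grid_counts \<tau> n \<eta> \<in> F}" by (auto simp: grid_algebra_def)
  obtain E' where "A = {\<eta> \<in> lf_upto \<tau>. grid_counts \<tau> (max m n) \<eta> \<in> E'}"
    using grid_algebra_refine[OF t, of m "max m n" E] A by auto
  moreover obtain F' where "B = {\<eta> \<in> lf_upto \<tau>. grid_counts \<tau> (max m n) \<eta> \<in> F'}"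
    using grid_algebra_refine[OF t, of n "max m n" F] B by auto
  ultimately have "A \<union> B = {\<eta> \<in> lf_upto \<tau>. grid_counts \<tau> (max m n) \<eta> \<in> E' \<union> F'}" by auto
  then show "A \<union> B \<in> grid_algebra \<tau>" unfolding grid_algebra_def by blast
qed

lemma sets_grid_sigma: "0 < \<tau> \<Longrightarrow> sets (sigma (lf_upto \<tau>) (grid_algebra \<tau>)) = sigma_sets (lf_upto \<tau>) (grid_algebra \<tau>)"
  by (rule sets_measure_of) (auto simp: grid_algebra_def)

lemma space_grid_sigma: "0 < \<tau> \<Longrightarrow> space (sigma (lf_upto \<tau>) (grid_algebra \<tau>)) = lf_upto \<tau>"
  by (rule space_measure_of) (auto simp: grid_algebra_def)

text \<open>An open set is the union over \<open>m\<close> of all level-\<open>m\<close> count events that it contains. The union over \<open>m\<close> is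
countable, and at each level arbitrary sets of count vectors are allowed.\<close>

lemma grid_sigma_finer_than_vague:
  assumes t: "0 < \<tau>"
  shows "(\<lambda>\<eta>. \<eta>) \<in> sigma (lf_upto \<tau>) (grid_algebra \<tau>) \<rightarrow>\<^sub>M vague_borel"
  unfolding vague_borel_def
proof (rule measurable_measure_of)
  show "{U. openin vague_topology U} \<subseteq> Pow lf_point_measures" using openin_vague_subset by auto
  show "(\<lambda>\<eta>. \<eta>) \<in> space (sigma (lf_upto \<tau>) (grid_algebra \<tau>)) \<rightarrow> lf_point_measures"
    unfolding space_grid_sigma[OF t] by (auto simp: lf_upto_def)
  fix U assume "U \<in> {U. openin vague_topology U}"
  then have U: "openin vague_topology U" by simp
  let ?E = "\<lambda>m. {v. \<forall>\<eta>\<in>lf_upto \<tau>. grid_counts \<tau> m \<eta> = v \<longrightarrow> \<eta> \<in> U}"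
  have "(\<lambda>\<eta>. \<eta>) -` U \<inter> lf_upto \<tau> = (\<Union>m. {\<eta> \<in> lf_upto \<tau>. grid_counts \<tau> m \<eta> \<in> ?E m})"
  proof (intro equalityI subsetI)
    fix \<eta> assume \<eta>: "\<eta> \<in> (\<lambda>\<eta>. \<eta>) -` U \<inter> lf_upto \<tau>"
    then obtain m0 where "\<forall>m\<ge>m0. \<forall>\<eta>'\<in>lf_upto \<tau>. grid_counts \<tau> m \<eta>' = grid_counts \<tau> m \<eta> \<longrightarrow> \<eta>' \<in> U"
      using open_determined_by_grid[OF t U, of \<eta>] by auto
    then have "grid_counts \<tau> m0 \<eta> \<in> ?E m0" by (auto dest: spec[of _ m0])
    then show "\<eta> \<in> (\<Union>m. {\<eta> \<in> lf_upto \<tau>. grid_counts \<tau> m \<eta> \<in> ?E m})" using \<eta> by blast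
  qed auto
  also have "\<dots> \<in> sets (sigma (lf_upto \<tau>) (grid_algebra \<tau>))"
  proof (rule sets.countable_UN, safe)
    fix m :: nat
    have "{\<eta> \<in> lf_upto \<tau>. grid_counts \<tau> m \<eta> \<in> ?E m} \<in> grid_algebra \<tau>" unfolding grid_algebra_def by blast
    then show "{\<eta> \<in> lf_upto \<tau>. grid_counts \<tau> m \<eta> \<in> ?E m} \<in> sets (sigma (lf_upto \<tau>) (grid_algebra \<tau>))"
      unfolding sets_grid_sigma[OF t] by (rule sigma_sets.Basic)
  qed
  finally show "(\<lambda>\<eta>. \<eta>) -` U \<inter> space (sigma (lf_upto \<tau>) (grid_algebra \<tau>)) \<in> sets (sigma (lf_upto \<tau>) (grid_algebra \<tau>))"
    by (simp only: space_grid_sigma[OF t])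
qed

lemma measurable_grid_sigma:
  assumes t: "0 < \<tau>" and r: "\<And>w. w \<in> space M \<Longrightarrow> \<Phi> w \<in> lf_upto \<tau>"
    and ev: "\<And>m E. {w \<in> space M. grid_counts \<tau> m (\<Phi> w) \<in> E} \<in> sets M"
  shows "\<Phi> \<in> M \<rightarrow>\<^sub>M sigma (lf_upto \<tau>) (grid_algebra \<tau>)"
proof (rule measurable_measure_of)
  show "grid_algebra \<tau> \<subseteq> Pow (lf_upto \<tau>)" by (auto simp: grid_algebra_def)
  show "\<Phi> \<in> space M \<rightarrow> lf_upto \<tau>" using r by auto
  fix A assume "A \<in> grid_algebra \<tau>"
  then obtain m E where A: "A = {\<eta> \<in> lf_upto \<tau>. grid_counts \<tau> m \<eta> \<in> E}" by (auto simp: grid_algebra_def)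
  have "\<Phi> -` A \<inter> space M = {w \<in> space M. grid_counts \<tau> m (\<Phi> w) \<in> E}" unfolding A using r by auto
  then show "\<Phi> -` A \<inter> space M \<in> sets M" using ev by simp
qed

lemma measurable_vague:
  assumes t: "0 < \<tau>" and r: "\<And>w. w \<in> space M \<Longrightarrow> \<Phi> w \<in> lf_upto \<tau>"
    and ev: "\<And>m E. {w \<in> space M. grid_counts \<tau> m (\<Phi> w) \<in> E} \<in> sets M"
  shows "\<Phi> \<in> M \<rightarrow>\<^sub>M vague_borel"
  by (rule measurable_compose[OF measurable_grid_sigma[OF assms] grid_sigma_finer_than_vague[OF t]])

text \<open>Both laws live on \<open>lf_upto \<tau>\<close>, where the count events generate a sigma-algebra that contains the traces of all
vague Borel sets.\<close>

lemma law_bound_from_grid: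
  assumes t: "0 < \<tau>" and P: "prob_space P" and Q: "prob_space Q"
    and r: "\<And>w. w \<in> space P \<Longrightarrow> \<Phi> w \<in> lf_upto \<tau>" "\<And>w. w \<in> space Q \<Longrightarrow> \<Psi> w \<in> lf_upto \<tau>"
    and ev: "\<And>m E. {w \<in> space P. grid_counts \<tau> m (\<Phi> w) \<in> E} \<in> sets P"
      "\<And>m E. {w \<in> space Q. grid_counts \<tau> m (\<Psi> w) \<in> E} \<in> sets Q"
    and bound: "\<And>m E. \<bar>measure P {w \<in> space P. grid_counts \<tau> m (\<Phi> w) \<in> E}
        - measure Q {w \<in> space Q. grid_counts \<tau> m (\<Psi> w) \<in> E}\<bar> \<le> c"
    and A: "A \<in> sets vague_borel"
  shows "\<bar>measure (distr P vague_borel \<Phi>) A - measure (distr Q vague_borel \<Psi>) A\<bar> \<le> c"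
proof -
  let ?G = "sigma (lf_upto \<tau>) (grid_algebra \<tau>)"
  have m1: "\<Phi> \<in> P \<rightarrow>\<^sub>M ?G" and m2: "\<Psi> \<in> Q \<rightarrow>\<^sub>M ?G"
    by (rule measurable_grid_sigma[OF t]; use r ev in simp)+
  have v1: "\<Phi> \<in> P \<rightarrow>\<^sub>M vague_borel" and v2: "\<Psi> \<in> Q \<rightarrow>\<^sub>M vague_borel"
    by (rule measurable_vague[OF t]; use r ev in simp)+
  interpret P: prob_space P by fact
  interpret Q: prob_space Q by fact
  let ?A = "A \<inter> lf_upto \<tau>"
  have A': "?A \<in> sets ?G"
    using measurable_sets[OF grid_sigma_finer_than_vague[OF t] A] by (simp add: space_grid_sigma[OF t])
  have "\<bar>measure (distr P ?G \<Phi>) ?A - measure (distr Q ?G \<Psi>) ?A\<bar> \<le> c"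
  proof (rule measure_diff_bound_on_generating_algebra[OF algebra_grid[OF t]])
    show "finite_measure (distr P ?G \<Phi>)" "finite_measure (distr Q ?G \<Psi>)"
      using P.prob_space_distr[OF m1] Q.prob_space_distr[OF m2] by (auto simp: prob_space_def)
    show "sets (distr P ?G \<Phi>) = sigma_sets (lf_upto \<tau>) (grid_algebra \<tau>)"
      "sets (distr Q ?G \<Psi>) = sigma_sets (lf_upto \<tau>) (grid_algebra \<tau>)"
      using sets_grid_sigma[OF t] by auto
    show "?A \<in> sigma_sets (lf_upto \<tau>) (grid_algebra \<tau>)" using A' sets_grid_sigma[OF t] by simp
    fix B assume B: "B \<in> grid_algebra \<tau>"
    then obtain m E where BE: "B = {\<eta> \<in> lf_upto \<tau>. grid_counts \<tau> m \<eta> \<in> E}" by (auto simp: grid_algebra_def)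
    have Bs: "B \<in> sets ?G" using B sets_grid_sigma[OF t] by auto
    have "\<Phi> -` B \<inter> space P = {w \<in> space P. grid_counts \<tau> m (\<Phi> w) \<in> E}"
      "\<Psi> -` B \<inter> space Q = {w \<in> space Q. grid_counts \<tau> m (\<Psi> w) \<in> E}"
      unfolding BE using r by auto
    then show "\<bar>measure (distr P ?G \<Phi>) B - measure (distr Q ?G \<Psi>) B\<bar> \<le> c"
      using bound[of m E] by (simp add: measure_distr[OF m1 Bs] measure_distr[OF m2 Bs])
  qed
  moreover have "\<Phi> -` ?A \<inter> space P = \<Phi> -` A \<inter> space P" "\<Psi> -` ?A \<inter> space Q = \<Psi> -` A \<inter> space Q"
    using r by auto
  ultimately show ?thesis
    by (simp only: measure_distr[OF m1 A'] measure_distr[OF m2 A'] measure_distr[OF v1 A] measure_distr[OF v2 A])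
qed

section \<open>The total mass is a vague Borel function\<close>

text \<open>Continuous cutoff functions with compact support that increase to \<open>1\<close>, so that their integrals recover
the total mass.\<close>

definition plateau :: "nat \<Rightarrow> real \<Rightarrow> real" where
  "plateau j x = max 0 (min 1 (min (real j * x - 1) (real j + 1 - x)))"

lemma plateau_bounds: "0 \<le> plateau j x \<and> plateau j x \<le> 1"
  by (auto simp: plateau_def)

lemma plateau_test_function:
  assumes "1 \<le> j"
  shows "plateau j \<in> vague_test_functions"
proof -
  have "continuous_on {0<..} (plateau j)"
    unfolding plateau_def[abs_def] by (intro continuous_intros)
  moreover have "compact {1 / real j..real j + 1}" "{1 / real j..real j + 1} \<subseteq> {0<..}"
    using assms less_le_trans[of 0 "1 / real j"] by auto
  moreover have "plateau j x = 0" if "x \<notin> {1 / real j..real j + 1}" for x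
  proof -
    have "real j * x - 1 \<le> 0 \<or> real j + 1 - x \<le> 0"
      using that assms by (auto simp: field_simps)
    then show ?thesis by (auto simp: plateau_def)
  qed
  ultimately show ?thesis unfolding vague_test_functions_def by blast
qed

lemma plateau_eventually_1:
  assumes "0 < x"
  shows "\<exists>j0. \<forall>j\<ge>j0. plateau j x = 1"
proof -
  obtain n1 where n1: "2 / x < real n1" using reals_Archimedean2 by blast
  obtain n2 where n2: "x < real n2" using reals_Archimedean2 by blast
  have "plateau j x = 1" if "n1 + n2 \<le> j" for j
  proof -
    have "2 / x < real j" "x < real j" using n1 n2 that by linarith+
    then have "2 < real j * x" "x < real j" using assms by (auto simp: pos_divide_less_eq)
    then show ?thesis by (simp add: plateau_def)
  qed
  then show ?thesis by blast
qed

lemma sum_over_finite_support: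
  fixes f :: "real \<Rightarrow> real"
  assumes lf: "dirac_sum J y \<in> lf_point_measures" and f: "f \<in> vague_test_functions"
  obtains T where "finite T" "T \<subseteq> {i \<in> J. 0 < y i}" "\<And>i. i \<in> J \<Longrightarrow> 0 < y i \<Longrightarrow> i \<notin> T \<Longrightarrow> f (y i) = 0"
proof -
  obtain K where K: "compact K" "K \<subseteq> {0<..}" "\<And>x. x \<in> {0<..} - K \<Longrightarrow> f x = 0"
    using f by (auto simp: vague_test_functions_def)
  have Ks: "K \<in> sets pos_borel" using K by (simp add: sets_pos_borel borel_compact)
  have "emeasure (dirac_sum J y) K < \<infinity>" using lf K by (auto simp: lf_point_measures_def)
  then have "finite {i \<in> J. y i \<in> K}" using emeasure_dirac_sum[OF Ks, of J y] by (auto split: if_splits)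
  moreover have "{i \<in> J. y i \<in> K} \<subseteq> {i \<in> J. 0 < y i}" using K by auto
  ultimately show thesis using that[of "{i \<in> J. y i \<in> K}"] K(3) by auto
qed

text \<open>If there were more than \<open>n\<close> points, some plateau function would be \<open>1\<close> at \<open>n + 1\<close> of them.\<close>

lemma total_mass_le_iff:
  assumes lf: "\<eta> \<in> lf_point_measures"
  shows "emeasure \<eta> {0<..} \<le> of_nat n \<longleftrightarrow> (\<forall>j\<ge>1. (LINT x|\<eta>. plateau j x) \<le> real n)"
proof -
  obtain J :: "nat set" and y where e: "\<eta> = dirac_sum J y" using lf by (auto simp: lf_point_measures_def)
  have lf': "dirac_sum J y \<in> lf_point_measures" using lf e by simp
  let ?J = "{i \<in> J. 0 < y i}"
  have pos: "{0<..} \<in> sets pos_borel" by (simp add: sets_pos_borel)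
  have em: "emeasure \<eta> {0<..} = (if finite ?J then of_nat (card ?J) else \<infinity>)"
    unfolding e using emeasure_dirac_sum[OF pos, of J y] by simp
  have int: "\<exists>T. finite T \<and> T \<subseteq> ?J \<and> (LINT x|\<eta>. plateau j x) = (\<Sum>i\<in>T. plateau j (y i)) \<and>
      (\<forall>i\<in>?J - T. plateau j (y i) = 0)" if j: "1 \<le> j" for j
  proof -
    obtain T where T: "finite T" "T \<subseteq> ?J" "\<And>i. i \<in> J \<Longrightarrow> 0 < y i \<Longrightarrow> i \<notin> T \<Longrightarrow> plateau j (y i) = 0"
      by (rule sum_over_finite_support[OF lf' plateau_test_function[OF j]]) blast
    then have "(LINT x|\<eta>. plateau j x) = (\<Sum>i\<in>T. plateau j (y i))"
      unfolding e by (intro integral_dirac_sum test_function_measurable plateau_test_function j) auto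
    then show ?thesis using T by blast
  qed
  show ?thesis
  proof
    assume L: "emeasure \<eta> {0<..} \<le> of_nat n"
    then have fin: "finite ?J" and c: "card ?J \<le> n"
      unfolding em by (auto split: if_splits simp: top_unique)
    show "\<forall>j\<ge>1. (LINT x|\<eta>. plateau j x) \<le> real n"
    proof (intro allI impI)
      fix j :: nat assume "1 \<le> j"
      from int[OF this] obtain T where T: "finite T" "T \<subseteq> ?J"
        "(LINT x|\<eta>. plateau j x) = (\<Sum>i\<in>T. plateau j (y i))" by blast
      have "(\<Sum>i\<in>T. plateau j (y i)) \<le> (\<Sum>i\<in>T. 1)" by (rule sum_mono) (use plateau_bounds in auto)
      also have "\<dots> = real (card T)" by simp
      also have "card T \<le> card ?J" by (rule card_mono[OF fin T(2)])
      finally show "(LINT x|\<eta>. plateau j x) \<le> real n" using T(3) c by simp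
    qed
  next
    assume R: "\<forall>j\<ge>1. (LINT x|\<eta>. plateau j x) \<le> real n"
    have small: "card G \<le> n" if G: "finite G" "G \<subseteq> ?J" for G
    proof -
      have "\<exists>j0. \<forall>j\<ge>j0. \<forall>i\<in>G. plateau j (y i) = 1" using G
      proof (induction G rule: finite_induct)
        case (insert i G)
        then obtain j0 j1 where "\<forall>j\<ge>j0. \<forall>i\<in>G. plateau j (y i) = 1" "\<forall>j\<ge>j1. plateau j (y i) = 1"
          using plateau_eventually_1[of "y i"] by auto
        then show ?case by (intro exI[of _ "max j0 j1"]) auto
      qed simp
      then obtain j0 where j0: "\<forall>j\<ge>j0. \<forall>i\<in>G. plateau j (y i) = 1" by blast
      let ?j = "max 1 j0"
      have j1: "1 \<le> ?j" by simp
      from int[OF j1] obtain T where T: "finite T" "T \<subseteq> ?J"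
        "(LINT x|\<eta>. plateau ?j x) = (\<Sum>i\<in>T. plateau ?j (y i))"
        "\<forall>i\<in>?J - T. plateau ?j (y i) = 0" by blast
      have one: "plateau ?j (y i) = 1" if "i \<in> G" for i using j0 that by simp
      have "G \<subseteq> T"
      proof
        fix i assume i: "i \<in> G"
        then show "i \<in> T" using one[OF i] T(4) G(2) by force
      qed
      have "real (card G) = (\<Sum>i\<in>G. plateau ?j (y i))" using one by simp
      also have "\<dots> \<le> (\<Sum>i\<in>T. plateau ?j (y i))"
        by (rule sum_mono2[OF T(1) \<open>G \<subseteq> T\<close>]) (use plateau_bounds in auto)
      also have "\<dots> \<le> real n" using R[rule_format, OF j1] T(3) by simp
      finally show ?thesis by simp
    qed
    have fin: "finite ?J"
    proof (rule ccontr)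
      assume "infinite ?J"
      then obtain G where "G \<subseteq> ?J" "finite G" "card G = Suc n" by (meson infinite_arbitrarily_large)
      then show False using small[of G] by simp
    qed
    then show "emeasure \<eta> {0<..} \<le> of_nat n" using small[OF fin] unfolding em by simp
  qed
qed

text \<open>By the preceding equivalence, the condition that the total mass be at most \<open>n\<close> is an intersection of countably
many vaguely closed conditions.\<close>

lemma total_mass_event:
  "{\<eta> \<in> lf_point_measures. \<exists>n\<in>E. emeasure \<eta> {0<..} = of_nat n} \<in> sets vague_borel"
proof -
  have le: "{\<eta> \<in> lf_point_measures. emeasure \<eta> {0<..} \<le> of_nat n} \<in> sets vague_borel" for n
  proof -
    have "{\<eta> \<in> lf_point_measures. (LINT x|\<eta>. plateau j x) \<in> {real n<..}} \<in> sets vague_borel" if "1 \<le> j" for j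
    proof -
      have "openin vague_topology {\<eta> \<in> lf_point_measures. (LINT x|\<eta>. plateau j x) \<in> {real n<..}}"
        unfolding vague_topology_def
        by (rule topology_generated_by_Basis, rule CollectI,
            intro exI[of _ "plateau j"] exI[of _ "{real n<..}"])
           (simp add: plateau_test_function[OF that])
      then show ?thesis unfolding sets_vague_borel by auto
    qed
    then have "space vague_borel - (\<Union>j\<in>{1..}. {\<eta> \<in> lf_point_measures. (LINT x|\<eta>. plateau j x) \<in> {real n<..}}) \<in> sets vague_borel"
      by (intro sets.Diff sets.top sets.countable_UN') auto
    also have "space vague_borel - (\<Union>j\<in>{1..}. {\<eta> \<in> lf_point_measures. (LINT x|\<eta>. plateau j x) \<in> {real n<..}})
       = {\<eta> \<in> lf_point_measures. \<forall>j\<ge>1. \<not> real n < (LINT x|\<eta>. plateau j x)}"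
      unfolding space_vague_borel by auto
    also have "\<dots> = {\<eta> \<in> lf_point_measures. emeasure \<eta> {0<..} \<le> of_nat n}"
      by (intro Collect_cong conj_cong refl) (simp only: total_mass_le_iff not_less)
    finally show ?thesis .
  qed
  have eq: "{\<eta> \<in> lf_point_measures. emeasure \<eta> {0<..} = of_nat n} \<in> sets vague_borel" for n
  proof (cases n)
    case 0
    then show ?thesis using le[of 0] by simp
  next
    case (Suc k)
    have "emeasure \<eta> {0<..} = of_nat n \<longleftrightarrow> emeasure \<eta> {0<..} \<le> of_nat n \<and> \<not> emeasure \<eta> {0<..} \<le> of_nat k"
      if lfe: "\<eta> \<in> lf_point_measures" for \<eta>
    proof -
      obtain J :: "nat set" and y where e: "\<eta> = dirac_sum J y" using lfe by (auto simp: lf_point_measures_def)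
      have pos: "{0<..} \<in> sets pos_borel" by (simp add: sets_pos_borel)
      show ?thesis unfolding e emeasure_dirac_sum[OF pos] Suc
        by (auto simp: top_unique simp del: of_nat_Suc)
    qed
    then have "{\<eta> \<in> lf_point_measures. emeasure \<eta> {0<..} = of_nat n} =
      {\<eta> \<in> lf_point_measures. emeasure \<eta> {0<..} \<le> of_nat n} - {\<eta> \<in> lf_point_measures. emeasure \<eta> {0<..} \<le> of_nat k}"
      by auto
    then show ?thesis using le by simp
  qed
  have "{\<eta> \<in> lf_point_measures. \<exists>n\<in>E. emeasure \<eta> {0<..} = of_nat n} =
     (\<Union>n\<in>E. {\<eta> \<in> lf_point_measures. emeasure \<eta> {0<..} = of_nat n})" by auto
  also have "\<dots> \<in> sets vague_borel" by (rule sets.countable_UN') (use eq in auto)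
  finally show ?thesis .
qed

section \<open>Total variation distance\<close>

lemma tv_dist_le:
  assumes "\<And>A. A \<in> sets \<nu>1 \<Longrightarrow> \<bar>measure \<nu>1 A - measure \<nu>2 A\<bar> \<le> c"
  shows "tv_dist \<nu>1 \<nu>2 \<le> c"
  unfolding tv_dist_def by (rule cSUP_least) (use assms sets.empty_sets in auto)

lemma tv_dist_ge:
  assumes "prob_space \<nu>1" "prob_space \<nu>2" "A \<in> sets \<nu>1"
  shows "\<bar>measure \<nu>1 A - measure \<nu>2 A\<bar> \<le> tv_dist \<nu>1 \<nu>2"
  unfolding tv_dist_def
proof (rule cSUP_upper[OF assms(3)])
  interpret a: prob_space \<nu>1 by fact
  interpret b: prob_space \<nu>2 by fact
  show "bdd_above ((\<lambda>A. \<bar>measure \<nu>1 A - measure \<nu>2 A\<bar>) ` sets \<nu>1)"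
  proof (rule bdd_aboveI2)
    fix A
    show "\<bar>measure \<nu>1 A - measure \<nu>2 A\<bar> \<le> 1"
      using a.prob_le_1[of A] b.prob_le_1[of A] measure_nonneg[of \<nu>1 A] measure_nonneg[of \<nu>2 A] by linarith
  qed
qed

section \<open>Sums over countable index sets\<close>

text \<open>Turns sums over \<open>I\<close> into integrals, for which interchange with a series is monotone convergence.\<close>

lemma infsum_eq_nn_integral:
  fixes f :: "'i \<Rightarrow> ennreal"
  assumes I: "countable I"
  shows "infsum f I = (\<integral>\<^sup>+i. f i \<partial>count_space I)"
proof (rule antisym)
  have fin: "sum f F \<le> (\<integral>\<^sup>+i. f i \<partial>count_space I)" if F: "finite F" "F \<subseteq> I" for F
  proof -
    have "sum f F = (\<integral>\<^sup>+i. f i \<partial>count_space F)" using F by (simp add: nn_integral_count_space_finite)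
    also have "\<dots> = (\<integral>\<^sup>+i. f i * indicator F i \<partial>count_space UNIV)"
      by (simp add: nn_integral_count_space_indicator)
    also have "\<dots> \<le> (\<integral>\<^sup>+i. f i * indicator I i \<partial>count_space UNIV)"
      by (rule nn_integral_mono) (use F in \<open>auto split: split_indicator\<close>)
    also have "\<dots> = (\<integral>\<^sup>+i. f i \<partial>count_space I)"
      by (simp add: nn_integral_count_space_indicator)
    finally show ?thesis .
  qed
  show "infsum f I \<le> (\<integral>\<^sup>+i. f i \<partial>count_space I)"
    by (subst nonneg_infsum_complete) (auto intro!: SUP_least fin)
  show "(\<integral>\<^sup>+i. f i \<partial>count_space I) \<le> infsum f I"
  proof -
    let ?e = "to_nat_on I"
    let ?h = "\<lambda>n. if n \<in> ?e ` I then f (from_nat_into I n) else 0"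
    have bij: "bij_betw ?e I (?e ` I)" using I by (simp add: inj_on_imp_bij_betw inj_on_to_nat_on)
    have "(\<integral>\<^sup>+i. f i \<partial>count_space I) = (\<integral>\<^sup>+i. f (from_nat_into I (?e i)) \<partial>count_space I)"
      by (rule nn_integral_cong) (use I in auto)
    also have "\<dots> = (\<integral>\<^sup>+n. f (from_nat_into I n) \<partial>count_space (?e ` I))"
      by (rule nn_integral_bij_count_space[OF bij])
    also have "\<dots> = (\<integral>\<^sup>+n. ?h n \<partial>count_space UNIV)"
      by (subst nn_integral_count_space_indicator, simp) (rule nn_integral_cong, auto)
    also have "\<dots> = (\<Sum>n. ?h n)" by (rule nn_integral_count_space_nat)
    also have "\<dots> \<le> infsum f I"
    proof (rule suminf_le_const)
      fix n
      let ?F = "from_nat_into I ` ({..<n} \<inter> ?e ` I)"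
      have F: "finite ?F" "?F \<subseteq> I" using I by auto
      have "(\<Sum>k<n. ?h k) = (\<Sum>k\<in>{..<n} \<inter> ?e ` I. f (from_nat_into I k))"
        by (simp add: sum.inter_restrict)
      also have "\<dots> = sum f ?F"
        by (rule sum.reindex[symmetric, unfolded o_def]) (use I in \<open>auto simp: inj_on_def\<close>)
      also have "\<dots> \<le> infsum f I"
        by (subst nonneg_infsum_complete) (use F in \<open>auto intro!: SUP_upper\<close>)
      finally show "(\<Sum>k<n. ?h k) \<le> infsum f I" .
    qed simp
    finally show ?thesis .
  qed
qed

lemma finite_infsum_ennreal:
  fixes f :: "'i \<Rightarrow> real"
  assumes nn: "\<And>i. i \<in> I \<Longrightarrow> 0 \<le> f i" and fin: "(\<Sum>\<^sub>\<infinity>i\<in>I. ennreal (f i)) \<noteq> \<infinity>"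
  shows "f summable_on I" "(\<Sum>\<^sub>\<infinity>i\<in>I. ennreal (f i)) = ennreal (\<Sum>\<^sub>\<infinity>i\<in>I. f i)"
proof -
  let ?s = "\<Sum>\<^sub>\<infinity>i\<in>I. ennreal (f i)"
  have sup: "?s = (SUP F\<in>{F. finite F \<and> F \<subseteq> I}. \<Sum>i\<in>F. ennreal (f i))"
    by (rule nonneg_infsum_complete) simp
  have sum_eq: "(\<Sum>i\<in>F. ennreal (f i)) = ennreal (sum f F)" if "F \<subseteq> I" for F
    by (rule sum_ennreal) (use that nn in auto)
  show s: "f summable_on I"
  proof (rule nonneg_bdd_above_summable_on[OF nn])
    have "sum f F \<le> enn2real ?s" if F: "F \<subseteq> I" "finite F" for F
    proof -
      have "ennreal (sum f F) \<le> ?s"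
        unfolding sup sum_eq[OF F(1), symmetric] by (rule SUP_upper) (use F in simp)
      also have "\<dots> = ennreal (enn2real ?s)" using fin by (simp add: less_top)
      finally show ?thesis by (simp add: ennreal_le_iff)
    qed
    then show "bdd_above (sum f ` {F. F \<subseteq> I \<and> finite F})" by (intro bdd_aboveI2) auto
  qed
  have "ennreal (infsum f I) = (SUP F\<in>{F. finite F \<and> F \<subseteq> I}. ennreal (sum f F))"
    by (rule infsum_nonneg_is_SUPREMUM_ennreal[OF s nn])
  also have "\<dots> = (SUP F\<in>{F. finite F \<and> F \<subseteq> I}. \<Sum>i\<in>F. ennreal (f i))"
    by (rule SUP_cong) (use sum_eq in auto)
  finally show "?s = ennreal (\<Sum>\<^sub>\<infinity>i\<in>I. f i)" using sup by simp
qed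

lemma infsum_ennreal_le_mult_SUP:
  fixes f :: "'i \<Rightarrow> real"
  assumes "\<And>i. i \<in> I \<Longrightarrow> 0 \<le> f i"
  shows "(\<Sum>\<^sub>\<infinity>i\<in>I. ennreal ((f i)\<^sup>2)) \<le> (\<Sum>\<^sub>\<infinity>i\<in>I. ennreal (f i)) * (SUP i\<in>I. ennreal (f i))"
proof -
  let ?c = "SUP i\<in>I. ennreal (f i)"
  have "(\<Sum>i\<in>F. ennreal ((f i)\<^sup>2)) \<le> (\<Sum>\<^sub>\<infinity>i\<in>I. ennreal (f i)) * ?c" if F: "finite F" "F \<subseteq> I" for F
  proof -
    have "(\<Sum>i\<in>F. ennreal ((f i)\<^sup>2)) \<le> (\<Sum>i\<in>F. ennreal (f i) * ?c)"
    proof (rule sum_mono)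
      fix i assume "i \<in> F"
      then have i: "i \<in> I" using F by auto
      have "ennreal ((f i)\<^sup>2) = ennreal (f i) * ennreal (f i)"
        using assms[OF i] by (simp add: power2_eq_square ennreal_mult)
      also have "\<dots> \<le> ennreal (f i) * ?c" by (intro mult_left_mono SUP_upper i) simp
      finally show "ennreal ((f i)\<^sup>2) \<le> ennreal (f i) * ?c" .
    qed
    also have "\<dots> = (\<Sum>i\<in>F. ennreal (f i)) * ?c" by (simp add: sum_distrib_right)
    also have "\<dots> \<le> (\<Sum>\<^sub>\<infinity>i\<in>I. ennreal (f i)) * ?c"
      by (rule mult_right_mono, subst nonneg_infsum_complete) (use F in \<open>auto intro!: SUP_upper\<close>)
    finally show ?thesis .
  qed
  then show ?thesis by (subst nonneg_infsum_complete) (auto intro!: SUP_least)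
qed

section \<open>Borel--Cantelli and the mean measure\<close>

lemma (in prob_space) indep_vars_reindex_inj:
  assumes ind: "indep_vars (\<lambda>_. N) X (f ` I)" and inj: "inj_on f I"
  shows "indep_vars (\<lambda>_. N) (\<lambda>i. X (f i)) I"
  unfolding indep_vars_def2
proof
  show "\<forall>i\<in>I. random_variable N (X (f i))" using ind by (auto simp: indep_vars_def2)
  let ?F = "\<lambda>j. {X j -` A \<inter> space M | A. A \<in> sets N}"
  have ind': "indep_sets ?F (f ` I)" using ind by (simp add: indep_vars_def2)
  show "indep_sets (\<lambda>i. ?F (f i)) I"
  proof (rule indep_setsI)
    fix i assume "i \<in> I"
    then show "?F (f i) \<subseteq> events" using ind' by (auto simp: indep_sets_def)
  next
    fix A J assume J: "J \<noteq> {}" "J \<subseteq> I" "finite J" "\<forall>j\<in>J. A j \<in> ?F (f j)"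
    have injJ: "inj_on f J" using inj J(2) by (rule inj_on_subset)
    let ?B = "\<lambda>k. A (the_inv_into J f k)"
    have B: "?B (f j) = A j" if "j \<in> J" for j using the_inv_into_f_f[OF injJ that] by simp
    have "prob (\<Inter>k\<in>f ` J. ?B k) = (\<Prod>k\<in>f ` J. prob (?B k))"
      by (rule indep_setsD[OF ind']) (use J B in auto)
    then show "prob (\<Inter>j\<in>J. A j) = (\<Prod>j\<in>J. prob (A j))"
      using B by (simp add: prod.reindex[OF injJ] cong: INF_cong prod.cong)
  qed
qed

text \<open>If infinitely many of the events occur, then one outside any given finite set does, and this has small
probability.\<close>

lemma (in prob_space) borel_cantelli_countable:
  assumes I: "countable I" and A: "\<And>i. i \<in> I \<Longrightarrow> {w \<in> space M. R i w} \<in> events"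
    and s: "(\<lambda>i. prob {w \<in> space M. R i w}) summable_on I"
  shows "AE w in M. finite {i \<in> I. R i w}"
proof -
  let ?N = "{w \<in> space M. \<not> finite {i \<in> I. R i w}}"
  let ?p = "\<lambda>i. prob {w \<in> space M. R i w}"
  have fin: "{w \<in> space M. finite {i \<in> I. R i w}} \<in> events"
    by (rule measurable_card_indices(2)[OF I A])
  have N: "?N \<in> events" using sets.sets_Collect_neg[OF fin] by simp
  have le: "prob ?N \<le> e" if e: "0 < e" for e
  proof -
    obtain F where F: "finite F" "F \<subseteq> I" "dist (sum ?p F) (infsum ?p I) \<le> e"
      using infsum_finite_approximation[OF s e] by blast
    have "prob ?N \<le> prob (\<Union>i\<in>I - F. {w \<in> space M. R i w})"
    proof (rule finite_measure_mono)
      show "?N \<subseteq> (\<Union>i\<in>I - F. {w \<in> space M. R i w})"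
      proof
        fix w assume w: "w \<in> ?N"
        then have "\<not> {i \<in> I. R i w} \<subseteq> F" using F(1) finite_subset by auto
        then show "w \<in> (\<Union>i\<in>I - F. {w \<in> space M. R i w})" using w by auto
      qed
      show "(\<Union>i\<in>I - F. {w \<in> space M. R i w}) \<in> events"
        by (rule sets.countable_UN') (use I A in auto)
    qed
    also have "\<dots> \<le> e"
    proof (rule prob_countable_union_le)
      fix G assume G: "finite G" "G \<subseteq> I - F"
      have "sum ?p (F \<union> G) \<le> infsum ?p I" by (rule finite_sum_le_infsum[OF s]) (use F G in auto)
      moreover have "sum ?p (F \<union> G) = sum ?p F + sum ?p G"
        by (rule sum.union_disjoint) (use F G in auto)
      ultimately show "sum ?p G \<le> e" using F(3) by (simp add: dist_real_def)
    qed (use I A in auto)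
    finally show ?thesis .
  qed
  have "prob ?N \<le> 0"
  proof (rule field_le_epsilon)
    fix e :: real assume "0 < e"
    then show "prob ?N \<le> 0 + e" using le[of e] by simp
  qed
  then have "prob ?N = 0" using measure_nonneg[of M ?N] by linarith
  then have "emeasure M ?N = 0" by (simp add: emeasure_eq_measure)
  then show ?thesis by (intro AE_I[OF _ _ N]) auto
qed

text \<open>The set function that defines the mean measure is countably additive, so that the measure takes the values
prescribed.\<close>

lemma emeasure_mean_measure:
  assumes P: "prob_space P" and I: "countable I"
    and Y: "\<And>i. i \<in> I \<Longrightarrow> Y i \<in> borel_measurable P" and B: "B \<in> sets pos_borel"
  shows "emeasure (mean_measure P I Y) B = (\<Sum>\<^sub>\<infinity>i\<in>I. ennreal (measure P {w \<in> space P. Y i w \<in> B}))"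
proof -
  interpret P: prob_space P by fact
  let ?\<mu> = "\<lambda>B. \<Sum>\<^sub>\<infinity>i\<in>I. emeasure (distr P borel (Y i)) B"
  have sp: "sets pos_borel = sigma_sets {0<..} (sets pos_borel)"
    using sets.sigma_sets_eq[of pos_borel] by (simp add: space_restrict_space)
  have "emeasure (mean_measure P I Y) B = ?\<mu> B"
  proof (rule emeasure_measure_of[OF mean_measure_def])
    show "sets pos_borel \<subseteq> Pow {0<..}" by (auto simp: sets_pos_borel)
    show "B \<in> sets (mean_measure P I Y)"
      unfolding mean_measure_def using B by (subst sets_measure_of) (auto simp: sets_pos_borel)
    show "positive (sets (mean_measure P I Y)) ?\<mu>" by (simp add: positive_def)
    show "countably_additive (sets (mean_measure P I Y)) ?\<mu>"
    proof (rule countably_additiveI)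
      fix A :: "nat \<Rightarrow> real set"
      assume A: "range A \<subseteq> sets (mean_measure P I Y)" "disjoint_family A"
      have "sets (mean_measure P I Y) = sets pos_borel"
        unfolding mean_measure_def by (subst sets_measure_of) (auto simp: sets_pos_borel sp[symmetric])
      then have Ab: "range A \<subseteq> sets borel" using A(1) by (auto simp: sets_pos_borel)
      have "(\<Sum>n. ?\<mu> (A n)) = (\<Sum>n. \<integral>\<^sup>+i. emeasure (distr P borel (Y i)) (A n) \<partial>count_space I)"
        by (simp add: infsum_eq_nn_integral[OF I])
      also have "\<dots> = (\<integral>\<^sup>+i. (\<Sum>n. emeasure (distr P borel (Y i)) (A n)) \<partial>count_space I)"
        by (rule nn_integral_suminf[symmetric]) simp
      also have "\<dots> = (\<integral>\<^sup>+i. emeasure (distr P borel (Y i)) (\<Union>n. A n) \<partial>count_space I)"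
        by (intro nn_integral_cong suminf_emeasure) (use Ab A(2) in auto)
      also have "\<dots> = ?\<mu> (\<Union>n. A n)" by (simp add: infsum_eq_nn_integral[OF I])
      finally show "(\<Sum>n. ?\<mu> (A n)) = ?\<mu> (\<Union>n. A n)" .
    qed
  qed
  also have "\<dots> = (\<Sum>\<^sub>\<infinity>i\<in>I. ennreal (measure P {w \<in> space P. Y i w \<in> B}))"
  proof (rule infsum_cong)
    fix i assume i: "i \<in> I"
    have "B \<in> sets borel" using B by (simp add: sets_pos_borel)
    then have "emeasure (distr P borel (Y i)) B = emeasure P (Y i -` B \<inter> space P)"
      by (rule emeasure_distr[OF Y[OF i]])
    also have "Y i -` B \<inter> space P = {w \<in> space P. Y i w \<in> B}" by auto
    finally show "emeasure (distr P borel (Y i)) B = ennreal (measure P {w \<in> space P. Y i w \<in> B})"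
      by (simp add: P.emeasure_eq_measure)
  qed
  finally show ?thesis .
qed

section \<open>Poisson processes\<close>

lemma poisson_process_lf:
  "poisson_process Q \<mu> Z \<Longrightarrow> w \<in> space Q \<Longrightarrow> Z w \<in> lf_point_measures"
  unfolding poisson_process_def using measurable_space[of Z Q vague_borel w] by (simp add: space_vague_borel)

lemma poisson_process_count_law:
  assumes "poisson_process Q \<mu> Z" "B \<in> sets pos_borel" "emeasure \<mu> B \<noteq> \<infinity>"
  shows "measure Q {w \<in> space Q. emeasure (Z w) B = of_nat k} = exp (- measure \<mu> B) * measure \<mu> B ^ k / fact k"
proof -
  have "\<forall>B \<in> sets pos_borel.
        if emeasure \<mu> B = \<infinity> then (AE w in Q. emeasure (Z w) B = \<infinity>)
        else (\<forall>k::nat. measure Q {w \<in> space Q. emeasure (Z w) B = of_nat k} =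
                exp (- measure \<mu> B) * measure \<mu> B ^ k / fact k)"
    using assms(1) unfolding poisson_process_def by (elim conjE)
  from bspec[OF this assms(2)] assms(3) show ?thesis by (simp only: if_False)
qed

lemma poisson_process_indep:
  assumes "poisson_process Q \<mu> Z" "finite F" "F \<subseteq> sets pos_borel" "disjoint F"
  shows "prob_space.indep_vars Q (\<lambda>_. borel) (\<lambda>B w. emeasure (Z w) B) F"
  using assms unfolding poisson_process_def by (elim conjE) blast

text \<open>Otherwise the process would almost surely have infinite mass on \<open>K\<close>, which no element of \<open>\<H>\<close> has.\<close>

lemma poisson_process_mean_locally_finite:
  assumes Q: "prob_space Q" and Z: "poisson_process Q \<mu> Z" and K: "compact K" "K \<subseteq> {0<..}"
  shows "emeasure \<mu> K \<noteq> \<infinity>"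
proof
  assume inf: "emeasure \<mu> K = \<infinity>"
  interpret Q: prob_space Q by fact
  have "K \<in> sets pos_borel" using K by (simp add: sets_pos_borel borel_compact)
  then have "AE w in Q. emeasure (Z w) K = \<infinity>" using Z inf unfolding poisson_process_def by (auto split: if_splits)
  moreover have "AE w in Q. emeasure (Z w) K < \<infinity>"
    using poisson_process_lf[OF Z] K by (intro AE_I2) (auto simp: lf_point_measures_def)
  ultimately have "AE w in Q. False" by eventually_elim auto
  then show False by simp
qed

definition cell_masses :: "'k set \<Rightarrow> ('k \<Rightarrow> real set) \<Rightarrow> real measure \<Rightarrow> 'k \<Rightarrow> nat" where
  "cell_masses K C \<eta> = (\<lambda>k. if k \<in> K then nat_value (emeasure \<eta> (C k)) else 0)"

lemma poisson_process_cells: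
  assumes Q: "prob_space Q" and Z: "poisson_process Q \<mu> Z"
    and K: "finite K" and C: "\<And>k. k \<in> K \<Longrightarrow> C k \<in> sets pos_borel" "\<And>k. k \<in> K \<Longrightarrow> C k \<noteq> {}"
      "disjoint_family_on C K" "\<And>k. k \<in> K \<Longrightarrow> emeasure \<mu> (C k) \<noteq> \<infinity>"
  shows "{w \<in> space Q. cell_masses K C (Z w) \<in> E} \<in> sets Q"
    and "measure Q {w \<in> space Q. cell_masses K C (Z w) \<in> E} = measure (mpois K (\<lambda>k. measure \<mu> (C k))) E"
proof -
  interpret Q: prob_space Q by fact
  have inj: "inj_on C K"
  proof (rule inj_onI, rule ccontr)
    fix k l assume kl: "k \<in> K" "l \<in> K" "C k = C l" "k \<noteq> l"
    then have "C k \<inter> C l = {}" using C(3) unfolding disjoint_family_on_def by blast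
    then show False using kl C(2)[of k] by simp
  qed
  have disj: "disjoint (C ` K)" by (rule disjoint_family_on_disjoint_image[OF C(3)])
  have "Q.indep_vars (\<lambda>_. borel) (\<lambda>B w. emeasure (Z w) B) (C ` K)"
    by (rule poisson_process_indep[OF Z]) (use K C(1) disj in auto)
  then have ind: "Q.indep_vars (\<lambda>_. borel) (\<lambda>k w. emeasure (Z w) (C k)) K"
    by (rule Q.indep_vars_reindex_inj[OF _ inj])
  have law: "Q.prob {w \<in> space Q. emeasure (Z w) (C k) = of_nat n} = pmf (pois (measure \<mu> (C k))) n"
    if "k \<in> K" for k n
    using poisson_process_count_law[OF Z C(1)[OF that] C(4)[OF that]] by (simp add: pmf_pois)
  show "{w \<in> space Q. cell_masses K C (Z w) \<in> E} \<in> sets Q"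
    unfolding cell_masses_def by (rule Q.poisson_counts_law(1)[OF K ind law])
  show "measure Q {w \<in> space Q. cell_masses K C (Z w) \<in> E} = measure (mpois K (\<lambda>k. measure \<mu> (C k))) E"
    unfolding cell_masses_def by (rule Q.poisson_counts_law(2)[OF K ind law])
qed

text \<open>The event that the truncated count is \<open>0\<close> contains, besides the event of no point, the event of infinite mass.
It has probability \<open>exp (- \<mu> B)\<close>, which is already exhausted by the event of no point.\<close>

lemma poisson_process_mass_finite:
  assumes Q: "prob_space Q" and Z: "poisson_process Q \<mu> Z"
    and B: "B \<in> sets pos_borel" "B \<noteq> {}" "emeasure \<mu> B \<noteq> \<infinity>"
  shows "AE w in Q. emeasure (Z w) B \<noteq> \<infinity>"
proof -
  interpret Q: prob_space Q by fact
  have "Q.indep_vars (\<lambda>_. borel) (\<lambda>B w. emeasure (Z w) B) {B}"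
    by (rule poisson_process_indep[OF Z]) (use B(1) in \<open>auto simp: disjoint_def\<close>)
  then have meas [measurable]: "(\<lambda>w. emeasure (Z w) B) \<in> borel_measurable Q"
    by (auto simp: Q.indep_vars_def2)
  let ?V = "{w \<in> space Q. cell_masses {0::nat} (\<lambda>_. B) (Z w) \<in> {0}}"
  let ?O = "{w \<in> space Q. emeasure (Z w) B = of_nat 0}"
  let ?I = "{w \<in> space Q. emeasure (Z w) B = \<infinity>}"
  have disj: "disjoint_family_on (\<lambda>_. B) {0::nat}" by (simp add: disjoint_family_on_def)
  note cells = poisson_process_cells[OF Q Z _ _ _ disj, of "{0}"]
  have V: "?V \<in> sets Q" by (rule cells(1)) (use B in auto)
  have "Q.prob ?V = measure (mpois {0::nat} (\<lambda>k. measure \<mu> B)) {0}" by (rule cells(2)) (use B in auto)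
  also have "\<dots> = exp (- measure \<mu> B)" by (simp add: measure_pmf_single pmf_mpois_0)
  finally have pV: "Q.prob ?V = exp (- measure \<mu> B)" .
  have "Q.prob ?O = exp (- measure \<mu> B) * measure \<mu> B ^ 0 / fact 0"
    by (rule poisson_process_count_law[OF Z B(1) B(3)])
  then have pO: "Q.prob ?O = exp (- measure \<mu> B)" by simp
  have I: "?I \<in> sets Q" and O: "?O \<in> sets Q" by measurable
  have sub: "?O \<union> ?I \<subseteq> ?V" by (auto simp: cell_masses_def nat_value_def fun_eq_iff)
  have "Q.prob (?O \<union> ?I) = Q.prob ?O + Q.prob ?I"
    by (rule Q.finite_measure_Union[OF O I]) auto
  moreover have "Q.prob (?O \<union> ?I) \<le> Q.prob ?V" by (rule Q.finite_measure_mono[OF sub V])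
  ultimately have "Q.prob ?I = 0" using pV pO measure_nonneg[of Q ?I] by linarith
  then have "emeasure Q ?I = 0" by (simp add: Q.emeasure_eq_measure)
  then show ?thesis by (intro AE_I[OF _ _ I]) auto
qed

lemma emeasure_restrict_upto:
  assumes \<eta>: "\<eta> \<in> lf_point_measures" and B: "B \<in> sets pos_borel"
  shows "emeasure (restrict_upto \<tau> \<eta>) B = emeasure \<eta> (B \<inter> {0<..\<tau>})"
proof -
  obtain J :: "nat set" and y where e: "\<eta> = dirac_sum J y" using \<eta> by (auto simp: lf_point_measures_def)
  have B': "B \<inter> {0<..\<tau>} \<in> sets pos_borel" using B by (auto simp: sets_pos_borel)
  have "{i \<in> {i \<in> J. y i \<le> \<tau>}. y i \<in> B} = {i \<in> J. y i \<in> B \<inter> {0<..\<tau>}}"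
    using B by (auto simp: sets_pos_borel)
  then show ?thesis
    unfolding e restrict_upto_dirac_sum emeasure_dirac_sum[OF B] emeasure_dirac_sum[OF B'] by simp
qed

lemma grid_counts_restrict_upto:
  assumes t: "0 < \<tau>" and \<eta>: "\<eta> \<in> lf_point_measures"
  shows "grid_counts \<tau> m (restrict_upto \<tau> \<eta>) = cell_masses (dyadic_index m) (dyadic_cell \<tau> m) \<eta>"
proof -
  have "emeasure (restrict_upto \<tau> \<eta>) (dyadic_cell \<tau> m k) = emeasure \<eta> (dyadic_cell \<tau> m k)"
    if k: "k \<in> dyadic_index m" for k
  proof -
    have "dyadic_cell \<tau> m k \<inter> {0<..\<tau>} = dyadic_cell \<tau> m k"
    proof (rule Int_absorb2, rule subset_trans[OF dyadic_cell_bounds[OF t k]])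
      have "0 < \<tau> / 2 ^ m" using t by simp
      then show "{\<tau> / 2 ^ m<..\<tau>} \<subseteq> {0<..\<tau>}" by (intro subsetI) (auto intro: less_trans)
    qed
    then show ?thesis using emeasure_restrict_upto[OF \<eta> dyadic_cell_pos[OF t]] by simp
  qed
  then show ?thesis by (auto simp: grid_counts_def cell_masses_def fun_eq_iff)
qed

lemma dyadic_cell_nonempty: "0 < \<tau> \<Longrightarrow> dyadic_cell \<tau> m k \<noteq> {}"
proof -
  assume t: "0 < \<tau>"
  have "\<tau> * real (Suc k) / 2 ^ m \<in> dyadic_cell \<tau> m k"
    using t by (auto simp: dyadic_cell_def intro!: divide_strict_right_mono)
  then show ?thesis by blast
qed

section \<open>Comparison of the point process with the Poisson process\<close>

locale poisson_comparison = prob_space P for P :: "'a measure" +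
  fixes I :: "'i set" and Y :: "'i \<Rightarrow> 'a \<Rightarrow> real"
    and Q :: "'b measure" and Z :: "'b \<Rightarrow> real measure" and \<tau> :: real
  assumes countable_I: "countable I"
    and indep: "indep_vars (\<lambda>_. borel) Y I"
    and prob_Q: "prob_space Q"
    and poisson_Z: "poisson_process Q (mean_measure P I Y) Z"
    and \<tau>_pos: "0 < \<tau>"
begin

abbreviation "\<mu> \<equiv> mean_measure P I Y"
abbreviation "N \<equiv> point_process I Y"

definition hit_prob :: "'i \<Rightarrow> real" where
  "hit_prob i = prob {w \<in> space P. Y i w \<in> {0<..\<tau>}}"

abbreviation law_Z :: "real measure measure" where
  "law_Z \<equiv> distr Q vague_borel (\<lambda>w. restrict_upto \<tau> (Z w))"

abbreviation law_N :: "real measure measure" where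
  "law_N \<equiv> distr P vague_borel (\<lambda>w. restrict_upto \<tau> (N w))"

lemma Y_measurable: "i \<in> I \<Longrightarrow> Y i \<in> borel_measurable P"
  using indep by (auto simp: indep_vars_def2)

lemma point_event:
  assumes "i \<in> I" "B \<in> sets borel"
  shows "{w \<in> space P. Y i w \<in> B} \<in> events"
  using measurable_sets[OF Y_measurable[OF assms(1)] assms(2)]
  by (simp add: vimage_def Int_def conj_commute)

lemma emeasure_\<mu>:
  "B \<in> sets pos_borel \<Longrightarrow> emeasure \<mu> B = (\<Sum>\<^sub>\<infinity>i\<in>I. ennreal (prob {w \<in> space P. Y i w \<in> B}))"
  by (rule emeasure_mean_measure[OF prob_space_axioms countable_I Y_measurable])

lemma hits_of_finite_mean:
  assumes B: "B \<in> sets pos_borel" and fin: "emeasure \<mu> B \<noteq> \<infinity>"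
  shows "(\<lambda>i. prob {w \<in> space P. Y i w \<in> B}) summable_on I"
    and "(\<Sum>\<^sub>\<infinity>i\<in>I. prob {w \<in> space P. Y i w \<in> B}) = measure \<mu> B"
proof -
  let ?p = "\<lambda>i. prob {w \<in> space P. Y i w \<in> B}"
  have f: "(\<Sum>\<^sub>\<infinity>i\<in>I. ennreal (?p i)) \<noteq> \<infinity>" using fin unfolding emeasure_\<mu>[OF B] .
  show "?p summable_on I" by (rule finite_infsum_ennreal(1)[OF _ f]) simp
  have "emeasure \<mu> B = ennreal (\<Sum>\<^sub>\<infinity>i\<in>I. ?p i)"
    unfolding emeasure_\<mu>[OF B] by (rule finite_infsum_ennreal(2)[OF _ f]) simp
  then show "(\<Sum>\<^sub>\<infinity>i\<in>I. ?p i) = measure \<mu> B"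
    by (simp add: measure_def infsum_nonneg)
qed

lemma indep_pointsI:
  assumes K: "finite K" and C: "\<And>k. k \<in> K \<Longrightarrow> C k \<in> sets pos_borel"
    "disjoint_family_on C K" "\<And>k. k \<in> K \<Longrightarrow> emeasure \<mu> (C k) \<noteq> \<infinity>"
  shows "indep_points P I Y K C"
proof (intro indep_points.intro indep_points_axioms.intro prob_space_axioms countable_I indep K C(2))
  show "(\<lambda>i. \<Sum>k\<in>K. prob {w \<in> space P. Y i w \<in> C k}) summable_on I"
    using K C(1,3)
  proof (induction K rule: finite_induct)
    case (insert k K)
    then show ?case by (simp add: summable_on_add hits_of_finite_mean(1))
  qed simp
next
  fix k assume "k \<in> K"
  then show "C k \<in> sets borel" using C(1) unfolding sets_pos_borel by blast
qed

lemma poisson_mean_eq: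
  assumes "indep_points P I Y K C" and C: "\<And>k. k \<in> K \<Longrightarrow> C k \<in> sets pos_borel"
    "\<And>k. k \<in> K \<Longrightarrow> emeasure \<mu> (C k) \<noteq> \<infinity>"
  shows "mpois K (indep_points.cell_mean P I Y C) = mpois K (\<lambda>k. measure \<mu> (C k))"
proof -
  interpret indep_points P I Y K C by fact
  have "cell_mean k = measure \<mu> (C k)" if "k \<in> K" for k
    unfolding cell_mean_def hit_def using hits_of_finite_mean(2)[OF C(1)[OF that] C(2)[OF that]] .
  then show ?thesis unfolding mpois_def by (intro Pi_pmf_cong) auto
qed

lemma \<mu>_locally_finite: "compact K \<Longrightarrow> K \<subseteq> {0<..} \<Longrightarrow> emeasure \<mu> K \<noteq> \<infinity>"
  by (rule poisson_process_mean_locally_finite[OF prob_Q poisson_Z])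

lemma dyadic_cell_mean_finite:
  assumes "k \<in> dyadic_index m"
  shows "emeasure \<mu> (dyadic_cell \<tau> m k) \<noteq> \<infinity>"
proof -
  have pos: "0 < \<tau> / 2 ^ m" using \<tau>_pos by simp
  have sub: "{\<tau> / 2 ^ m..\<tau>} \<subseteq> {0<..}" using pos by (auto intro: less_le_trans)
  have fin: "emeasure \<mu> {\<tau> / 2 ^ m..\<tau>} \<noteq> \<infinity>"
    by (rule \<mu>_locally_finite[OF compact_Icc sub])
  have s: "sets \<mu> = sets pos_borel"
    unfolding mean_measure_def using sets.sigma_sets_eq[of pos_borel]
    by (subst sets_measure_of) (auto simp: sets_pos_borel space_restrict_space)
  have "emeasure \<mu> (dyadic_cell \<tau> m k) \<le> emeasure \<mu> {\<tau> / 2 ^ m..\<tau>}"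
  proof (rule emeasure_mono)
    show "dyadic_cell \<tau> m k \<subseteq> {\<tau> / 2 ^ m..\<tau>}"
      by (rule subset_trans[OF dyadic_cell_bounds[OF \<tau>_pos assms] greaterThanAtMost_subseteq_atLeastAtMost_iff[THEN iffD2]]) simp
    show "{\<tau> / 2 ^ m..\<tau>} \<in> sets \<mu>" unfolding s sets_pos_borel using sub by simp
  qed
  then show ?thesis using fin by (auto simp: top_unique)
qed

lemma dyadic_indep_points: "indep_points P I Y (dyadic_index m) (dyadic_cell \<tau> m)"
  by (rule indep_pointsI)
     (use dyadic_cell_pos[OF \<tau>_pos] dyadic_cells_disjoint[OF \<tau>_pos] dyadic_cell_mean_finite in
       \<open>auto simp: dyadic_index_def\<close>)

text \<open>The almost sure event on which the points form an element of \<open>\<H>\<close>; outside it, \<open>N\<close> is the zero measure.\<close>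

definition regular :: "'a set" where
  "regular = {w \<in> space P. dirac_sum I (\<lambda>i. Y i w) \<in> lf_point_measures}"

lemma window_event:
  "i \<in> I \<Longrightarrow> {w \<in> space P. a \<le> Y i w \<and> Y i w \<le> b} \<in> events"
  using point_event[of i "{a..b}"] by simp

lemma regular_event: "regular \<in> events"
proof -
  have "regular = {w \<in> space P. \<forall>n::nat. finite {i \<in> I. 1 / real (Suc n) \<le> Y i w \<and> Y i w \<le> real (Suc n)}}"
    unfolding regular_def dirac_sum_in_lf[OF countable_I] ..
  also have "\<dots> \<in> events"
    by (intro sets.sets_Collect_countable_All measurable_card_indices(2)[OF countable_I] window_event)
  finally show ?thesis .
qed

lemma AE_regular: "AE w in P. w \<in> regular"
proof -
  have "AE w in P. finite {i \<in> I. 1 / real (Suc n) \<le> Y i w \<and> Y i w \<le> real (Suc n)}" for n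
  proof (rule borel_cantelli_countable[OF countable_I window_event])
    have "0 < 1 / real (Suc n)" by simp
    then have sub: "{1 / real (Suc n)..real (Suc n)} \<subseteq> {0<..}"
      using less_le_trans[of 0 "1 / real (Suc n)"] by auto
    then have B: "{1 / real (Suc n)..real (Suc n)} \<in> sets pos_borel" by (simp add: sets_pos_borel)
    have "(\<lambda>i. prob {w \<in> space P. Y i w \<in> {1 / real (Suc n)..real (Suc n)}}) summable_on I"
      by (rule hits_of_finite_mean(1)[OF B \<mu>_locally_finite[OF compact_Icc sub]])
    then show "(\<lambda>i. prob {w \<in> space P. 1 / real (Suc n) \<le> Y i w \<and> Y i w \<le> real (Suc n)}) summable_on I"
      by (simp only: atLeastAtMost_iff)
  qed
  then have "AE w in P. \<forall>n::nat. finite {i \<in> I. 1 / real (Suc n) \<le> Y i w \<and> Y i w \<le> real (Suc n)}"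
    by (simp only: AE_all_countable) blast
  then show ?thesis
    using AE_space by eventually_elim (simp only: regular_def dirac_sum_in_lf[OF countable_I] mem_Collect_eq simp_thms)
qed

lemma N_regular: "w \<in> regular \<Longrightarrow> N w = dirac_sum I (\<lambda>i. Y i w)"
  by (simp add: regular_def point_process_def)

lemma N_irregular: "w \<in> space P \<Longrightarrow> w \<notin> regular \<Longrightarrow> N w = null_measure pos_borel"
  by (simp add: regular_def point_process_def)

lemma null_measure_eq_dirac_sum: "null_measure pos_borel = dirac_sum ({} :: nat set) (\<lambda>_. 0)"
  by (rule measure_eqI) (auto simp: emeasure_dirac_sum)

lemma null_measure_lf: "null_measure pos_borel \<in> lf_point_measures"
  unfolding null_measure_eq_dirac_sum by (subst dirac_sum_in_lf) auto

lemma N_lf: "w \<in> space P \<Longrightarrow> N w \<in> lf_point_measures"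
  using null_measure_lf by (simp add: point_process_def)

lemma Z_lf: "w \<in> space Q \<Longrightarrow> Z w \<in> lf_point_measures"
  by (rule poisson_process_lf[OF poisson_Z])

lemma grid_counts_N:
  assumes w: "w \<in> regular"
  shows "grid_counts \<tau> m (restrict_upto \<tau> (N w))
     = cell_counts (dyadic_index m) (dyadic_cell \<tau> m) I (\<lambda>i. Y i w)"
proof -
  have "w \<in> space P" using w by (simp add: regular_def)
  then have lf: "dirac_sum I (\<lambda>i. Y i w) \<in> lf_point_measures" using w by (simp add: regular_def)
  have "grid_counts \<tau> m (restrict_upto \<tau> (N w)) = cell_masses (dyadic_index m) (dyadic_cell \<tau> m) (N w)"
    by (rule grid_counts_restrict_upto[OF \<tau>_pos N_lf]) fact
  also have "\<dots> = grid_counts \<tau> m (N w)" by (simp add: cell_masses_def grid_counts_def)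
  also have "\<dots> = cell_counts (dyadic_index m) (dyadic_cell \<tau> m) I (\<lambda>i. Y i w)"
    unfolding N_regular[OF w] by (rule grid_counts_dirac_sum(1)[OF \<tau>_pos lf])
  finally show ?thesis .
qed

text \<open>Changing the condition to a constant on the null set of irregular outcomes affects neither measurability
nor the probability.\<close>

lemma modified_event:
  assumes A: "{w \<in> space P. R w} \<in> events"
    and reg: "\<And>w. w \<in> regular \<Longrightarrow> T w \<longleftrightarrow> R w"
    and irr: "\<And>w. w \<in> space P \<Longrightarrow> w \<notin> regular \<Longrightarrow> T w \<longleftrightarrow> c"
  shows "{w \<in> space P. T w} \<in> events" "prob {w \<in> space P. T w} = prob {w \<in> space P. R w}"
proof -
  have "{w \<in> space P. T w} = (regular \<inter> {w \<in> space P. R w}) \<union> ((space P - regular) \<inter> (if c then space P else {}))"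
    using reg irr by (auto simp: regular_def)
  also have "\<dots> \<in> events" using regular_event A by auto
  finally show T: "{w \<in> space P. T w} \<in> events" .
  have "AE w in P. w \<in> {w \<in> space P. T w} \<longleftrightarrow> w \<in> {w \<in> space P. R w}"
    using AE_regular by eventually_elim (simp add: reg)
  then show "prob {w \<in> space P. T w} = prob {w \<in> space P. R w}"
    by (rule finite_measure_eq_AE[OF _ T A])
qed

lemma N_grid_event:
  "{w \<in> space P. grid_counts \<tau> m (restrict_upto \<tau> (N w)) \<in> E} \<in> events"
  "prob {w \<in> space P. grid_counts \<tau> m (restrict_upto \<tau> (N w)) \<in> E}
     = prob {w \<in> space P. cell_counts (dyadic_index m) (dyadic_cell \<tau> m) I (\<lambda>i. Y i w) \<in> E}"
proof -
  interpret grid: indep_points P I Y "dyadic_index m" "dyadic_cell \<tau> m" by (rule dyadic_indep_points)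
  note ev = grid.cell_counts_event[OF subset_refl, of E]
  show "{w \<in> space P. grid_counts \<tau> m (restrict_upto \<tau> (N w)) \<in> E} \<in> events"
    by (rule modified_event(1)[OF ev, where c="grid_counts \<tau> m (restrict_upto \<tau> (null_measure pos_borel)) \<in> E"])
       (simp_all only: grid_counts_N N_irregular simp_thms)
  show "prob {w \<in> space P. grid_counts \<tau> m (restrict_upto \<tau> (N w)) \<in> E}
     = prob {w \<in> space P. cell_counts (dyadic_index m) (dyadic_cell \<tau> m) I (\<lambda>i. Y i w) \<in> E}"
    by (rule modified_event(2)[OF ev, where c="grid_counts \<tau> m (restrict_upto \<tau> (null_measure pos_borel)) \<in> E"])
       (simp_all only: grid_counts_N N_irregular simp_thms)
qed

lemma Z_grid_event:
  "{w \<in> space Q. grid_counts \<tau> m (restrict_upto \<tau> (Z w)) \<in> E} \<in> sets Q"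
  "measure Q {w \<in> space Q. grid_counts \<tau> m (restrict_upto \<tau> (Z w)) \<in> E}
     = measure (mpois (dyadic_index m) (\<lambda>k. measure \<mu> (dyadic_cell \<tau> m k))) E"
proof -
  have eq: "{w \<in> space Q. grid_counts \<tau> m (restrict_upto \<tau> (Z w)) \<in> E}
    = {w \<in> space Q. cell_masses (dyadic_index m) (dyadic_cell \<tau> m) (Z w) \<in> E}"
    using grid_counts_restrict_upto[OF \<tau>_pos Z_lf] by auto
  have K: "finite (dyadic_index m)" by (simp add: dyadic_index_def)
  note cells = poisson_process_cells[OF prob_Q poisson_Z K dyadic_cell_pos[OF \<tau>_pos]
      dyadic_cell_nonempty[OF \<tau>_pos] dyadic_cells_disjoint[OF \<tau>_pos] dyadic_cell_mean_finite]
  show "{w \<in> space Q. grid_counts \<tau> m (restrict_upto \<tau> (Z w)) \<in> E} \<in> sets Q"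
    unfolding eq by (rule cells(1))
  show "measure Q {w \<in> space Q. grid_counts \<tau> m (restrict_upto \<tau> (Z w)) \<in> E}
     = measure (mpois (dyadic_index m) (\<lambda>k. measure \<mu> (dyadic_cell \<tau> m k))) E"
    unfolding eq by (rule cells(2))
qed

lemma hit_prob_bounds: "0 \<le> hit_prob i" "hit_prob i \<le> 1"
  by (auto simp: hit_prob_def)

text \<open>The bound for the counts is uniform in the grid, because the cells of every grid lie in \<open>(0,\<tau>]\<close>.\<close>

lemma tv_upper:
  assumes s: "(\<lambda>i. (hit_prob i)\<^sup>2) summable_on I"
  shows "tv_dist law_Z law_N \<le> (\<Sum>\<^sub>\<infinity>i\<in>I. (hit_prob i)\<^sup>2)"
proof (rule tv_dist_le)
  fix A assume "A \<in> sets law_Z"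
  then have A: "A \<in> sets vague_borel" by simp
  show "\<bar>measure law_Z A - measure law_N A\<bar> \<le> (\<Sum>\<^sub>\<infinity>i\<in>I. (hit_prob i)\<^sup>2)"
  proof (rule law_bound_from_grid[OF \<tau>_pos prob_Q prob_space_axioms _ _ Z_grid_event(1) N_grid_event(1) _ A])
    show "restrict_upto \<tau> (Z w) \<in> lf_upto \<tau>" if "w \<in> space Q" for w
      by (rule restrict_upto_in_lf_upto[OF Z_lf[OF that]])
    show "restrict_upto \<tau> (N w) \<in> lf_upto \<tau>" if "w \<in> space P" for w
      by (rule restrict_upto_in_lf_upto[OF N_lf[OF that]])
    fix m E
    interpret grid: indep_points P I Y "dyadic_index m" "dyadic_cell \<tau> m" by (rule dyadic_indep_points)
    have le: "grid.hits i \<le> hit_prob i" if i: "i \<in> I" for i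
      unfolding grid.hits_eq[OF i] hit_prob_def
    proof (rule finite_measure_mono[OF _ point_event[OF i]])
      have "0 < \<tau> / 2 ^ m" using \<tau>_pos by simp
      then show "{w \<in> space P. Y i w \<in> (\<Union>k\<in>dyadic_index m. dyadic_cell \<tau> m k)} \<subseteq> {w \<in> space P. Y i w \<in> {0<..\<tau>}}"
      proof (intro Collect_mono impI conjI; elim conjE)
        fix w assume "0 < \<tau> / 2 ^ m" and "Y i w \<in> (\<Union>k\<in>dyadic_index m. dyadic_cell \<tau> m k)"
        then have "Y i w \<in> {\<tau> / 2 ^ m<..\<tau>}" using dyadic_cell_bounds[OF \<tau>_pos, of _ m] by blast
        then show "Y i w \<in> {0<..\<tau>}" using \<open>0 < \<tau> / 2 ^ m\<close> by (auto intro: less_trans)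
      qed
      show "{0<..\<tau>} \<in> sets borel" by simp
    qed
    have mean: "mpois (dyadic_index m) grid.cell_mean
       = mpois (dyadic_index m) (\<lambda>k. measure \<mu> (dyadic_cell \<tau> m k))"
      by (rule poisson_mean_eq[OF dyadic_indep_points dyadic_cell_pos[OF \<tau>_pos] dyadic_cell_mean_finite])
    have "\<bar>measure Q {w \<in> space Q. grid_counts \<tau> m (restrict_upto \<tau> (Z w)) \<in> E} -
        prob {w \<in> space P. grid_counts \<tau> m (restrict_upto \<tau> (N w)) \<in> E}\<bar>
      \<le> (\<Sum>\<^sub>\<infinity>i\<in>I. (grid.hits i)\<^sup>2)"
      using grid.cell_counts_upper[of E] unfolding Z_grid_event(2) N_grid_event(2) mean
      by (subst abs_minus_commute)
    also have "\<dots> \<le> (\<Sum>\<^sub>\<infinity>i\<in>I. (hit_prob i)\<^sup>2)"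
      by (rule infsum_mono[OF grid.hits_sq_summable s]) (rule power_mono[OF le grid.hits_nonneg])
    finally show "\<bar>measure Q {w \<in> space Q. grid_counts \<tau> m (restrict_upto \<tau> (Z w)) \<in> E} -
        prob {w \<in> space P. grid_counts \<tau> m (restrict_upto \<tau> (N w)) \<in> E}\<bar>
      \<le> (\<Sum>\<^sub>\<infinity>i\<in>I. (hit_prob i)\<^sup>2)" .
  qed
qed

lemma Z_restricted_measurable: "(\<lambda>w. restrict_upto \<tau> (Z w)) \<in> Q \<rightarrow>\<^sub>M vague_borel"
  by (rule measurable_vague[OF \<tau>_pos restrict_upto_in_lf_upto[OF Z_lf] Z_grid_event(1)])

lemma N_restricted_measurable: "(\<lambda>w. restrict_upto \<tau> (N w)) \<in> P \<rightarrow>\<^sub>M vague_borel"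
  by (rule measurable_vague[OF \<tau>_pos restrict_upto_in_lf_upto[OF N_lf] N_grid_event(1)])

text \<open>The events \<open>A\<close> used here depend only on the total mass, whose laws under the two processes are a Poisson law and the
law of a sum of independent indicators. The set \<open>E\<close> consists of vectors indexed by the single cell \<open>0\<close>, and \<open>?vec\<close>
identifies them with numbers.\<close>

lemma tv_lower:
  assumes fin: "emeasure \<mu> {0<..\<tau>} \<noteq> \<infinity>"
  shows "(\<Sum>\<^sub>\<infinity>i\<in>I. (hit_prob i)\<^sup>2) \<le> 24 * max 1 (\<Sum>\<^sub>\<infinity>i\<in>I. hit_prob i) * tv_dist law_Z law_N"
proof -
  interpret Q: prob_space Q by (rule prob_Q)
  let ?K = "{0::nat}"
  let ?C = "\<lambda>_::nat. {0<..\<tau>}"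
  have B: "{0<..\<tau>} \<in> sets pos_borel" "{0<..\<tau>} \<noteq> {}" using \<tau>_pos by (auto simp: sets_pos_borel)
  have disj: "disjoint_family_on ?C ?K" by (simp add: disjoint_family_on_def)
  have ip: "indep_points P I Y ?K ?C" by (rule indep_pointsI[OF _ B(1) disj fin]) simp
  interpret one: indep_points P I Y ?K ?C by (rule ip)
  have hits: "one.hits i = hit_prob i" for i
    by (simp add: one.hits_def one.hit_def hit_prob_def)
  have "\<bar>prob {w \<in> space P. cell_counts ?K ?C I (\<lambda>i. Y i w) \<in> E} - measure (mpois ?K one.cell_mean) E\<bar>
     \<le> tv_dist law_Z law_N" for E
  proof -
    let ?vec = "\<lambda>n k::nat. if k = 0 then n else (0::nat)"
    define A where "A = {\<eta> \<in> lf_point_measures. \<exists>n\<in>{n. ?vec n \<in> E}. emeasure \<eta> {0<..} = of_nat n}"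
    have A: "A \<in> sets vague_borel" unfolding A_def by (rule total_mass_event)
    have mass: "emeasure (restrict_upto \<tau> \<eta>) {0<..} = emeasure \<eta> {0<..\<tau>}" if "\<eta> \<in> lf_point_measures" for \<eta>
    proof -
      have "{0<..} \<inter> {0<..\<tau>} = {0<..\<tau>}" by auto
      then show ?thesis using emeasure_restrict_upto[OF that, of "{0<..}" \<tau>] by (simp add: sets_pos_borel)
    qed
    have lfr: "restrict_upto \<tau> \<eta> \<in> lf_point_measures" if "\<eta> \<in> lf_point_measures" for \<eta>
      using restrict_upto_in_lf_upto[OF that, of \<tau>] by (simp add: lf_upto_def)
    have in_A: "restrict_upto \<tau> \<eta> \<in> A \<longleftrightarrow> cell_masses ?K ?C \<eta> \<in> E"
      if lf: "\<eta> \<in> lf_point_measures" and f: "emeasure \<eta> {0<..\<tau>} \<noteq> \<infinity>" for \<eta>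
    proof -
      obtain J :: "nat set" and y where e: "\<eta> = dirac_sum J y" using lf unfolding lf_point_measures_def by blast
      then obtain n where n: "emeasure \<eta> {0<..\<tau>} = of_nat n"
        using f emeasure_dirac_sum[OF B(1), of J y] by (auto split: if_splits)
      have "cell_masses ?K ?C \<eta> = ?vec n" using n by (auto simp: cell_masses_def fun_eq_iff)
      then show ?thesis using lfr[OF lf] by (simp add: A_def mass[OF lf] n)
    qed
    note cells = poisson_process_cells[OF prob_Q poisson_Z finite.insertI[OF finite.emptyI] B(1) B(2) disj fin]
    have lawZ: "measure law_Z A = measure (mpois ?K one.cell_mean) E"
    proof -
      have ZA: "{w \<in> space Q. restrict_upto \<tau> (Z w) \<in> A} \<in> sets Q"
        using measurable_sets[OF Z_restricted_measurable A] by (simp add: vimage_def Int_def conj_commute)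
      have "measure law_Z A = measure Q {w \<in> space Q. restrict_upto \<tau> (Z w) \<in> A}"
        using measure_distr[OF Z_restricted_measurable A] by (simp add: vimage_def Int_def conj_commute)
      also have "\<dots> = measure Q {w \<in> space Q. cell_masses ?K ?C (Z w) \<in> E}"
      proof (rule Q.finite_measure_eq_AE[OF _ ZA cells(1)])
        show "AE w in Q. w \<in> {w \<in> space Q. restrict_upto \<tau> (Z w) \<in> A} \<longleftrightarrow> w \<in> {w \<in> space Q. cell_masses ?K ?C (Z w) \<in> E}"
          using poisson_process_mass_finite[OF prob_Q poisson_Z B fin] AE_space
          by eventually_elim (simp add: in_A Z_lf)
      qed
      also have "\<dots> = measure (mpois ?K (\<lambda>k. measure \<mu> (?C k))) E" by (rule cells(2))
      also have "\<dots> = measure (mpois ?K one.cell_mean) E"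
        by (subst poisson_mean_eq[OF ip B(1) fin]) simp
      finally show ?thesis .
    qed
    have lawN: "measure law_N A = prob {w \<in> space P. cell_counts ?K ?C I (\<lambda>i. Y i w) \<in> E}"
    proof -
      have NA: "{w \<in> space P. restrict_upto \<tau> (N w) \<in> A} \<in> events"
        using measurable_sets[OF N_restricted_measurable A] by (simp add: vimage_def Int_def conj_commute)
      have "measure law_N A = prob {w \<in> space P. restrict_upto \<tau> (N w) \<in> A}"
        using measure_distr[OF N_restricted_measurable A] by (simp add: vimage_def Int_def conj_commute)
      also have "\<dots> = prob {w \<in> space P. cell_counts ?K ?C I (\<lambda>i. Y i w) \<in> E}"
      proof (rule finite_measure_eq_AE[OF _ NA one.cell_counts_event[OF subset_refl]])
        have hit_fin: "AE w in P. finite {i \<in> I. Y i w \<in> {0<..\<tau>}}"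
          by (rule borel_cantelli_countable[OF countable_I point_event hits_of_finite_mean(1)[OF B(1) fin]]) simp_all
        show "AE w in P. w \<in> {w \<in> space P. restrict_upto \<tau> (N w) \<in> A}
           \<longleftrightarrow> w \<in> {w \<in> space P. cell_counts ?K ?C I (\<lambda>i. Y i w) \<in> E}"
          using hit_fin AE_regular AE_space
        proof eventually_elim
          fix w assume w: "finite {i \<in> I. Y i w \<in> {0<..\<tau>}}" "w \<in> regular" "w \<in> space P"
          have em: "emeasure (N w) {0<..\<tau>} = of_nat (card {i \<in> I. Y i w \<in> {0<..\<tau>}})"
            unfolding N_regular[OF w(2)] emeasure_dirac_sum[OF B(1)] using w(1) by (simp only: if_True)
          have "cell_masses ?K ?C (N w) = cell_counts ?K ?C I (\<lambda>i. Y i w)"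
            by (simp only: cell_masses_def cell_counts_def em nat_value_of_nat)
          moreover have "emeasure (N w) {0<..\<tau>} \<noteq> \<infinity>" unfolding em by simp
          ultimately show "w \<in> {w \<in> space P. restrict_upto \<tau> (N w) \<in> A}
           \<longleftrightarrow> w \<in> {w \<in> space P. cell_counts ?K ?C I (\<lambda>i. Y i w) \<in> E}"
            using in_A[OF N_lf[OF w(3)]] w(3) by simp
        qed
      qed
      finally show ?thesis .
    qed
    have "\<bar>measure law_Z A - measure law_N A\<bar> \<le> tv_dist law_Z law_N"
      by (rule tv_dist_ge[OF Q.prob_space_distr[OF Z_restricted_measurable] prob_space_distr[OF N_restricted_measurable]])
         (use A in simp)
    then show ?thesis unfolding lawZ lawN by (simp only: abs_minus_commute)
  qed
  from one.cell_counts_lower[OF refl this] show ?thesis by (simp only: hits)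
qed

end

theorem theorem2p2:
  fixes I :: "'i set"
    and x :: "'i \<Rightarrow> real ^ 'd"
    and g :: "real ^ 'd \<Rightarrow> real"
    and P :: "'a measure"
    and S :: "'a \<Rightarrow> real"
    and S' :: "'i \<Rightarrow> 'a \<Rightarrow> real"
    and Q :: "'b measure"
    and Z :: "'b \<Rightarrow> real measure"
    and \<tau> :: real
    and Y :: "'i \<Rightarrow> 'a \<Rightarrow> real"
    and N :: "'a \<Rightarrow> real measure"
    and p :: "'i \<Rightarrow> real \<Rightarrow> real"
    and M :: "real \<Rightarrow> ennreal"
  assumes "countable I"
    and "locally_finite_subset (- {0}) (x ` I)"
    and "g \<in> borel_measurable borel"
    and "\<And>y. 0 \<le> g y"
    and "locally_finite_subset {0..} (g ` x ` I)"
    and "prob_space P"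
    and "prob_space.indep_vars P (\<lambda>_. borel) (case_option S S') (insert None (Some ` I))"
    and "\<And>i. i \<in> I \<Longrightarrow> distr P borel (S' i) = distr P borel S"
    and "AE \<omega> in P. 0 < S \<omega>"
    and "Y = (\<lambda>i \<omega>. g (x i) / S' i \<omega>)"
    and "N = point_process I Y"
    and "p = (\<lambda>i t. measure P {\<omega> \<in> space P. 0 < g (x i) / S \<omega> \<and> g (x i) / S \<omega> \<le> t})"
    and "M = (\<lambda>t. \<Sum>\<^sub>\<infinity>i\<in>I. ennreal (p i t))"
    and "prob_space Q"
    and "poisson_process Q (mean_measure P I Y) Z"
    and "0 < \<tau>"
  shows "min 1 (inverse (M \<tau>)) / 32 * (\<Sum>\<^sub>\<infinity>i\<in>I. ennreal ((p i \<tau>)\<^sup>2))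
           \<le> ennreal (tv_dist (distr Q vague_borel (\<lambda>\<omega>. restrict_upto \<tau> (Z \<omega>)))
                              (distr P vague_borel (\<lambda>\<omega>. restrict_upto \<tau> (N \<omega>))))
         \<and> ennreal (tv_dist (distr Q vague_borel (\<lambda>\<omega>. restrict_upto \<tau> (Z \<omega>)))
                          (distr P vague_borel (\<lambda>\<omega>. restrict_upto \<tau> (N \<omega>))))
           \<le> (\<Sum>\<^sub>\<infinity>i\<in>I. ennreal ((p i \<tau>)\<^sup>2))
         \<and> (\<Sum>\<^sub>\<infinity>i\<in>I. ennreal ((p i \<tau>)\<^sup>2)) \<le> M \<tau> * (SUP i\<in>I. ennreal (p i \<tau>))"
proof -
  interpret P: prob_space P by fact
  note indS = assms(7)
  have S: "S \<in> borel_measurable P" using indS by (auto simp: P.indep_vars_def2)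
  have S': "S' i \<in> borel_measurable P" if "i \<in> I" for i
    using indS that by (auto simp: P.indep_vars_def2)
  have "P.indep_vars (\<lambda>_. borel) (case_option S S') (Some ` I)"
    by (rule P.indep_vars_subset[OF indS]) auto
  then have "P.indep_vars (\<lambda>_. borel) (\<lambda>i. case_option S S' (Some i)) I"
    by (rule P.indep_vars_reindex_inj) simp
  then have indS': "P.indep_vars (\<lambda>_. borel) S' I" by simp
  have quot: "(\<lambda>s. c / s) \<in> borel_measurable borel" for c :: real by measurable
  have indY: "P.indep_vars (\<lambda>_. borel) Y I"
    unfolding assms(10) by (rule P.indep_vars_compose2[OF indS' quot])
  interpret poisson_comparison P I Y Q Z \<tau>
    by (intro poisson_comparison.intro poisson_comparison_axioms.intro assms(1,6,14,15,16) indY)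
  have hit: "hit_prob i = p i \<tau>" if i: "i \<in> I" for i
  proof -
    let ?B = "{s. g (x i) / s \<in> {0<..\<tau>}}"
    have B: "?B \<in> sets borel" using measurable_sets[OF quot, of "{0<..\<tau>}" "g (x i)"] by (simp add: vimage_def)
    have "hit_prob i = P.prob {w \<in> space P. Y i w \<in> {0<..\<tau>}}" by (rule hit_prob_def)
    also have "\<dots> = P.prob (S' i -` ?B \<inter> space P)"
      by (rule arg_cong[where f="measure P"]) (auto simp: assms(10))
    also have "\<dots> = measure (distr P borel (S' i)) ?B" by (rule measure_distr[OF S'[OF i] B, symmetric])
    also have "\<dots> = measure (distr P borel S) ?B" using assms(8)[OF i] by simp
    also have "\<dots> = p i \<tau>"
      unfolding assms(12) measure_distr[OF S B] by (rule arg_cong[where f="measure P"]) auto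
    finally show ?thesis .
  qed
  let ?tv = "tv_dist (distr Q vague_borel (\<lambda>w. restrict_upto \<tau> (Z w)))
                     (distr P vague_borel (\<lambda>w. restrict_upto \<tau> (N w)))"
  let ?s = "\<Sum>\<^sub>\<infinity>i\<in>I. ennreal ((p i \<tau>)\<^sup>2)"
  have tv: "?tv = tv_dist law_Z law_N" unfolding assms(11) ..
  have s_eq: "?s = (\<Sum>\<^sub>\<infinity>i\<in>I. ennreal ((hit_prob i)\<^sup>2))" by (rule infsum_cong) (simp add: hit)
  have M_eq: "M \<tau> = (\<Sum>\<^sub>\<infinity>i\<in>I. ennreal (hit_prob i))"
    unfolding assms(13) by (rule infsum_cong) (simp add: hit)
  have p0: "0 \<le> p i \<tau>" for i by (simp add: assms(12))
  have upper: "ennreal ?tv \<le> ?s"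
  proof (cases "?s = \<infinity>")
    case False
    have nn: "0 \<le> (hit_prob i)\<^sup>2" for i by simp
    have f: "(\<Sum>\<^sub>\<infinity>i\<in>I. ennreal ((hit_prob i)\<^sup>2)) \<noteq> \<infinity>" using False unfolding s_eq .
    show ?thesis
      unfolding tv s_eq finite_infsum_ennreal(2)[OF nn f]
      by (rule ennreal_leI[OF tv_upper[OF finite_infsum_ennreal(1)[OF nn f]]])
  qed simp
  have lower: "min 1 (inverse (M \<tau>)) / 32 * ?s \<le> ennreal ?tv"
  proof (cases "M \<tau> = \<infinity>")
    case True
    then show ?thesis by simp
  next
    case False
    have f: "(\<Sum>\<^sub>\<infinity>i\<in>I. ennreal (hit_prob i)) \<noteq> \<infinity>" using False unfolding M_eq .
    note sm = finite_infsum_ennreal[OF hit_prob_bounds(1) f]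
    have sq: "(\<lambda>i. (hit_prob i)\<^sup>2) summable_on I"
      by (rule summable_on_comparison_test[OF sm(1)])
         (use hit_prob_bounds in \<open>auto simp: power2_eq_square mult_left_le\<close>)
    have s_real: "?s = ennreal (\<Sum>\<^sub>\<infinity>i\<in>I. (hit_prob i)\<^sup>2)"
    proof -
      have "(\<Sum>\<^sub>\<infinity>i\<in>I. ennreal ((hit_prob i)\<^sup>2)) \<le> (\<Sum>\<^sub>\<infinity>i\<in>I. ennreal (hit_prob i))"
        by (rule infsum_mono)
           (use hit_prob_bounds in \<open>auto simp: power2_eq_square mult_left_le
              intro!: ennreal_leI nonneg_summable_on_complete\<close>)
      then have "(\<Sum>\<^sub>\<infinity>i\<in>I. ennreal ((hit_prob i)\<^sup>2)) \<noteq> \<infinity>" using f by (auto simp: top_unique)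
      then show ?thesis unfolding s_eq by (rule finite_infsum_ennreal(2)[rotated]) simp
    qed
    let ?l = "\<Sum>\<^sub>\<infinity>i\<in>I. hit_prob i"
    let ?m = "max 1 ?l"
    have l0: "0 \<le> ?l" by (rule infsum_nonneg) (rule hit_prob_bounds)
    have B: "{0<..\<tau>} \<in> sets pos_borel" by (auto simp: sets_pos_borel)
    have "emeasure \<mu> {0<..\<tau>} \<noteq> \<infinity>"
      unfolding emeasure_\<mu>[OF B] using f unfolding hit_prob_def .
    from tv_lower[OF this] have low: "(\<Sum>\<^sub>\<infinity>i\<in>I. (hit_prob i)\<^sup>2) \<le> 24 * ?m * ?tv" unfolding tv .
    have "min 1 (inverse (M \<tau>)) = ennreal (1 / ?m)"
    proof (cases "?l \<le> 1")
      case True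
      \<comment> \<open>This includes \<open>l = 0\<close>, whose inverse is infinite.\<close>
      have "1 \<le> inverse (ennreal ?l)"
      proof (cases "?l = 0")
        case True
        then show ?thesis by simp
      next
        case False
        then have "inverse (ennreal ?l) = ennreal (inverse ?l)" using l0 by (intro inverse_ennreal) simp
        moreover have "1 \<le> inverse ?l" using False l0 True by (simp add: one_le_inverse)
        ultimately show ?thesis by simp
      qed
      then show ?thesis using True unfolding M_eq sm(2) by (simp add: min_def max_def)
    next
      case False
      then have "inverse (ennreal ?l) = ennreal (inverse ?l)" by (intro inverse_ennreal) simp
      moreover have "inverse ?l \<le> 1" using False by (simp add: inverse_le_1_iff)
      ultimately show ?thesis using False unfolding M_eq sm(2) by (simp add: min_def max_def inverse_eq_divide)
    qed
    then have "min 1 (inverse (M \<tau>)) / 32 * ?s = ennreal (1 / ?m / 32 * (\<Sum>\<^sub>\<infinity>i\<in>I. (hit_prob i)\<^sup>2))"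
    proof -
      have scale: "ennreal u / 32 * ennreal v = ennreal (u / 32 * v)" if "0 \<le> u" "0 \<le> v" for u v
      proof -
        have "ennreal u / 32 = ennreal (u / 32)" using divide_ennreal[OF that(1), of 32] by simp
        then show ?thesis using ennreal_mult[of "u / 32" v] that by simp
      qed
      assume "min 1 (inverse (M \<tau>)) = ennreal (1 / ?m)"
      then show ?thesis
        unfolding s_real by (simp only:) (rule scale, auto intro: infsum_nonneg)
    qed
    also have "\<dots> \<le> ennreal ?tv"
    proof (rule ennreal_leI)
      have t0: "0 \<le> ?tv"
      proof -
        have "0 \<le> (\<Sum>\<^sub>\<infinity>i\<in>I. (hit_prob i)\<^sup>2)" by (rule infsum_nonneg) simp
        then have "0 \<le> (24 * ?m) * ?tv" using low by linarith
        then show ?thesis by (subst (asm) zero_le_mult_iff) auto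
      qed
      have "1 / ?m / 32 * (\<Sum>\<^sub>\<infinity>i\<in>I. (hit_prob i)\<^sup>2) \<le> 1 / ?m / 32 * (24 * ?m * ?tv)"
        by (rule mult_left_mono[OF low]) simp
      also have "\<dots> = 3 / 4 * ?tv" by simp
      also have "\<dots> \<le> ?tv" using t0 by simp
      finally show "1 / ?m / 32 * (\<Sum>\<^sub>\<infinity>i\<in>I. (hit_prob i)\<^sup>2) \<le> ?tv" .
    qed
    finally show ?thesis .
  qed
  have third: "?s \<le> M \<tau> * (SUP i\<in>I. ennreal (p i \<tau>))"
    unfolding assms(13) by (rule infsum_ennreal_le_mult_SUP) (rule p0)
  show ?thesis using lower upper third by blast
qed

end
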